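(* Consider $n$ independent types of stations: for $i\in[n]$, initial positions form a homogeneous Poisson point process on $\mathbb R^2$ of intensity $\lambda_i$, each station moves at speed $v_i$ in an independent uniform direction, with $v_1>v_2>\dots>v_n$; let $\lambda=\sum_i\lambda_i$. Then: (i) $\Lambda_i=\frac{4v_i\sqrt\lambda}{\pi}\big(\frac{\lambda_i}{\lambda}\big)^2$ for $i\in[n]$; (ii) for every $i\neq j$, $\Lambda^{(1)}_{i,j}=\Lambda^{(2)}_{j,i}$ and $\Lambda^{(2)}_{i,j}=\Lambda^{(1)}_{j,i}$; (iii) for every $j<i$ and $k\in\{1,2\}$, $$\Lambda^{(k)}_{i,j}=4\lambda_i\lambda_jv_iv_j\int_0^\infty\Big[\int_0^{h_j}\int_{t^*}^\infty e^{-\lambda\pi\hat h_k^2(t,h_j,h_i)}dt\,dh_i+\int_{h_j}^\infty\int_0^\infty e^{-\lambda\pi\hat h_k^2(t,h_j,h_i)}dt\,dh_i\Big]dh_j,$$ where $\hat h_k^2(t,h_j,h_i)=v_j^2\big(\frac{v_i^2t+(-1)^k\sqrt{\Delta_{i,j}}}{v_j^2-v_i^2}\big)^2+h_j^2$, $\Delta_{i,j}=v_j^2v_i^2t^2-(h_j^2-h_i^2)(v_j^2-v_i^2)$, and $t^*=\frac1{v_jv_i}(h_j^2-h_i^2)^{1/2}(v_j^2-v_i^2)^{1/2}$.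
   Context: A user at the origin is served by the nearest station; a handover is a time at which two stations are simultaneously nearest. For a type-$i$ station, its head $(T,H)$ is the time and value of its minimal distance to the origin and its radial bird is $\{(t,(v_i^2(t-T)^2+H^2)^{1/2})\}$; handovers are intersections of two radial birds lying on the graph of the nearest-station distance. $\Lambda_i$ is the intensity of handovers produced by two type-$i$ birds. For $i\neq j$, $\Lambda^{(k)}_{i,j}$ is the intensity of handovers produced by the $k$-th (in time order) intersection of a type-$i$ bird and a type-$j$ bird whose type-$i$ head lies to the left (smaller time coordinate) of the type-$j$ head. *)

theory Defs
  imports "HOL-Probability.Probability"
begin

text \<open>A station is described by its initial position in the plane and the angle
  (in [0,2pi)) of its direction of motion.  A station of speed v is at position
  x + v t (cos theta, sin theta) at time t.\<close>

type_synonym station = "(real \<times> real) \<times> real"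

definition dist_at :: "real \<Rightarrow> station \<Rightarrow> real \<Rightarrow> real" where
  "dist_at v s t = sqrt ((fst (fst s) + v * t * cos (snd s))\<^sup>2 + (snd (fst s) + v * t * sin (snd s))\<^sup>2)"

text \<open>Time coordinate of the head (time of minimal distance to the origin).\<close>
definition head_time :: "real \<Rightarrow> station \<Rightarrow> real" where
  "head_time v s = - (fst (fst s) * cos (snd s) + snd (fst s) * sin (snd s)) / v"

definition nearest_dist ::
  "nat \<Rightarrow> (nat \<Rightarrow> real) \<Rightarrow> (nat \<Rightarrow> 'w \<Rightarrow> station set) \<Rightarrow> 'w \<Rightarrow> real \<Rightarrow> real" where
  "nearest_dist n v \<Phi> \<omega> t = Inf {dist_at (v i) s t | i s. i \<in> {1..n} \<and> s \<in> \<Phi> i \<omega>}"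

definition is_nearest ::
  "nat \<Rightarrow> (nat \<Rightarrow> real) \<Rightarrow> (nat \<Rightarrow> 'w \<Rightarrow> station set) \<Rightarrow> 'w \<Rightarrow> nat \<Rightarrow> station \<Rightarrow> real \<Rightarrow> bool" where
  "is_nearest n v \<Phi> \<omega> i s t \<longleftrightarrow> dist_at (v i) s t = nearest_dist n v \<Phi> \<omega> t"

definition handovers_same ::
  "nat \<Rightarrow> (nat \<Rightarrow> real) \<Rightarrow> (nat \<Rightarrow> 'w \<Rightarrow> station set) \<Rightarrow> nat \<Rightarrow> 'w \<Rightarrow> real set" where
  "handovers_same n v \<Phi> i \<omega> = {t \<in> {0..1}. \<exists>a\<in>\<Phi> i \<omega>. \<exists>b\<in>\<Phi> i \<omega>. a \<noteq> b \<and>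
      is_nearest n v \<Phi> \<omega> i a t \<and> is_nearest n v \<Phi> \<omega> i b t}"

text \<open>Handovers in [0,1] produced by the k-th (in time order) intersection of a
  type-i bird and a type-j bird whose type-i head lies to the left of the type-j head.\<close>
definition handovers_cross ::
  "nat \<Rightarrow> (nat \<Rightarrow> real) \<Rightarrow> (nat \<Rightarrow> 'w \<Rightarrow> station set) \<Rightarrow> nat \<Rightarrow> nat \<Rightarrow> nat \<Rightarrow> 'w \<Rightarrow> real set" where
  "handovers_cross n v \<Phi> k i j \<omega> = {t \<in> {0..1}. \<exists>a\<in>\<Phi> i \<omega>. \<exists>b\<in>\<Phi> j \<omega>.
      head_time (v i) a < head_time (v j) b \<and>
      is_nearest n v \<Phi> \<omega> i a t \<and> is_nearest n v \<Phi> \<omega> j b t \<and>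
      card {s. s \<le> t \<and> dist_at (v i) a s = dist_at (v j) b s} = k}"

definition Lambda_same ::
  "'w measure \<Rightarrow> nat \<Rightarrow> (nat \<Rightarrow> real) \<Rightarrow> (nat \<Rightarrow> 'w \<Rightarrow> station set) \<Rightarrow> nat \<Rightarrow> ennreal" where
  "Lambda_same M n v \<Phi> i =
     (\<integral>\<^sup>+ \<omega>. emeasure (count_space UNIV) (handovers_same n v \<Phi> i \<omega>) \<partial>M)"

definition Lambda_cross ::
  "'w measure \<Rightarrow> nat \<Rightarrow> (nat \<Rightarrow> real) \<Rightarrow> (nat \<Rightarrow> 'w \<Rightarrow> station set) \<Rightarrow> nat \<Rightarrow> nat \<Rightarrow> nat \<Rightarrow> ennreal" where
  "Lambda_cross M n v \<Phi> k i j =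
     (\<integral>\<^sup>+ \<omega>. emeasure (count_space UNIV) (handovers_cross n v \<Phi> k i j \<omega>) \<partial>M)"

text \<open>Independent homogeneous Poisson point processes: type i has positions of
  intensity lam i in the plane and independent uniform directions in [0,2pi),
  i.e. it is a Poisson process on R^2 x [0,2pi) with intensity (lam i / 2pi) Leb.
  Counts in bounded Borel sets are Poisson, and counts in disjoint sets (and of
  different types) are mutually independent.\<close>
definition indep_marked_PPPs ::
  "'w measure \<Rightarrow> nat \<Rightarrow> (nat \<Rightarrow> real) \<Rightarrow> (nat \<Rightarrow> 'w \<Rightarrow> station set) \<Rightarrow> bool" where
  "indep_marked_PPPs M n lam \<Phi> \<longleftrightarrow>
     prob_space M \<and>
     (\<forall>i\<in>{1..n}. \<forall>\<omega>\<in>space M. \<Phi> i \<omega> \<subseteq> UNIV \<times> {0..<2*pi}) \<and>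
     (\<forall>i\<in>{1..n}. AE \<omega> in M. \<forall>B. bounded B \<longrightarrow> finite (\<Phi> i \<omega> \<inter> B)) \<and>
     (\<forall>i\<in>{1..n}. \<forall>B\<in>sets borel. bounded B \<longrightarrow>
        (\<lambda>\<omega>. card (\<Phi> i \<omega> \<inter> B)) \<in> measurable M (count_space UNIV) \<and>
        (\<forall>m::nat. let \<mu> = lam i / (2*pi) * measure lborel (B \<inter> (UNIV \<times> {0..<2*pi})) in
           measure M {\<omega>\<in>space M. card (\<Phi> i \<omega> \<inter> B) = m} = \<mu> ^ m / fact m * exp (- \<mu>))) \<and>
     (\<forall>(I::nat set) (typ::nat \<Rightarrow> nat) (Bs::nat \<Rightarrow> station set).
        finite I \<longrightarrow> (\<forall>l\<in>I. typ l \<in> {1..n} \<and> Bs l \<in> sets borel \<and> bounded (Bs l)) \<longrightarrow>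
        (\<forall>l\<in>I. \<forall>l'\<in>I. l \<noteq> l' \<and> typ l = typ l' \<longrightarrow> Bs l \<inter> Bs l' = {}) \<longrightarrow>
        prob_space.indep_vars M (\<lambda>_. count_space UNIV)
          (\<lambda>l \<omega>. card (\<Phi> (typ l) \<omega> \<inter> Bs l)) I)"

definition Delta :: "real \<Rightarrow> real \<Rightarrow> real \<Rightarrow> real \<Rightarrow> real \<Rightarrow> real" where
  "Delta vi vj t hj hi = vj\<^sup>2 * vi\<^sup>2 * t\<^sup>2 - (hj\<^sup>2 - hi\<^sup>2) * (vj\<^sup>2 - vi\<^sup>2)"

definition hhat_sq :: "nat \<Rightarrow> real \<Rightarrow> real \<Rightarrow> real \<Rightarrow> real \<Rightarrow> real \<Rightarrow> real" where
  "hhat_sq k vi vj t hj hi =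
     vj\<^sup>2 * ((vi\<^sup>2 * t + (-1) ^ k * sqrt (Delta vi vj t hj hi)) / (vj\<^sup>2 - vi\<^sup>2))\<^sup>2 + hj\<^sup>2"

definition t_star :: "real \<Rightarrow> real \<Rightarrow> real \<Rightarrow> real \<Rightarrow> real" where
  "t_star vi vj hj hi = 1 / (vj * vi) * sqrt (hj\<^sup>2 - hi\<^sup>2) * sqrt (vj\<^sup>2 - vi\<^sup>2)"

end

theory Submission
  imports Defs
begin

text \<open>A handover at time t is a pair of stations at a common distance r from the origin such that no
  station is strictly closer. For a Poisson process the expected number of such pairs is the integral
  over all pairs of the probability that the disc of radius r is empty at the meeting time, namely
  exp(- L pi r^2) whatever the time. Almost surely no three stations tie, so pairs may be counted
  instead of times. In head coordinates a type-i process has intensity 2 lam v dT dH; since the picture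
  is invariant under time shifts, integrating out one head time leaves the stated triple integrals.
  Exchanging the roles of the two stations reverses time, which gives the symmetry (ii). For equal
  speeds the squared meeting distance is
  (v d)^2/4 + (h^2 + h'^2)/2 + (h'^2 - h^2)^2/(2 v d)^2, d being the difference of the head times,
  and the integral over d is of Cauchy--Schloemilch type.\<close>

section \<open>Stations and the intensity of their heads\<close>

text \<open>The hypotheses speak only of counts in bounded Borel sets, so the integral over pairs
  has to be built up from products of counts: rectangles of disjoint windows come before arbitrary
  measurable sets of pairs. The obstacle is that the region required to be empty depends on the pair
  itself, whereas independence is available only for fixed sets. Several configurations are
  discarded as null: patterns that are not locally finite, ties with a third station, stations of
  one type with equal head times, and tangent birds. The factor 4 lam_i lam_j v_i v_j is the product
  of the two head intensities; nothing else enters because the observation window [0,1] has length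
  one. The two ranges of h_i in (iii) reflect the discriminant: for h_i < h_j it becomes positive
  only beyond t*, for h_i >= h_j it is positive for every t > 0. For equal speeds the integral over
  d collapses the exponent to - L pi max(h, h')^2, whose integral over the quadrant is 1 / (L
  pi).\<close>

definition offset :: "station \<Rightarrow> real" where
  "offset s = - fst (fst s) * sin (snd s) + snd (fst s) * cos (snd s)"

text \<open>The sign of \<open>offset\<close> tells on which side the origin is passed; only the
  absolute value is the value H of the head. The signed quantity is kept as well because it is one
  coordinate of a rotated initial position.\<close>

abbreviation height :: "station \<Rightarrow> real" where
  "height s \<equiv> \<bar>offset s\<bar>"

text \<open>Rotating the plane so that the motion is along the first axis leaves a transverse
  coordinate \<open>offset\<close> that is constant in time, while the other coordinate runs at
  speed v and vanishes at the head time. This is the equation of the radial bird.\<close>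

lemma dist_at_head:
  assumes "v \<noteq> 0"
  shows "dist_at v s t = sqrt (v\<^sup>2 * (t - head_time v s)\<^sup>2 + (offset s)\<^sup>2)"
proof -
  obtain x y \<theta> where s: "s = ((x, y), \<theta>)" by (metis prod.collapse)
  \<comment> \<open>With sine and cosine replaced by arbitrary c, d on the unit circle, the rotation
    identity becomes purely polynomial.\<close>
  have "(x + v * t * c)\<^sup>2 + (y + v * t * d)\<^sup>2 = (v * t + (x * c + y * d))\<^sup>2 + (- x * d + y * c)\<^sup>2"
    if "c\<^sup>2 + d\<^sup>2 = 1" for c d :: real
    using that by algebra
  from this[of "cos \<theta>" "sin \<theta>"]
  have "(x + v * t * cos \<theta>)\<^sup>2 + (y + v * t * sin \<theta>)\<^sup>2
      = (v * t + (x * cos \<theta> + y * sin \<theta>))\<^sup>2 + (- x * sin \<theta> + y * cos \<theta>)\<^sup>2"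
    by simp
  also have "v * t + (x * cos \<theta> + y * sin \<theta>) = v * (t - head_time v s)"
    using assms by (simp add: s head_time_def field_simps)
  finally show ?thesis
    by (simp add: s dist_at_def offset_def power_mult_distrib)
qed

lemma dist_at_nonneg: "0 \<le> dist_at v s t"
  by (simp add: dist_at_def)

lemma dist_at_eq_norm:
  "dist_at v s t = norm (fst s + (v * t) *\<^sub>R (cos (snd s), sin (snd s)))"
  by (simp add: dist_at_def norm_prod_def fst_add snd_add)

text \<open>This bounds the price of rounding a meeting time: a station moves by at most its speed
  times the rounding error.\<close>

lemma dist_at_lipschitz: "dist_at v s t \<le> dist_at v s t' + \<bar>v\<bar> * \<bar>t - t'\<bar>"
proof -
  let ?u = "(cos (snd s), sin (snd s))"
  have "fst s + (v * t) *\<^sub>R ?u = (fst s + (v * t') *\<^sub>R ?u) + (v * (t - t')) *\<^sub>R ?u"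
    by (simp add: algebra_simps)
  moreover have "norm ((v * (t - t')) *\<^sub>R ?u) = \<bar>v\<bar> * \<bar>t - t'\<bar>"
    by (simp only: norm_scaleR) (simp add: norm_prod_def abs_mult)
  ultimately show ?thesis
    unfolding dist_at_eq_norm by (metis norm_triangle_ineq)
qed

lemma borel_measurable_station_coordinates [measurable]:
  "(\<lambda>s::station. fst (fst s)) \<in> borel_measurable borel"
  "(\<lambda>s::station. snd (fst s)) \<in> borel_measurable borel"
  "(\<lambda>s::station. snd s) \<in> borel_measurable borel"
  by (simp_all add: borel_prod[symmetric])

lemma borel_measurable_head [measurable]:
  "head_time v \<in> borel_measurable borel" "offset \<in> borel_measurable borel"
  unfolding head_time_def[abs_def] offset_def[abs_def] by measurable

lemma borel_measurable_dist_at [measurable (raw)]: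
  assumes [measurable]: "f \<in> borel_measurable N" "g \<in> borel_measurable N"
  shows "(\<lambda>x. dist_at v (f x) (g x)) \<in> borel_measurable N"
  unfolding dist_at_def by measurable

text \<open>The restriction of the directions is put into the density, so the space of stations
  stays a full Euclidean space and windows are plain Borel sets.\<close>

definition intensity :: "real \<Rightarrow> station measure" where
  "intensity l = density lborel (\<lambda>s. ennreal (l / (2 * pi)) * indicator (UNIV \<times> {0..<2*pi}) s)"

lemma strip_borel [measurable]: "(UNIV :: (real \<times> real) set) \<times> {0..<2*pi::real} \<in> sets borel"
proof -
  have "(UNIV :: (real \<times> real) set) \<times> {0..<2*pi::real} \<in> sets (borel \<Otimes>\<^sub>M borel)"
    by (rule pair_measureI) auto
  then show ?thesis by (simp only: borel_prod)
qed

lemma sets_intensity [simp, measurable_cong]: "sets (intensity l) = sets borel"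
  and space_intensity [simp]: "space (intensity l) = UNIV"
  by (simp_all add: intensity_def)

lemma emeasure_intensity:
  assumes "B \<in> sets borel"
  shows "emeasure (intensity l) B
    = ennreal (l / (2 * pi)) * emeasure lborel (B \<inter> UNIV \<times> {0..<2*pi})"
proof -
  have [measurable]: "B \<in> sets borel" by fact
  have "emeasure (intensity l) B
    = (\<integral>\<^sup>+ s. ennreal (l / (2 * pi)) * (indicator (UNIV \<times> {0..<2*pi}) s * indicator B s) \<partial>lborel)"
    unfolding intensity_def by (simp add: emeasure_density mult.assoc)
  also have "\<dots> = (\<integral>\<^sup>+ s. ennreal (l / (2 * pi)) * indicator (B \<inter> UNIV \<times> {0..<2*pi}) s \<partial>lborel)"
    by (intro nn_integral_cong) (auto simp: indicator_def)
  finally show ?thesis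
    by (simp add: nn_integral_cmult)
qed

lemma nn_integral_intensity:
  assumes [measurable]: "f \<in> borel_measurable borel"
  shows "(\<integral>\<^sup>+ s. f s \<partial>intensity l)
    = ennreal (l / (2 * pi)) * (\<integral>\<^sup>+ \<theta>. indicator {0..<2*pi} \<theta> * (\<integral>\<^sup>+ x. f (x, \<theta>) \<partial>lborel) \<partial>lborel)"
proof -
  have [measurable]: "f \<in> borel_measurable (borel \<Otimes>\<^sub>M borel)" by (simp add: borel_prod)
  have "(\<integral>\<^sup>+ s. f s \<partial>intensity l)
    = (\<integral>\<^sup>+ s. ennreal (l / (2 * pi)) * (indicator (UNIV \<times> {0..<2*pi}) s * f s) \<partial>lborel)"
    unfolding intensity_def by (simp add: nn_integral_density mult.assoc)
  also have "\<dots> = ennreal (l / (2 * pi)) * (\<integral>\<^sup>+ s. indicator (UNIV \<times> {0..<2*pi}) s * f s \<partial>(lborel \<Otimes>\<^sub>M lborel))"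
    by (simp add: nn_integral_cmult lborel_prod)
  also have "(\<integral>\<^sup>+ s. indicator (UNIV \<times> {0..<2*pi}) s * f s \<partial>(lborel \<Otimes>\<^sub>M lborel))
    = (\<integral>\<^sup>+ s. indicator {0..<2*pi} (snd s) * f s \<partial>(lborel \<Otimes>\<^sub>M lborel))"
    by (intro nn_integral_cong) (auto simp: indicator_def)
  also have "\<dots> = (\<integral>\<^sup>+ \<theta>. (\<integral>\<^sup>+ x. indicator {0..<2*pi} \<theta> * f (x, \<theta>) \<partial>lborel) \<partial>lborel)"
    by (subst lborel_pair.nn_integral_snd[symmetric]) auto
  also have "\<dots> = (\<integral>\<^sup>+ \<theta>. indicator {0..<2*pi} \<theta> * (\<integral>\<^sup>+ x. f (x, \<theta>) \<partial>lborel) \<partial>lborel)"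
    by (intro nn_integral_cong nn_integral_cmult) auto
  finally show ?thesis .
qed

lemma emeasure_lborel_bounded_finite:
  fixes B :: "'a::euclidean_space set"
  assumes "bounded B" shows "emeasure lborel B < \<infinity>"
proof -
  obtain a where "B \<subseteq> cbox (-a) a" using bounded_subset_cbox_symmetric[OF assms] by blast
  then have "emeasure lborel B \<le> emeasure lborel (cbox (-a) a)" by (intro emeasure_mono) auto
  also have "\<dots> < \<infinity>" by (rule emeasure_lborel_cbox_finite)
  finally show ?thesis .
qed

lemma emeasure_intensity_finite:
  assumes "B \<in> sets borel" "bounded B"
  shows "emeasure (intensity l) B < \<infinity>"
  unfolding emeasure_intensity[OF assms(1)]
  using emeasure_lborel_bounded_finite[OF bounded_subset[OF assms(2)], of "B \<inter> UNIV \<times> {0..<2*pi}"]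
  by (auto simp: ennreal_mult_less_top)

lemma sigma_finite_intensity: "sigma_finite_measure (intensity l)"
proof
  let ?A = "range (\<lambda>k::nat. ball (0::station) (real k))"
  have "\<Union> ?A = UNIV"
    by (auto simp: dist_norm) (metis norm_Pair reals_Archimedean2)
  moreover have "\<forall>a\<in>?A. emeasure (intensity l) a \<noteq> \<infinity>"
    using emeasure_intensity_finite[of "ball _ _"] by (auto simp: less_top)
  ultimately show "\<exists>A. countable A \<and> A \<subseteq> sets (intensity l) \<and> \<Union> A = space (intensity l) \<and>
      (\<forall>a\<in>A. emeasure (intensity l) a \<noteq> \<infinity>)"
    by (intro exI[of _ ?A]) auto
qed

lemma dist_minus_left: "dist (- u) x = norm (x + u)" for u x :: "'a::real_normed_vector"
  by (metis dist_commute dist_norm diff_minus_eq_add)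

text \<open>For each direction the admissible initial positions form a disc of radius r, merely
  translated by the motion; hence the value depends neither on v nor on t. A negative radius is
  allowed because shrunken radii occur later.\<close>

lemma emeasure_intensity_ball:
  assumes "0 \<le> l"
  shows "emeasure (intensity l) {s. dist_at v s t < r} = ennreal (l * pi * (max 0 r)\<^sup>2)"
proof -
  have [measurable]: "{s. dist_at v s t < r} \<in> sets borel" by measurable
  have disc: "emeasure lborel {x. norm (x + c) < r} = ennreal (pi * (max 0 r)\<^sup>2)" for c :: "real \<times> real"
  proof (cases "r > 0")
    case True
    have "{x. norm (x + c) < r} = ball (-c) r"
      by (auto simp: dist_minus_left)
    then show ?thesis using True emeasure_ball[of r "-c"] by (simp add: unit_ball_vol_2 max_def power2_eq_square)
  next
    case False
    then have "{x. norm (x + c) < r} = {}" by (auto simp: not_less intro: order_trans)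
    then show ?thesis using False by (simp only: max_def) auto
  qed
  have "emeasure (intensity l) {s. dist_at v s t < r} = (\<integral>\<^sup>+ s. indicator {s. dist_at v s t < r} s \<partial>intensity l)"
    by simp
  also have "\<dots> = ennreal (l / (2 * pi)) * (\<integral>\<^sup>+ \<theta>. indicator {0..<2*pi} \<theta> *
      (\<integral>\<^sup>+ x. indicator {s. dist_at v s t < r} (x, \<theta>) \<partial>lborel) \<partial>lborel)"
    by (rule nn_integral_intensity) measurable
  also have "(\<lambda>\<theta>. \<integral>\<^sup>+ x. indicator {s. dist_at v s t < r} (x, \<theta>) \<partial>lborel)
    = (\<lambda>\<theta>. ennreal (pi * (max 0 r)\<^sup>2))"
  proof
    fix \<theta> :: real
    let ?D = "{x. norm (x + (v * t) *\<^sub>R (cos \<theta>, sin \<theta>)) < r}"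
    have "(\<integral>\<^sup>+ x. indicator {s. dist_at v s t < r} (x, \<theta>) \<partial>lborel) = (\<integral>\<^sup>+ x. indicator ?D x \<partial>lborel)"
      by (intro nn_integral_cong) (auto simp: indicator_def dist_at_eq_norm)
    also have "\<dots> = emeasure lborel ?D"
      by (intro nn_integral_indicator) simp
    finally show "(\<integral>\<^sup>+ x. indicator {s. dist_at v s t < r} (x, \<theta>) \<partial>lborel) = ennreal (pi * (max 0 r)\<^sup>2)"
      by (simp only: disc)
  qed
  also have "ennreal (l / (2 * pi)) * (\<integral>\<^sup>+ \<theta>. indicator {0..<2*pi} \<theta> * ennreal (pi * (max 0 r)\<^sup>2) \<partial>lborel)
      = ennreal (l / (2 * pi)) * (ennreal (2 * pi) * ennreal (pi * (max 0 r)\<^sup>2))"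
    by (subst nn_integral_multc) (auto simp: mult.commute)
  also have "\<dots> = ennreal (l * pi * (max 0 r)\<^sup>2)"
    using assms by (simp add: ennreal_mult[symmetric])
  finally show ?thesis .
qed

text \<open>Each slice of fixed direction is a circle in the plane and hence null. This is what
  makes a tie with a third station negligible.\<close>

lemma emeasure_intensity_circle:
  "emeasure (intensity l) {s. dist_at v s t = r} = 0"
proof -
  have "emeasure (intensity l) {s. dist_at v s t = r} = (\<integral>\<^sup>+ s. indicator {s. dist_at v s t = r} s \<partial>intensity l)"
    by simp
  also have "\<dots> = ennreal (l / (2 * pi)) * (\<integral>\<^sup>+ \<theta>. indicator {0..<2*pi} \<theta> *
      (\<integral>\<^sup>+ x. indicator {s. dist_at v s t = r} (x, \<theta>) \<partial>lborel) \<partial>lborel)"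
    by (rule nn_integral_intensity) measurable
  also have "(\<lambda>\<theta>. \<integral>\<^sup>+ x. indicator {s. dist_at v s t = r} (x, \<theta>) \<partial>lborel) = (\<lambda>\<theta>. 0)"
  proof
    fix \<theta> :: real
    let ?c = "- ((v * t) *\<^sub>R (cos \<theta>, sin \<theta>))"
    have "(\<integral>\<^sup>+ x. indicator {s. dist_at v s t = r} (x, \<theta>) \<partial>lborel) = (\<integral>\<^sup>+ x. indicator (sphere ?c r) x \<partial>lborel)"
      by (intro nn_integral_cong) (simp only: indicator_def dist_at_eq_norm mem_sphere mem_Collect_eq
          dist_minus_left fst_conv snd_conv)
    also have "\<dots> = emeasure lborel (sphere ?c r)"
      by (intro nn_integral_indicator) simp
    also have "\<dots> = emeasure lebesgue (sphere ?c r)"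
      by simp
    also have "\<dots> = 0"
      using negligible_sphere[of ?c r] by (simp only: negligible_iff_emeasure0 fmeasurableD lmeasurable_compact compact_sphere)
    finally show "(\<integral>\<^sup>+ x. indicator {s. dist_at v s t = r} (x, \<theta>) \<partial>lborel) = 0" .
  qed
  finally show ?thesis by simp
qed

text \<open>For fixed direction, position and (signed) head are related by a rotation, which is
  composed here of two one-dimensional affine substitutions.\<close>

lemma nn_integral_rotation:
  fixes f :: "real \<times> real \<Rightarrow> ennreal"
  assumes [measurable]: "f \<in> borel_measurable borel" and "cos \<theta> \<noteq> 0"
  shows "(\<integral>\<^sup>+ z. f (fst z * cos \<theta> + snd z * sin \<theta>, - fst z * sin \<theta> + snd z * cos \<theta>) \<partial>lborel)
    = (\<integral>\<^sup>+ p. \<integral>\<^sup>+ h. f (p, h) \<partial>lborel \<partial>lborel)"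
proof -
  let ?c = "cos \<theta>" and ?s = "sin \<theta>"
  have [measurable]: "f \<in> borel_measurable (borel \<Otimes>\<^sub>M borel)" by (simp add: borel_prod)
  have "(\<integral>\<^sup>+ p. \<integral>\<^sup>+ h. f (p, h) \<partial>lborel \<partial>lborel)
      = (\<integral>\<^sup>+ p. ennreal \<bar>1 / ?c\<bar> * (\<integral>\<^sup>+ y. f (p, - p * ?s / ?c + 1 / ?c * y) \<partial>lborel) \<partial>lborel)"
    using assms(2) by (intro nn_integral_cong nn_integral_real_affine) auto
  also have "\<dots> = ennreal \<bar>1 / ?c\<bar> * (\<integral>\<^sup>+ p. \<integral>\<^sup>+ y. f (p, - p * ?s / ?c + 1 / ?c * y) \<partial>lborel \<partial>lborel)"
    by (intro nn_integral_cmult) measurable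
  also have "(\<integral>\<^sup>+ p. \<integral>\<^sup>+ y. f (p, - p * ?s / ?c + 1 / ?c * y) \<partial>lborel \<partial>lborel)
      = (\<integral>\<^sup>+ y. \<integral>\<^sup>+ p. f (p, - p * ?s / ?c + 1 / ?c * y) \<partial>lborel \<partial>lborel)"
    by (rule lborel_pair.Fubini'[symmetric]) measurable
  also have "\<dots> = (\<integral>\<^sup>+ y. ennreal \<bar>?c\<bar> * (\<integral>\<^sup>+ x. f (y * ?s + ?c * x, - (y * ?s + ?c * x) * ?s / ?c + 1 / ?c * y) \<partial>lborel) \<partial>lborel)"
    using assms(2) by (intro nn_integral_cong nn_integral_real_affine) auto
  also have "\<dots> = ennreal \<bar>?c\<bar> * (\<integral>\<^sup>+ y. \<integral>\<^sup>+ x. f (y * ?s + ?c * x, - (y * ?s + ?c * x) * ?s / ?c + 1 / ?c * y) \<partial>lborel \<partial>lborel)"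
    by (intro nn_integral_cmult) measurable
  also have "(\<integral>\<^sup>+ y. \<integral>\<^sup>+ x. f (y * ?s + ?c * x, - (y * ?s + ?c * x) * ?s / ?c + 1 / ?c * y) \<partial>lborel \<partial>lborel)
      = (\<integral>\<^sup>+ y. \<integral>\<^sup>+ x. f (x * ?c + y * ?s, - x * ?s + y * ?c) \<partial>lborel \<partial>lborel)"
  proof -
    have "- (y * ?s + ?c * x) * ?s / ?c + 1 / ?c * y = - x * ?s + y * ?c" for x y
    proof -
      have "- (y * ?s + ?c * x) * ?s + y = ?c * (- x * ?s + y * ?c)"
        using sin_cos_squared_add[of \<theta>] by algebra
      then show ?thesis using assms(2) by (simp add: field_simps)
    qed
    then show ?thesis by (simp only: mult.commute[of _ ?c] add.commute[of "_ * ?s"])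
  qed
  also have "\<dots> = (\<integral>\<^sup>+ z. f (fst z * ?c + snd z * ?s, - fst z * ?s + snd z * ?c) \<partial>(lborel \<Otimes>\<^sub>M lborel))"
    by (subst lborel_pair.nn_integral_snd[symmetric]) auto
  finally show ?thesis
    using assms(2) by (simp add: lborel_prod mult.assoc[symmetric] ennreal_mult[symmetric] abs_mult[symmetric])
qed

text \<open>The rotation is decomposed into affine substitutions that divide by the cosine of the
  direction; the excluded directions are countable.\<close>

lemma AE_cos_nonzero: "AE \<theta> in lborel. cos (\<theta>::real) \<noteq> 0"
proof -
  have "{x::real. cos x = 0} \<subseteq> range (\<lambda>i::int. of_int i * (pi / 2))"
    by (auto simp: cos_zero_iff_int)
  then have "countable {x::real. cos x = 0}" by (rule countable_subset) auto
  then have "{x::real. cos x = 0} \<in> null_sets lborel" by (rule countable_imp_null_set_lborel)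
  then show ?thesis by (auto dest: AE_not_in)
qed

text \<open>The constant 2 l v arises as follows: the substitution p = - v T gives v, folding the
  signed offset into its absolute value gives 2, and the total angle 2 pi cancels the normalisation
  of the directions.\<close>

lemma nn_integral_head:
  fixes f :: "real \<times> real \<Rightarrow> ennreal"
  assumes f[measurable]: "f \<in> borel_measurable borel" and "v > 0" "l \<ge> 0"
  shows "(\<integral>\<^sup>+ s. f (head_time v s, height s) \<partial>intensity l)
    = ennreal (2 * l * v) * (\<integral>\<^sup>+ T. \<integral>\<^sup>+ h. indicator {0..} h * f (T, h) \<partial>lborel \<partial>lborel)"
proof -
  have [measurable]: "f \<in> borel_measurable (borel \<Otimes>\<^sub>M borel)" by (simp add: borel_prod)
  let ?I = "\<integral>\<^sup>+ T. \<integral>\<^sup>+ h. f (T, \<bar>h\<bar>) \<partial>lborel \<partial>lborel"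
  let ?J = "\<integral>\<^sup>+ T. \<integral>\<^sup>+ h. indicator {0..} h * f (T, h) \<partial>lborel \<partial>lborel"
  \<comment> \<open>The negative half-line is reflected onto the positive one; the point 0, which
    would be counted on one side only, is null.\<close>
  have half: "(\<integral>\<^sup>+ h. f (T, \<bar>h\<bar>) \<partial>lborel) = 2 * (\<integral>\<^sup>+ h. indicator {0..} h * f (T, h) \<partial>lborel)" for T
  proof -
    have "(\<integral>\<^sup>+ h. f (T, \<bar>h\<bar>) \<partial>lborel)
        = (\<integral>\<^sup>+ h. indicator {0..} h * f (T, h) + indicator {..<0} h * f (T, -h) \<partial>lborel)"
      by (intro nn_integral_cong) (auto simp: indicator_def)
    also have "\<dots> = (\<integral>\<^sup>+ h. indicator {0..} h * f (T, h) \<partial>lborel) + (\<integral>\<^sup>+ h. indicator {..<0} h * f (T, -h) \<partial>lborel)"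
      by (intro nn_integral_add) measurable
    also have "(\<integral>\<^sup>+ h. indicator {..<0} h * f (T, -h) \<partial>lborel) = (\<integral>\<^sup>+ h. indicator {..<0} (-h) * f (T, h) \<partial>lborel)"
      by (subst nn_integral_real_affine[where c="-1" and t=0]) auto
    also have "\<dots> = (\<integral>\<^sup>+ h. indicator {0..} h * f (T, h) \<partial>lborel)"
      using AE_lborel_singleton[of "0::real"]
      by (intro nn_integral_cong_AE) (auto simp: indicator_def elim!: eventually_mono)
    finally show ?thesis by (simp add: mult_2)
  qed
  have inner: "(\<integral>\<^sup>+ x. f (head_time v (x, \<theta>), height (x, \<theta>)) \<partial>lborel) = ennreal v * ?I"
    if "cos \<theta> \<noteq> 0" for \<theta>
  proof -
    have "(\<integral>\<^sup>+ x. f (head_time v (x, \<theta>), height (x, \<theta>)) \<partial>lborel)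
      = (\<integral>\<^sup>+ z. (\<lambda>(p, h). f (- p / v, \<bar>h\<bar>)) (fst z * cos \<theta> + snd z * sin \<theta>, - fst z * sin \<theta> + snd z * cos \<theta>) \<partial>lborel)"
      by (simp only: head_time_def offset_def fst_conv snd_conv prod.case)
    also have "\<dots> = (\<integral>\<^sup>+ p. \<integral>\<^sup>+ h. f (- p / v, \<bar>h\<bar>) \<partial>lborel \<partial>lborel)"
      using that by (subst nn_integral_rotation) (auto simp: borel_prod[symmetric])
    also have "\<dots> = ennreal v * ?I"
      using \<open>v > 0\<close> by (subst nn_integral_real_affine[where c="-v" and t=0]) auto
    finally show ?thesis .
  qed
  have "(\<integral>\<^sup>+ s. f (head_time v s, height s) \<partial>intensity l)
    = ennreal (l / (2 * pi)) * (\<integral>\<^sup>+ \<theta>. indicator {0..<2*pi} \<theta> * (\<integral>\<^sup>+ x. f (head_time v (x, \<theta>), height (x, \<theta>)) \<partial>lborel) \<partial>lborel)"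
    by (rule nn_integral_intensity) measurable
  also have "(\<integral>\<^sup>+ \<theta>. indicator {0..<2*pi} \<theta> * (\<integral>\<^sup>+ x. f (head_time v (x, \<theta>), height (x, \<theta>)) \<partial>lborel) \<partial>lborel)
     = (\<integral>\<^sup>+ \<theta>. indicator {0..<2*pi} \<theta> * (ennreal v * ?I) \<partial>lborel)"
    using AE_cos_nonzero by (intro nn_integral_cong_AE) (auto simp: inner elim!: eventually_mono)
  also have "\<dots> = ennreal (2 * pi) * (ennreal v * ?I)"
    by (subst nn_integral_multc) auto
  also have "?I = 2 * ?J"
    by (simp add: half) (intro nn_integral_cmult, measurable)
  also have "ennreal (l / (2 * pi)) * (ennreal (2 * pi) * (ennreal v * (2 * ?J)))
      = (ennreal (l / (2 * pi)) * ennreal (2 * pi) * ennreal v * ennreal 2) * ?J"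
    by (simp add: mult_ac)
  also have "ennreal (l / (2 * pi)) * ennreal (2 * pi) * ennreal v * ennreal 2 = ennreal (2 * l * v)"
    using assms(2,3) by (simp add: ennreal_mult[symmetric] mult_ac del: ennreal_numeral)
  finally show ?thesis .
qed

section \<open>Poisson counts\<close>

text \<open>Counting with values in \<open>ennreal\<close> gives countable additivity directly and
  assigns infinity, not 0, to infinite sets.\<close>

abbreviation num :: "'a set \<Rightarrow> ennreal" where
  "num \<equiv> emeasure (count_space UNIV)"

lemma num_finite: "finite X \<Longrightarrow> num X = of_nat (card X)"
  by (simp add: emeasure_count_space)

lemma num_Times: "num (X \<times> Y) = num X * num Y" if "finite X" "finite Y"
  using that by (simp add: num_finite card_cartesian_product)

text \<open>A Dynkin-class argument in which measurability of the random counts and the formula for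
  their weighted means are propagated together.\<close>

lemma weighted_count_extend:
  fixes F :: "'w \<Rightarrow> 'b set" and Z :: "'w \<Rightarrow> ennreal" and N :: "'b measure"
  assumes stable: "Int_stable P" and P: "P \<subseteq> Pow (space N)" and gen: "sets N = sigma_sets (space N) P"
    and top: "space N \<in> P" and fin: "emeasure N (space N) < \<infinity>"
    and Z[measurable]: "Z \<in> borel_measurable M"
    and F: "\<And>\<omega>. \<omega> \<in> space M \<Longrightarrow> finite (F \<omega>)" "\<And>\<omega>. F \<omega> \<subseteq> space N"
    and meas: "\<And>A. A \<in> P \<Longrightarrow> (\<lambda>\<omega>. num (A \<inter> F \<omega>)) \<in> borel_measurable M"
    and mean: "\<And>A. A \<in> P \<Longrightarrow> (\<integral>\<^sup>+\<omega>. Z \<omega> * num (A \<inter> F \<omega>) \<partial>M) = c * emeasure N A"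
    and c: "c < \<infinity>"
    and A: "A \<in> sets N"
  shows "(\<lambda>\<omega>. num (A \<inter> F \<omega>)) \<in> borel_measurable M
    \<and> (\<integral>\<^sup>+\<omega>. Z \<omega> * num (A \<inter> F \<omega>) \<partial>M) = c * emeasure N A"
proof -
  have "A \<in> sigma_sets (space N) P" using A gen by simp
  with stable P show ?thesis
  proof (induction rule: sigma_sets_induct_disjoint)
    case (basic A)
    then show ?case using meas mean by simp
  next
    case empty
    then show ?case by simp
  next
    case (compl A)
    then have [measurable]: "(\<lambda>\<omega>. num (A \<inter> F \<omega>)) \<in> borel_measurable M" and
      A: "(\<integral>\<^sup>+\<omega>. Z \<omega> * num (A \<inter> F \<omega>) \<partial>M) = c * emeasure N A" by auto
    have AN: "A \<in> sets N" using compl gen by simp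
    have [measurable]: "(\<lambda>\<omega>. num (space N \<inter> F \<omega>)) \<in> borel_measurable M" using meas top by blast
    have add: "num (space N \<inter> F \<omega>) = num ((space N - A) \<inter> F \<omega>) + num (A \<inter> F \<omega>)" for \<omega>
      using sets.sets_into_space[OF AN]
      by (subst plus_emeasure) (auto intro!: arg_cong[where f=num])
    have finA: "num (A \<inter> F \<omega>) < \<infinity>" if "\<omega> \<in> space M" for \<omega>
      using F(1)[OF that] by (subst num_finite) (auto simp: of_nat_less_top)
    \<comment> \<open>Complements are reached by subtraction, which undoes an addition in
      \<open>ennreal\<close> only because the count of \<open>A\<close> is finite.\<close>
    have "(\<lambda>\<omega>. num (space N \<inter> F \<omega>) - num (A \<inter> F \<omega>)) \<in> borel_measurable M" by measurable
    moreover have diff: "num (space N \<inter> F \<omega>) - num (A \<inter> F \<omega>) = num ((space N - A) \<inter> F \<omega>)" if "\<omega> \<in> space M" for \<omega>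
      using finA[OF that] by (simp add: add)
    ultimately have m[measurable]: "(\<lambda>\<omega>. num ((space N - A) \<inter> F \<omega>)) \<in> borel_measurable M"
      by (subst measurable_cong[where g="\<lambda>\<omega>. num (space N \<inter> F \<omega>) - num (A \<inter> F \<omega>)"]) auto
    have "c * emeasure N (space N) = (\<integral>\<^sup>+\<omega>. Z \<omega> * num (space N \<inter> F \<omega>) \<partial>M)"
      using mean top by simp
    also have "\<dots> = (\<integral>\<^sup>+\<omega>. Z \<omega> * num ((space N - A) \<inter> F \<omega>) + Z \<omega> * num (A \<inter> F \<omega>) \<partial>M)"
      by (simp add: add distrib_left)
    also have "\<dots> = (\<integral>\<^sup>+\<omega>. Z \<omega> * num ((space N - A) \<inter> F \<omega>) \<partial>M) + c * emeasure N A"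
      by (subst nn_integral_add) (auto simp: A)
    also have "c * emeasure N (space N) = c * emeasure N (space N - A) + c * emeasure N A"
      using AN sets.sets_into_space[OF AN]
      by (subst distrib_left[symmetric], subst plus_emeasure) (auto intro!: arg_cong[where f="\<lambda>x. c * emeasure N x"])
    finally have eq: "c * emeasure N (space N - A) + c * emeasure N A
       = (\<integral>\<^sup>+\<omega>. Z \<omega> * num ((space N - A) \<inter> F \<omega>) \<partial>M) + c * emeasure N A" .
    \<comment> \<open>Finiteness of N and of c makes the term to be cancelled finite.\<close>
    have "emeasure N A \<le> emeasure N (space N)" by (rule emeasure_space)
    with fin c have "c * emeasure N A < \<top>" by (auto simp: ennreal_mult_less_top)
    with eq have "c * emeasure N (space N - A) = (\<integral>\<^sup>+\<omega>. Z \<omega> * num ((space N - A) \<inter> F \<omega>) \<partial>M)"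
      by (metis ennreal_add_diff_cancel_right infinity_ennreal_def order_less_irrefl)
    with m show ?case by simp
  next
    case (union B)
    then have [measurable]: "\<And>k. (\<lambda>\<omega>. num (B k \<inter> F \<omega>)) \<in> borel_measurable M" by auto
    have dj: "disjoint_family (\<lambda>k. B k \<inter> F \<omega>)" for \<omega>
      using union(1) by (auto simp: disjoint_family_on_def)
    have sum: "num (\<Union> (range B) \<inter> F \<omega>) = (\<Sum>k. num (B k \<inter> F \<omega>))" for \<omega>
      using suminf_emeasure[OF _ dj[of \<omega>], of "count_space UNIV"] by (simp add: Int_UN_distrib2)
    have BN: "range B \<subseteq> sets N" using union gen by auto
    have "(\<integral>\<^sup>+\<omega>. Z \<omega> * num (\<Union> (range B) \<inter> F \<omega>) \<partial>M) = (\<integral>\<^sup>+\<omega>. (\<Sum>k. Z \<omega> * num (B k \<inter> F \<omega>)) \<partial>M)"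
      by (simp add: sum)
    also have "\<dots> = (\<Sum>k. c * emeasure N (B k))"
      using union by (subst nn_integral_suminf) auto
    also have "\<dots> = c * emeasure N (\<Union> (range B))"
      using BN union(1) by (simp add: suminf_emeasure)
    finally show ?case by (simp add: sum)
  qed
qed

text \<open>Of the Poisson laws only the means and the void probabilities are retained, and
  independence enters as a product formula for nonnegative functions of counts. Local finiteness
  holds for every outcome, not just almost surely.\<close>

locale typed_poisson = prob_space M for M :: "'w measure" +
  fixes n :: nat and lam :: "nat \<Rightarrow> real" and \<Psi> :: "nat \<Rightarrow> 'w \<Rightarrow> station set"
  assumes lam_pos: "\<And>i. i \<in> {1..n} \<Longrightarrow> 0 < lam i"
    and marks: "\<And>i \<omega>. i \<in> {1..n} \<Longrightarrow> \<omega> \<in> space M \<Longrightarrow> \<Psi> i \<omega> \<subseteq> UNIV \<times> {0..<2*pi}"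
    and locally_finite: "\<And>i \<omega> B. i \<in> {1..n} \<Longrightarrow> \<omega> \<in> space M \<Longrightarrow> bounded B \<Longrightarrow> finite (\<Psi> i \<omega> \<inter> B)"
    and count_measurable: "\<And>i B. i \<in> {1..n} \<Longrightarrow> B \<in> sets borel \<Longrightarrow> bounded B \<Longrightarrow>
      (\<lambda>\<omega>. card (\<Psi> i \<omega> \<inter> B)) \<in> measurable M (count_space UNIV)"
    and mean_count: "\<And>i B. i \<in> {1..n} \<Longrightarrow> B \<in> sets borel \<Longrightarrow> bounded B \<Longrightarrow>
      (\<integral>\<^sup>+\<omega>. of_nat (card (\<Psi> i \<omega> \<inter> B)) \<partial>M) = emeasure (intensity (lam i)) B"
    and void_prob: "\<And>i B. i \<in> {1..n} \<Longrightarrow> B \<in> sets borel \<Longrightarrow> bounded B \<Longrightarrow>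
      (\<integral>\<^sup>+\<omega>. indicator {0} (card (\<Psi> i \<omega> \<inter> B)) \<partial>M) = ennreal (exp (- measure (intensity (lam i)) B))"
    and count_indep: "\<And>(I::nat set) typ Bs (g :: nat \<Rightarrow> nat \<Rightarrow> ennreal). finite I \<Longrightarrow>
      (\<And>l. l \<in> I \<Longrightarrow> typ l \<in> {1..n}) \<Longrightarrow> (\<And>l. l \<in> I \<Longrightarrow> Bs l \<in> sets borel) \<Longrightarrow> (\<And>l. l \<in> I \<Longrightarrow> bounded (Bs l)) \<Longrightarrow>
      (\<And>l l'. l \<in> I \<Longrightarrow> l' \<in> I \<Longrightarrow> l \<noteq> l' \<Longrightarrow> typ l = typ l' \<Longrightarrow> Bs l \<inter> Bs l' = {}) \<Longrightarrow>
      (\<integral>\<^sup>+\<omega>. (\<Prod>l\<in>I. g l (card (\<Psi> (typ l) \<omega> \<inter> Bs l))) \<partial>M)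
        = (\<Prod>l\<in>I. \<integral>\<^sup>+\<omega>. g l (card (\<Psi> (typ l) \<omega> \<inter> Bs l)) \<partial>M)"

section \<open>From the hypotheses on the point processes to a locally finite version\<close>

lemma nn_integral_nat_valued:
  assumes X: "X \<in> measurable M (count_space (UNIV::nat set))"
  shows "(\<integral>\<^sup>+\<omega>. f (X \<omega>) \<partial>M) = (\<Sum>m. f m * emeasure M {\<omega>\<in>space M. X \<omega> = m})"
proof -
  have [measurable]: "X \<in> measurable M (count_space UNIV)" by fact
  have "(\<integral>\<^sup>+\<omega>. f (X \<omega>) \<partial>M) = (\<integral>\<^sup>+\<omega>. (\<Sum>m. f m * indicator {\<omega>\<in>space M. X \<omega> = m} \<omega>) \<partial>M)"
  proof (rule nn_integral_cong)
    fix \<omega> assume "\<omega> \<in> space M"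
    then have "(\<Sum>m. f m * indicator {\<omega>\<in>space M. X \<omega> = m} \<omega>) = (\<Sum>m\<in>{X \<omega>}. f m * indicator {\<omega>\<in>space M. X \<omega> = m} \<omega>)"
      by (intro suminf_finite) auto
    with \<open>\<omega> \<in> space M\<close> show "f (X \<omega>) = (\<Sum>m. f m * indicator {\<omega>\<in>space M. X \<omega> = m} \<omega>)" by simp
  qed
  also have "\<dots> = (\<Sum>m. f m * emeasure M {\<omega>\<in>space M. X \<omega> = m})"
    by (subst nn_integral_suminf) (auto simp: nn_integral_cmult)
  finally show ?thesis .
qed

lemma measure_intensity:
  assumes "B \<in> sets borel" "l \<ge> 0"
  shows "measure (intensity l) B = l / (2*pi) * measure lborel (B \<inter> (UNIV \<times> {0..<2*pi}))"
  using assms by (simp add: measure_def emeasure_intensity enn2real_mult)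

text \<open>The given patterns are locally finite only almost surely, and \<open>card\<close> of an
  infinite set is 0, so a count may be meaningless on a null event. The patterns are therefore
  modified there; all integrals remain unchanged.\<close>

lemma indep_marked_PPPs_imp_typed_poisson:
  assumes PPP: "indep_marked_PPPs M n lam \<Phi>" and lam: "\<forall>i\<in>{1..n}. lam i > 0"
  obtains \<Psi> where "typed_poisson M n lam \<Psi>" "AE \<omega> in M. \<forall>i\<in>{1..n}. \<Psi> i \<omega> = \<Phi> i \<omega>"
proof -
  from PPP interpret prob_space M by (simp add: indep_marked_PPPs_def)
  note PPP' = PPP[unfolded indep_marked_PPPs_def, THEN conjunct2]
  note sub = PPP'[THEN conjunct1] and fin = PPP'[THEN conjunct2, THEN conjunct1]
    and cnt = PPP'[THEN conjunct2, THEN conjunct2, THEN conjunct1]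
    and ind = PPP'[THEN conjunct2, THEN conjunct2, THEN conjunct2]
  have meas: "(\<lambda>\<omega>. card (\<Phi> i \<omega> \<inter> B)) \<in> measurable M (count_space UNIV)"
    and pois: "measure M {\<omega>\<in>space M. card (\<Phi> i \<omega> \<inter> B) = m}
      = (lam i / (2*pi) * measure lborel (B \<inter> (UNIV \<times> {0..<2*pi}))) ^ m / fact m
        * exp (- (lam i / (2*pi) * measure lborel (B \<inter> (UNIV \<times> {0..<2*pi}))))"
    if "i \<in> {1..n}" "B \<in> sets borel" "bounded B" for i B m
    using cnt[rule_format, OF that] unfolding Let_def by simp_all
  from fin have "AE \<omega> in M. \<forall>i\<in>{1..n}. \<forall>B. bounded B \<longrightarrow> finite (\<Phi> i \<omega> \<inter> B)"
    by (subst AE_ball_countable) auto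
  then obtain G where G[measurable]: "G \<in> sets M" and AEG: "AE \<omega> in M. \<omega> \<in> G"
    and Gfin: "\<And>\<omega> i B. \<omega> \<in> G \<Longrightarrow> i \<in> {1..n} \<Longrightarrow> bounded B \<Longrightarrow> finite (\<Phi> i \<omega> \<inter> B)"
  proof (elim AE_E)
    fix N assume N: "{\<omega> \<in> space M. \<not> (\<forall>i\<in>{1..n}. \<forall>B. bounded B \<longrightarrow> finite (\<Phi> i \<omega> \<inter> B))} \<subseteq> N"
      "emeasure M N = 0" "N \<in> sets M"
    show thesis
    proof (rule that[of "space M - N"])
      show "AE \<omega> in M. \<omega> \<in> space M - N" using N by (intro AE_I[of _ _ N]) auto
      show "finite (\<Phi> i \<omega> \<inter> B)" if "\<omega> \<in> space M - N" "i \<in> {1..n}" "bounded B" for \<omega> i B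
        using N(1) that by (metis (mono_tags, lifting) Diff_iff mem_Collect_eq subsetD)
    qed (use N in auto)
  qed
  \<comment> \<open>Off the good event every pattern is made empty, which keeps it locally finite
    and within the range of directions.\<close>
  define \<Psi> where "\<Psi> i \<omega> = (if \<omega> \<in> G then \<Phi> i \<omega> else {})" for i \<omega>
  have eq: "AE \<omega> in M. \<forall>i. \<Psi> i \<omega> = \<Phi> i \<omega>"
    using AEG by eventually_elim (simp add: \<Psi>_def)
  \<comment> \<open>The transfer compares integrands almost everywhere, so f needs no
    measurability.\<close>
  have tr: "(\<integral>\<^sup>+\<omega>. f (\<lambda>i. \<Psi> i \<omega>) \<partial>M) = (\<integral>\<^sup>+\<omega>. f (\<lambda>i. \<Phi> i \<omega>) \<partial>M)" for f
    using eq by (intro nn_integral_cong_AE) (auto elim!: eventually_mono)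
  have P: "emeasure M {\<omega>\<in>space M. card (\<Phi> i \<omega> \<inter> B) = m}
      = ennreal ((measure (intensity (lam i)) B) ^ m / fact m * exp (- measure (intensity (lam i)) B))"
    if "i \<in> {1..n}" "B \<in> sets borel" "bounded B" for i B m
  proof -
    have "0 \<le> lam i" using lam that(1) by (simp add: less_imp_le)
    show ?thesis
      unfolding measure_intensity[OF that(2) \<open>0 \<le> lam i\<close>] emeasure_eq_measure pois[OF that, of m] ..
  qed
  have "typed_poisson M n lam \<Psi>"
  proof (unfold_locales)
    fix i assume i: "i \<in> {1..n}"
    then show "0 < lam i" using lam by simp
    fix \<omega> assume w: "\<omega> \<in> space M"
    then show "\<Psi> i \<omega> \<subseteq> UNIV \<times> {0..<2*pi}" using sub i by (auto simp: \<Psi>_def)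
    fix B :: "station set" assume "bounded B" 
    then show "finite (\<Psi> i \<omega> \<inter> B)" using Gfin i by (auto simp: \<Psi>_def)
  next
    fix i and B :: "station set" assume B: "i \<in> {1..n}" "B \<in> sets borel" "bounded B"
    note [measurable] = meas[OF B]
    let ?\<mu> = "measure (intensity (lam i)) B"
    have fin: "emeasure (intensity (lam i)) B = ennreal ?\<mu>"
      using emeasure_intensity_finite[OF B(2,3), of "lam i"] by (intro emeasure_eq_ennreal_measure) auto
    have "(\<lambda>\<omega>. if \<omega> \<in> G then card (\<Phi> i \<omega> \<inter> B) else 0) \<in> measurable M (count_space UNIV)"
      by measurable
    also have "(\<lambda>\<omega>. if \<omega> \<in> G then card (\<Phi> i \<omega> \<inter> B) else 0) = (\<lambda>\<omega>. card (\<Psi> i \<omega> \<inter> B))"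
      by (auto simp: \<Psi>_def)
    finally show "(\<lambda>\<omega>. card (\<Psi> i \<omega> \<inter> B)) \<in> measurable M (count_space UNIV)" .
    have "(\<integral>\<^sup>+\<omega>. of_nat (card (\<Psi> i \<omega> \<inter> B)) \<partial>M) = (\<integral>\<^sup>+\<omega>. of_nat (card (\<Phi> i \<omega> \<inter> B)) \<partial>M)"
      by (rule tr)
    also have "\<dots> = (\<Sum>m. of_nat m * emeasure M {\<omega>\<in>space M. card (\<Phi> i \<omega> \<inter> B) = m})"
      by (rule nn_integral_nat_valued) measurable
    also have "\<dots> = (\<Sum>m. ennreal (real m * (?\<mu> ^ m / fact m * exp (- ?\<mu>))))"
      unfolding P[OF B] ennreal_of_nat_eq_real_of_nat by (subst ennreal_mult) auto
    also have "\<dots> = ennreal ?\<mu>"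
    proof (rule suminf_ennreal_eq)
      \<comment> \<open>The mean of the Poisson law: the term m = 0 vanishes, and after a shift by
        one the series is \<mu> exp(-\<mu>) times the exponential series of \<mu>.\<close>
      have eq1: "(\<lambda>m. ?\<mu> * exp (- ?\<mu>) * (inverse (fact m) * ?\<mu> ^ m))
          = (\<lambda>m. real (Suc m) * (?\<mu> ^ Suc m / fact (Suc m) * exp (- ?\<mu>)))"
      proof
        fix m
        have "real (Suc m) * (x / (real (Suc m) * f)) = x / f" for x f :: real by simp
        then show "?\<mu> * exp (- ?\<mu>) * (inverse (fact m) * ?\<mu> ^ m)
            = real (Suc m) * (?\<mu> ^ Suc m / fact (Suc m) * exp (- ?\<mu>))"
          unfolding fact_Suc mult.assoc[symmetric] by (simp add: divide_inverse mult_ac del: of_nat_Suc)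
      qed
      have eq2: "?\<mu> * exp (- ?\<mu>) * exp ?\<mu> = ?\<mu>" by (simp add: mult.assoc exp_add[symmetric])
      have "(\<lambda>m. ?\<mu> * exp (- ?\<mu>) * (inverse (fact m) * ?\<mu> ^ m)) sums (?\<mu> * exp (- ?\<mu>) * exp ?\<mu>)"
        using exp_converges[of ?\<mu>] by (intro sums_mult) (simp add: scaleR_conv_of_real)
      then have "(\<lambda>m. real (Suc m) * (?\<mu> ^ Suc m / fact (Suc m) * exp (- ?\<mu>))) sums ?\<mu>"
        by (rule eq1[THEN arg_cong2[where f="(sums)"], OF eq2, THEN iffD1])
      then show "(\<lambda>m. real m * (?\<mu> ^ m / fact m * exp (- ?\<mu>))) sums ?\<mu>"
        by (subst (asm) sums_Suc_iff) simp
    qed simp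
    finally show "(\<integral>\<^sup>+\<omega>. of_nat (card (\<Psi> i \<omega> \<inter> B)) \<partial>M) = emeasure (intensity (lam i)) B"
      by (simp add: fin)
    have "(\<integral>\<^sup>+\<omega>. indicator {0} (card (\<Psi> i \<omega> \<inter> B)) \<partial>M) = (\<integral>\<^sup>+\<omega>. indicator {0} (card (\<Phi> i \<omega> \<inter> B)) \<partial>M)"
      by (rule tr)
    also have "\<dots> = (\<Sum>m. indicator {0} m * emeasure M {\<omega>\<in>space M. card (\<Phi> i \<omega> \<inter> B) = m})"
      by (rule nn_integral_nat_valued) measurable
    also have "\<dots> = (\<Sum>m\<in>{0}. indicator {0} m * emeasure M {\<omega>\<in>space M. card (\<Phi> i \<omega> \<inter> B) = m})"
      by (intro suminf_finite) auto
    finally show "(\<integral>\<^sup>+\<omega>. indicator {0} (card (\<Psi> i \<omega> \<inter> B)) \<partial>M) = ennreal (exp (- ?\<mu>))"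
      using P[OF B, of 0] by simp
  next
    fix I :: "nat set" and ty and Bs :: "nat \<Rightarrow> station set" and g :: "nat \<Rightarrow> nat \<Rightarrow> ennreal"
    assume I: "finite I" "\<And>l. l \<in> I \<Longrightarrow> ty l \<in> {1..n}" "\<And>l. l \<in> I \<Longrightarrow> Bs l \<in> sets borel"
      "\<And>l. l \<in> I \<Longrightarrow> bounded (Bs l)"
      "\<And>l l'. l \<in> I \<Longrightarrow> l' \<in> I \<Longrightarrow> l \<noteq> l' \<Longrightarrow> ty l = ty l' \<Longrightarrow> Bs l \<inter> Bs l' = {}"
    have "indep_vars (\<lambda>_. count_space UNIV) (\<lambda>l \<omega>. card (\<Phi> (ty l) \<omega> \<inter> Bs l)) I"
      using I by (intro ind[rule_format]) auto
    then have iv: "indep_vars (\<lambda>_. borel) (\<lambda>l \<omega>. g l (card (\<Phi> (ty l) \<omega> \<inter> Bs l))) I"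
      by (rule indep_vars_compose2) auto
    have "(\<integral>\<^sup>+\<omega>. (\<Prod>l\<in>I. g l (card (\<Phi> (ty l) \<omega> \<inter> Bs l))) \<partial>M)
        = (\<Prod>l\<in>I. \<integral>\<^sup>+\<omega>. g l (card (\<Phi> (ty l) \<omega> \<inter> Bs l)) \<partial>M)"
      by (rule indep_vars_nn_integral[OF I(1) iv]) auto
    then show "(\<integral>\<^sup>+\<omega>. (\<Prod>l\<in>I. g l (card (\<Psi> (ty l) \<omega> \<inter> Bs l))) \<partial>M)
        = (\<Prod>l\<in>I. \<integral>\<^sup>+\<omega>. g l (card (\<Psi> (ty l) \<omega> \<inter> Bs l)) \<partial>M)"
      unfolding tr[of "\<lambda>X. \<Prod>l\<in>I. g l (card (X (ty l) \<inter> Bs l))"]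
        tr[of "\<lambda>X. g l (card (X (ty l) \<inter> Bs l))" for l] .
  qed
  then show thesis using eq by (intro that[of \<Psi>]) (auto elim!: eventually_mono)
qed

section \<open>Mean counts of pairs and triples of windows, with void events\<close>

context typed_poisson
begin

lemma num_measurable:
  assumes "i \<in> {1..n}" "B \<in> sets borel" "bounded B"
  shows "(\<lambda>\<omega>. num (\<Psi> i \<omega> \<inter> B)) \<in> borel_measurable M"
proof -
  have [measurable]: "(\<lambda>\<omega>. card (\<Psi> i \<omega> \<inter> B)) \<in> measurable M (count_space UNIV)"
    by (rule count_measurable[OF assms])
  have "(\<lambda>\<omega>. of_nat (card (\<Psi> i \<omega> \<inter> B)) :: ennreal) \<in> borel_measurable M" by measurable
  then show ?thesis
    by (subst measurable_cong[where g="\<lambda>\<omega>. of_nat (card (\<Psi> i \<omega> \<inter> B))"])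
       (auto intro!: num_finite locally_finite assms)
qed

definition void :: "(nat \<Rightarrow> station set) \<Rightarrow> 'w \<Rightarrow> bool" where
  "void K \<omega> \<longleftrightarrow> (\<forall>l\<in>{1..n}. \<Psi> l \<omega> \<inter> K l = {})"

text \<open>Writing the event as a product of functions of single counts brings it into the form to
  which the independence formula applies. Finiteness is needed for a zero \<open>card\<close> to
  mean an empty intersection.\<close>

lemma void_indicator:
  assumes "\<And>l. l \<in> {1..n} \<Longrightarrow> bounded (K l)" "\<omega> \<in> space M"
  shows "(of_bool (void K \<omega>) :: ennreal) = (\<Prod>l\<in>{1..n}. indicator {0} (card (\<Psi> l \<omega> \<inter> K l)))"
proof (cases "void K \<omega>")
  case True
  then show ?thesis by (auto simp: void_def)
next
  case False
  then obtain l where l: "l \<in> {1..n}" "\<Psi> l \<omega> \<inter> K l \<noteq> {}" by (force simp: void_def)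
  then have "card (\<Psi> l \<omega> \<inter> K l) \<noteq> 0" using locally_finite assms by auto
  then have "(\<Prod>l\<in>{1..n}. indicator {0} (card (\<Psi> l \<omega> \<inter> K l)) :: ennreal) = 0"
    using l by (intro prod_zero) (auto intro!: bexI[of _ l])
  with False show ?thesis by simp
qed

lemma void_measurable:
  assumes "\<And>l. l \<in> {1..n} \<Longrightarrow> bounded (K l)" "\<And>l. l \<in> {1..n} \<Longrightarrow> K l \<in> sets borel"
  shows "(\<lambda>\<omega>. of_bool (void K \<omega>) :: ennreal) \<in> borel_measurable M"
proof -
  have m: "(\<lambda>\<omega>. card (\<Psi> l \<omega> \<inter> K l)) \<in> measurable M (count_space UNIV)" if "l \<in> {1..n}" for l
    using that assms by (intro count_measurable) auto
  have "(\<lambda>\<omega>. (\<Prod>l\<in>{1..n}. indicator {0} (card (\<Psi> l \<omega> \<inter> K l)) :: ennreal)) \<in> borel_measurable M"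
    by (intro borel_measurable_prod_ennreal measurable_compose[OF m]) auto
  then show ?thesis
    using assms(1) by (subst measurable_cong[OF void_indicator]) auto
qed

text \<open>Windows of different types may overlap freely, since the types are independent of each
  other.\<close>

definition typed_disjoint :: "nat \<Rightarrow> station set \<Rightarrow> nat \<Rightarrow> station set \<Rightarrow> bool" where
  "typed_disjoint i Q j Q' \<longleftrightarrow> (i = j \<longrightarrow> Q \<inter> Q' = {})"

definition window :: "nat \<Rightarrow> station set \<Rightarrow> bool" where
  "window i Q \<longleftrightarrow> i \<in> {1..n} \<and> Q \<in> sets borel \<and> bounded Q"

lemma window_Int: "window i Q \<Longrightarrow> A \<in> sets borel \<Longrightarrow> window i (Q \<inter> A)"
  by (auto simp: window_def intro: bounded_subset)

lemma num_count: "window i Q \<Longrightarrow> \<omega> \<in> space M \<Longrightarrow> num (\<Psi> i \<omega> \<inter> Q) = of_nat (card (\<Psi> i \<omega> \<inter> Q))"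
  by (intro num_finite locally_finite) (auto simp: window_def)

text \<open>The two windows avoid the void regions of their own types, so the n + 2 counts involved
  are independent and the mean factorises.\<close>

lemma mean_two_void:
  assumes Q: "window i Q" "window j Q'" "typed_disjoint i Q j Q'"
    and K: "\<And>l. l \<in> {1..n} \<Longrightarrow> window l (K l)" "Q \<inter> K i = {}" "Q' \<inter> K j = {}"
  shows "(\<integral>\<^sup>+\<omega>. of_bool (void K \<omega>) * (num (\<Psi> i \<omega> \<inter> Q) * num (\<Psi> j \<omega> \<inter> Q')) \<partial>M)
    = (\<Prod>l\<in>{1..n}. ennreal (exp (- measure (intensity (lam l)) (K l))))
      * (emeasure (intensity (lam i)) Q * emeasure (intensity (lam j)) Q')"
proof -
  \<comment> \<open>The labels 1 to n belong to the void regions, which leaves 0 and n + 1 for the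
    two windows; their types i and j may coincide with each other and with types of void
    regions.\<close>
  define ty where "ty l = (if l = 0 then i else if l = Suc n then j else l)" for l
  define Bs where "Bs l = (if l = 0 then Q else if l = Suc n then Q' else K l)" for l
  define g :: "nat \<Rightarrow> nat \<Rightarrow> ennreal" where
    "g l = (if l = 0 \<or> l = Suc n then of_nat else indicator {0})" for l
  have I: "{0..Suc n} = insert 0 (insert (Suc n) {1..n})" by auto
  have exp: "(\<Prod>l\<in>{0..Suc n}. F l) = F 0 * (F (Suc n) * (\<Prod>l\<in>{1..n}. F l))" for F :: "nat \<Rightarrow> ennreal"
    unfolding I by (subst prod.insert, simp, simp)+ simp
  have "(\<integral>\<^sup>+\<omega>. of_bool (void K \<omega>) * (num (\<Psi> i \<omega> \<inter> Q) * num (\<Psi> j \<omega> \<inter> Q')) \<partial>M)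
    = (\<integral>\<^sup>+\<omega>. (\<Prod>l\<in>{0..Suc n}. g l (card (\<Psi> (ty l) \<omega> \<inter> Bs l))) \<partial>M)"
  proof (rule nn_integral_cong)
    fix \<omega> assume w: "\<omega> \<in> space M"
    have "of_bool (void K \<omega>) = (\<Prod>l\<in>{1..n}. indicator {0} (card (\<Psi> l \<omega> \<inter> K l)) :: ennreal)"
      using K(1) w by (intro void_indicator) (auto simp: window_def)
    also have "\<dots> = (\<Prod>l\<in>{1..n}. g l (card (\<Psi> (ty l) \<omega> \<inter> Bs l)))"
      by (intro prod.cong) (auto simp: g_def ty_def Bs_def)
    finally show "of_bool (void K \<omega>) * (num (\<Psi> i \<omega> \<inter> Q) * num (\<Psi> j \<omega> \<inter> Q'))
      = (\<Prod>l\<in>{0..Suc n}. g l (card (\<Psi> (ty l) \<omega> \<inter> Bs l)))"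
      unfolding exp num_count[OF Q(1) w] num_count[OF Q(2) w]
      by (simp add: g_def ty_def Bs_def mult_ac)
  qed
  also have "\<dots> = (\<Prod>l\<in>{0..Suc n}. \<integral>\<^sup>+\<omega>. g l (card (\<Psi> (ty l) \<omega> \<inter> Bs l)) \<partial>M)"
  proof (rule count_indep)
    fix l assume l: "l \<in> {0..Suc n}"
    have "window (ty l) (Bs l)"
      using Q(1,2) K(1) l by (auto simp: ty_def Bs_def)
    then show "ty l \<in> {1..n}" "Bs l \<in> sets borel" "bounded (Bs l)" by (auto simp: window_def)
    fix l' assume l': "l' \<in> {0..Suc n}" "l \<noteq> l'" "ty l = ty l'"
    then show "Bs l \<inter> Bs l' = {}"
      using Q(3) K(2,3) l by (auto simp: ty_def Bs_def typed_disjoint_def split: if_splits)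
  qed simp
  also have "\<dots> = emeasure (intensity (lam i)) Q * (emeasure (intensity (lam j)) Q' *
      (\<Prod>l\<in>{1..n}. ennreal (exp (- measure (intensity (lam l)) (K l)))))"
  proof -
    have "(\<Prod>l\<in>{1..n}. \<integral>\<^sup>+\<omega>. g l (card (\<Psi> (ty l) \<omega> \<inter> Bs l)) \<partial>M)
      = (\<Prod>l\<in>{1..n}. ennreal (exp (- measure (intensity (lam l)) (K l))))"
    proof (rule prod.cong[OF refl])
      fix l assume l: "l \<in> {1..n}"
      then show "(\<integral>\<^sup>+\<omega>. g l (card (\<Psi> (ty l) \<omega> \<inter> Bs l)) \<partial>M) = ennreal (exp (- measure (intensity (lam l)) (K l)))"
        using void_prob[of l "K l"] K(1)[OF l] by (simp add: g_def ty_def Bs_def window_def)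
    qed
    then show ?thesis
      unfolding exp using mean_count[of i Q] mean_count[of j Q'] Q(1,2) by (simp add: g_def ty_def Bs_def window_def)
  qed
  finally show ?thesis by (simp add: mult_ac)
qed

lemma mean_three:
  assumes Q: "window i Q" "window j Q'" "window k Q''"
    and "typed_disjoint i Q j Q'" "typed_disjoint i Q k Q''" "typed_disjoint j Q' k Q''"
  shows "(\<integral>\<^sup>+\<omega>. num (\<Psi> k \<omega> \<inter> Q'') * (num (\<Psi> i \<omega> \<inter> Q) * num (\<Psi> j \<omega> \<inter> Q')) \<partial>M)
    = emeasure (intensity (lam k)) Q'' * (emeasure (intensity (lam i)) Q * emeasure (intensity (lam j)) Q')"
proof -
  define ty :: "nat \<Rightarrow> nat" where "ty l = (if l = 0 then i else if l = 1 then j else k)" for l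
  define Bs :: "nat \<Rightarrow> station set" where "Bs l = (if l = 0 then Q else if l = 1 then Q' else Q'')" for l
  let ?I = "{0, 1, 2::nat}"
  have "(\<integral>\<^sup>+\<omega>. num (\<Psi> k \<omega> \<inter> Q'') * (num (\<Psi> i \<omega> \<inter> Q) * num (\<Psi> j \<omega> \<inter> Q')) \<partial>M)
    = (\<integral>\<^sup>+\<omega>. (\<Prod>l\<in>?I. of_nat (card (\<Psi> (ty l) \<omega> \<inter> Bs l))) \<partial>M)"
    using Q by (intro nn_integral_cong) (simp add: num_count ty_def Bs_def mult_ac)
  also have "\<dots> = (\<Prod>l\<in>?I. \<integral>\<^sup>+\<omega>. of_nat (card (\<Psi> (ty l) \<omega> \<inter> Bs l)) \<partial>M)"
    using assms by (intro count_indep) (auto simp: ty_def Bs_def typed_disjoint_def window_def split: if_splits)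
  also have "\<dots> = emeasure (intensity (lam k)) Q'' * (emeasure (intensity (lam i)) Q * emeasure (intensity (lam j)) Q')"
    using mean_count[of i Q] mean_count[of j Q'] mean_count[of k Q''] Q
    by (simp add: ty_def Bs_def window_def mult_ac)
  finally show ?thesis .
qed

end

section \<open>Moment measures of pairs and triples\<close>

context typed_poisson
begin

lemma window_finite: "window i Q \<Longrightarrow> \<omega> \<in> space M \<Longrightarrow> finite (\<Psi> i \<omega> \<inter> Q)"
  by (intro locally_finite) (auto simp: window_def)

text \<open>The weight Z is left general because two instances are needed: the indicator of a void
  event, and the count of a third window on the way to triples.\<close>

lemma pair_mean_weighted:
  assumes Q: "window i Q" "window j Q'"
    and Z: "Z \<in> borel_measurable M" and c: "c < \<infinity>"
    and mean: "\<And>A A'. A \<in> sets borel \<Longrightarrow> A' \<in> sets borel \<Longrightarrow>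
      (\<integral>\<^sup>+\<omega>. Z \<omega> * (num (\<Psi> i \<omega> \<inter> (Q \<inter> A)) * num (\<Psi> j \<omega> \<inter> (Q' \<inter> A'))) \<partial>M)
        = c * (emeasure (intensity (lam i)) (Q \<inter> A) * emeasure (intensity (lam j)) (Q' \<inter> A'))"
    and A: "A \<in> sets (borel \<Otimes>\<^sub>M borel)"
  shows "(\<lambda>\<omega>. num (A \<inter> (\<Psi> i \<omega> \<inter> Q) \<times> (\<Psi> j \<omega> \<inter> Q'))) \<in> borel_measurable M
    \<and> (\<integral>\<^sup>+\<omega>. Z \<omega> * num (A \<inter> (\<Psi> i \<omega> \<inter> Q) \<times> (\<Psi> j \<omega> \<inter> Q')) \<partial>M)
      = c * emeasure (intensity (lam i) \<Otimes>\<^sub>M intensity (lam j)) (A \<inter> Q \<times> Q')"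
proof -
  interpret J: sigma_finite_measure "intensity (lam j)" by (rule sigma_finite_intensity)
  let ?P = "{a \<times> b | a b. a \<in> sets (borel::station measure) \<and> b \<in> sets (borel::station measure)}"
  let ?\<nu> = "intensity (lam i) \<Otimes>\<^sub>M intensity (lam j)"
  \<comment> \<open>Restricting the product intensity to the bounded windows makes it finite, as
    passing to complements requires.\<close>
  define N where "N = density ?\<nu> (indicator (Q \<times> Q'))"
  have Qb [measurable]: "Q \<in> sets borel" "Q' \<in> sets borel" and b: "bounded Q" "bounded Q'"
    and ij: "i \<in> {1..n}" "j \<in> {1..n}" using Q by (auto simp: window_def)
  have setsN: "sets N = sets (borel \<Otimes>\<^sub>M borel)"
    unfolding N_def by (simp cong: sets_pair_measure_cong)
  have spaceN: "space N = UNIV" by (simp add: N_def space_pair_measure)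
  have N: "emeasure N B = emeasure ?\<nu> (B \<inter> Q \<times> Q')" if "B \<in> sets (borel \<Otimes>\<^sub>M borel)" for B
  proof -
    have "B \<in> sets ?\<nu>" using that by (simp cong: sets_pair_measure_cong)
    moreover have "Q \<times> Q' \<in> sets ?\<nu>" by (rule pair_measureI) auto
    ultimately show ?thesis unfolding N_def by (simp add: emeasure_restricted Int_commute)
  qed
  have rect: "emeasure N (a \<times> a') = emeasure (intensity (lam i)) (Q \<inter> a) * emeasure (intensity (lam j)) (Q' \<inter> a')"
    if [measurable]: "a \<in> sets borel" "a' \<in> sets borel" for a a'
    by (subst N) (auto simp: Times_Int_Times Int_commute J.emeasure_pair_measure_Times)
  have "(\<lambda>\<omega>. num (A \<inter> (\<Psi> i \<omega> \<inter> Q) \<times> (\<Psi> j \<omega> \<inter> Q'))) \<in> borel_measurable M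
    \<and> (\<integral>\<^sup>+\<omega>. Z \<omega> * num (A \<inter> (\<Psi> i \<omega> \<inter> Q) \<times> (\<Psi> j \<omega> \<inter> Q')) \<partial>M) = c * emeasure N A"
  proof (rule weighted_count_extend[where P = ?P])
    show "Int_stable ?P" by (rule Int_stable_pair_measure_generator)
    show "?P \<subseteq> Pow (space N)" by (simp add: spaceN)
    show "sets N = sigma_sets (space N) ?P"
      using sets_pair_measure[of "borel::station measure" "borel::station measure"] by (simp add: setsN spaceN)
    show "space N \<in> ?P" by (auto simp: spaceN intro!: exI[of _ UNIV])
    have "emeasure N (UNIV \<times> UNIV) < \<infinity>"
      using emeasure_intensity_finite[OF Qb(1) b(1), of "lam i"] emeasure_intensity_finite[OF Qb(2) b(2), of "lam j"]
      by (subst rect) (auto simp: ennreal_mult_less_top)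
    then show "emeasure N (space N) < \<infinity>" by (simp add: spaceN)
    show "Z \<in> borel_measurable M" by fact
    show "finite ((\<Psi> i \<omega> \<inter> Q) \<times> (\<Psi> j \<omega> \<inter> Q'))" if "\<omega> \<in> space M" for \<omega>
      using that b ij by (intro finite_cartesian_product locally_finite)
    show "(\<Psi> i \<omega> \<inter> Q) \<times> (\<Psi> j \<omega> \<inter> Q') \<subseteq> space N" for \<omega> by (simp add: spaceN)
    show "c < \<infinity>" by fact
    show "A \<in> sets N" using A by (simp add: setsN)
    fix B assume "B \<in> ?P"
    then obtain a a' where B: "B = a \<times> a'" and [measurable]: "a \<in> sets borel" "a' \<in> sets borel" by auto
    have w: "window i (Q \<inter> a)" "window j (Q' \<inter> a')" using Q by (auto intro!: window_Int)
    have eq: "num (B \<inter> (\<Psi> i \<omega> \<inter> Q) \<times> (\<Psi> j \<omega> \<inter> Q')) = num (\<Psi> i \<omega> \<inter> (Q \<inter> a)) * num (\<Psi> j \<omega> \<inter> (Q' \<inter> a'))"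
      if "\<omega> \<in> space M" for \<omega>
      unfolding num_Times[OF w[THEN window_finite, OF that], symmetric]
      by (rule arg_cong[where f=num]) (auto simp: B)
    have "(\<lambda>\<omega>. num (\<Psi> i \<omega> \<inter> (Q \<inter> a)) * num (\<Psi> j \<omega> \<inter> (Q' \<inter> a'))) \<in> borel_measurable M"
      using w by (intro borel_measurable_times_ennreal num_measurable) (auto simp: window_def)
    then show "(\<lambda>\<omega>. num (B \<inter> (\<Psi> i \<omega> \<inter> Q) \<times> (\<Psi> j \<omega> \<inter> Q'))) \<in> borel_measurable M"
      by (subst measurable_cong[OF eq])
    show "(\<integral>\<^sup>+\<omega>. Z \<omega> * num (B \<inter> (\<Psi> i \<omega> \<inter> Q) \<times> (\<Psi> j \<omega> \<inter> Q')) \<partial>M) = c * emeasure N B"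
    proof -
      have "(\<integral>\<^sup>+\<omega>. Z \<omega> * num (B \<inter> (\<Psi> i \<omega> \<inter> Q) \<times> (\<Psi> j \<omega> \<inter> Q')) \<partial>M)
        = (\<integral>\<^sup>+\<omega>. Z \<omega> * (num (\<Psi> i \<omega> \<inter> (Q \<inter> a)) * num (\<Psi> j \<omega> \<inter> (Q' \<inter> a'))) \<partial>M)"
        by (intro nn_integral_cong) (simp only: eq)
      then show ?thesis by (simp add: mean) (simp add: B rect)
    qed
  qed
  with N[OF A] show ?thesis by simp
qed

lemma pair_mean_void:
  assumes Q: "window i Q" "window j Q'" "typed_disjoint i Q j Q'"
    and K: "\<And>l. l \<in> {1..n} \<Longrightarrow> window l (K l)" "Q \<inter> K i = {}" "Q' \<inter> K j = {}"
    and A: "A \<in> sets (borel \<Otimes>\<^sub>M borel)"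
  shows "(\<lambda>\<omega>. num (A \<inter> (\<Psi> i \<omega> \<inter> Q) \<times> (\<Psi> j \<omega> \<inter> Q'))) \<in> borel_measurable M
    \<and> (\<integral>\<^sup>+\<omega>. of_bool (void K \<omega>) * num (A \<inter> (\<Psi> i \<omega> \<inter> Q) \<times> (\<Psi> j \<omega> \<inter> Q')) \<partial>M)
      = (\<Prod>l\<in>{1..n}. ennreal (exp (- measure (intensity (lam l)) (K l))))
        * emeasure (intensity (lam i) \<Otimes>\<^sub>M intensity (lam j)) (A \<inter> Q \<times> Q')"
proof (rule pair_mean_weighted[OF Q(1,2) _ _ _ A])
  show "(\<lambda>\<omega>. of_bool (void K \<omega>) :: ennreal) \<in> borel_measurable M"
    using K(1) by (intro void_measurable) (auto simp: window_def)
  show "(\<Prod>l\<in>{1..n}. ennreal (exp (- measure (intensity (lam l)) (K l)))) < \<infinity>"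
    by (simp add: prod_ennreal)
  fix A A' :: "station set" assume "A \<in> sets borel" "A' \<in> sets borel"
  then show "(\<integral>\<^sup>+\<omega>. of_bool (void K \<omega>) * (num (\<Psi> i \<omega> \<inter> (Q \<inter> A)) * num (\<Psi> j \<omega> \<inter> (Q' \<inter> A'))) \<partial>M)
      = (\<Prod>l\<in>{1..n}. ennreal (exp (- measure (intensity (lam l)) (K l))))
        * (emeasure (intensity (lam i)) (Q \<inter> A) * emeasure (intensity (lam j)) (Q' \<inter> A'))"
    using Q K by (intro mean_two_void window_Int) (auto simp: typed_disjoint_def)
qed

text \<open>The extension from rectangles is made twice: sets of pairs are handled with the third
  count as weight, and products of a set of pairs with a window then generate the sets of
  triples.\<close>

lemma triple_mean:
  assumes Q: "window i Q" "window j Q'" "window k Q''"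
    and dj: "typed_disjoint i Q j Q'" "typed_disjoint i Q k Q''" "typed_disjoint j Q' k Q''"
    and A: "A \<in> sets ((borel \<Otimes>\<^sub>M borel) \<Otimes>\<^sub>M borel)"
  shows "(\<lambda>\<omega>. num (A \<inter> ((\<Psi> i \<omega> \<inter> Q) \<times> (\<Psi> j \<omega> \<inter> Q')) \<times> (\<Psi> k \<omega> \<inter> Q''))) \<in> borel_measurable M
    \<and> (\<integral>\<^sup>+\<omega>. num (A \<inter> ((\<Psi> i \<omega> \<inter> Q) \<times> (\<Psi> j \<omega> \<inter> Q')) \<times> (\<Psi> k \<omega> \<inter> Q'')) \<partial>M)
      = emeasure ((intensity (lam i) \<Otimes>\<^sub>M intensity (lam j)) \<Otimes>\<^sub>M intensity (lam k)) (A \<inter> (Q \<times> Q') \<times> Q'')"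
proof -
  interpret J: sigma_finite_measure "intensity (lam j)" by (rule sigma_finite_intensity)
  interpret K: sigma_finite_measure "intensity (lam k)" by (rule sigma_finite_intensity)
  let ?P = "{a \<times> b | a b. a \<in> sets (borel \<Otimes>\<^sub>M borel :: (station \<times> station) measure) \<and> b \<in> sets (borel::station measure)}"
  let ?\<nu> = "intensity (lam i) \<Otimes>\<^sub>M intensity (lam j)"
  define N where "N = density (?\<nu> \<Otimes>\<^sub>M intensity (lam k)) (indicator ((Q \<times> Q') \<times> Q''))"
  have Qb [measurable]: "Q \<in> sets borel" "Q' \<in> sets borel" "Q'' \<in> sets borel"
    and b: "bounded Q" "bounded Q'" "bounded Q''"
    and ij: "i \<in> {1..n}" "j \<in> {1..n}" "k \<in> {1..n}" using Q by (auto simp: window_def)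
  have QQ: "Q \<times> Q' \<in> sets (borel \<Otimes>\<^sub>M borel)" by (rule pair_measureI) auto
  have sets\<nu>: "sets ?\<nu> = sets (borel \<Otimes>\<^sub>M borel)" by (simp cong: sets_pair_measure_cong)
  have sets3: "sets (?\<nu> \<Otimes>\<^sub>M intensity (lam k)) = sets ((borel \<Otimes>\<^sub>M borel) \<Otimes>\<^sub>M borel)"
    by (simp add: sets\<nu> cong: sets_pair_measure_cong)
  have setsN: "sets N = sets ((borel \<Otimes>\<^sub>M borel) \<Otimes>\<^sub>M borel)"
    by (simp add: N_def sets3)
  have spaceN: "space N = UNIV" by (simp add: N_def space_pair_measure)
  have N: "emeasure N B = emeasure (?\<nu> \<Otimes>\<^sub>M intensity (lam k)) (B \<inter> (Q \<times> Q') \<times> Q'')"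
    if "B \<in> sets ((borel \<Otimes>\<^sub>M borel) \<Otimes>\<^sub>M borel)" for B
  proof -
    have "(Q \<times> Q') \<times> Q'' \<in> sets (?\<nu> \<Otimes>\<^sub>M intensity (lam k))" using QQ by (intro pair_measureI) (auto simp: sets\<nu>)
    then show ?thesis using that unfolding N_def by (simp add: emeasure_restricted sets3 Int_commute)
  qed
  have rect: "emeasure N (a \<times> a') = emeasure (intensity (lam k)) (Q'' \<inter> a') * emeasure ?\<nu> (a \<inter> Q \<times> Q')"
    if [measurable]: "a \<in> sets (borel \<Otimes>\<^sub>M borel)" "a' \<in> sets borel" for a a'
    using QQ by (subst N) (auto simp: Times_Int_Times Int_commute[of Q''] K.emeasure_pair_measure_Times sets\<nu> mult.commute)
  have "(\<lambda>\<omega>. num (A \<inter> ((\<Psi> i \<omega> \<inter> Q) \<times> (\<Psi> j \<omega> \<inter> Q')) \<times> (\<Psi> k \<omega> \<inter> Q''))) \<in> borel_measurable M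
    \<and> (\<integral>\<^sup>+\<omega>. 1 * num (A \<inter> ((\<Psi> i \<omega> \<inter> Q) \<times> (\<Psi> j \<omega> \<inter> Q')) \<times> (\<Psi> k \<omega> \<inter> Q'')) \<partial>M) = 1 * emeasure N A"
  proof (rule weighted_count_extend[where P = ?P])
    show "Int_stable ?P" by (rule Int_stable_pair_measure_generator)
    show "?P \<subseteq> Pow (space N)" by (simp add: spaceN)
    show "sets N = sigma_sets (space N) ?P"
      using sets_pair_measure[of "borel \<Otimes>\<^sub>M borel :: (station \<times> station) measure" "borel::station measure"]
      by (simp add: setsN spaceN space_pair_measure)
    show "space N \<in> ?P"
      using sets.top[of "borel \<Otimes>\<^sub>M borel :: (station \<times> station) measure"]
      by (auto simp: spaceN space_pair_measure intro!: exI[of _ UNIV])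
    have "emeasure N (UNIV \<times> UNIV) < \<infinity>"
      using emeasure_intensity_finite[OF Qb(1) b(1), of "lam i"] emeasure_intensity_finite[OF Qb(2) b(2), of "lam j"]
         emeasure_intensity_finite[OF Qb(3) b(3), of "lam k"] sets.top[of "borel \<Otimes>\<^sub>M borel :: (station \<times> station) measure"]
      by (subst rect) (auto simp: space_pair_measure ennreal_mult_less_top J.emeasure_pair_measure_Times)
    then show "emeasure N (space N) < \<infinity>" by (simp add: spaceN)
    show "(\<lambda>_. 1) \<in> borel_measurable M" by simp
    show "finite (((\<Psi> i \<omega> \<inter> Q) \<times> (\<Psi> j \<omega> \<inter> Q')) \<times> (\<Psi> k \<omega> \<inter> Q''))" if "\<omega> \<in> space M" for \<omega>
      using that b ij by (intro finite_cartesian_product locally_finite)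
    show "((\<Psi> i \<omega> \<inter> Q) \<times> (\<Psi> j \<omega> \<inter> Q')) \<times> (\<Psi> k \<omega> \<inter> Q'') \<subseteq> space N" for \<omega> by (simp add: spaceN)
    show "(1::ennreal) < \<infinity>" by simp
    show "A \<in> sets N" using A by (simp add: setsN)
    fix B assume "B \<in> ?P"
    then obtain a a' where B: "B = a \<times> a'" and [measurable]: "a \<in> sets (borel \<Otimes>\<^sub>M borel)" "a' \<in> sets borel" by auto
    have w: "window k (Q'' \<inter> a')" using Q by (auto intro!: window_Int)
    have m: "(\<lambda>\<omega>. num (\<Psi> k \<omega> \<inter> (Q'' \<inter> a'))) \<in> borel_measurable M"
      using w by (intro num_measurable) (auto simp: window_def)
    have eq: "num (B \<inter> ((\<Psi> i \<omega> \<inter> Q) \<times> (\<Psi> j \<omega> \<inter> Q')) \<times> (\<Psi> k \<omega> \<inter> Q''))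
        = num (\<Psi> k \<omega> \<inter> (Q'' \<inter> a')) * num (a \<inter> (\<Psi> i \<omega> \<inter> Q) \<times> (\<Psi> j \<omega> \<inter> Q'))"
      if "\<omega> \<in> space M" for \<omega>
    proof -
      have "finite (a \<inter> (\<Psi> i \<omega> \<inter> Q) \<times> (\<Psi> j \<omega> \<inter> Q'))"
        using Q that by (intro finite_Int disjI2 finite_cartesian_product window_finite)
      from num_Times[OF this window_finite[OF w that]] show ?thesis
        unfolding mult.commute[of "num (\<Psi> k \<omega> \<inter> (Q'' \<inter> a'))"]
        by (rule trans[rotated]) (auto simp: B intro!: arg_cong[where f=num])
    qed
    \<comment> \<open>The weight in the pair formula is the count of the third window, whose mean is
      the constant c.\<close>
    have pw: "(\<lambda>\<omega>. num (a \<inter> (\<Psi> i \<omega> \<inter> Q) \<times> (\<Psi> j \<omega> \<inter> Q'))) \<in> borel_measurable M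
      \<and> (\<integral>\<^sup>+\<omega>. num (\<Psi> k \<omega> \<inter> (Q'' \<inter> a')) * num (a \<inter> (\<Psi> i \<omega> \<inter> Q) \<times> (\<Psi> j \<omega> \<inter> Q')) \<partial>M)
      = emeasure (intensity (lam k)) (Q'' \<inter> a') * emeasure ?\<nu> (a \<inter> Q \<times> Q')"
    proof (rule pair_mean_weighted[OF Q(1,2) m])
      show "emeasure (intensity (lam k)) (Q'' \<inter> a') < \<infinity>"
        using w by (intro emeasure_intensity_finite) (auto simp: window_def)
      fix A A' :: "station set" assume "A \<in> sets borel" "A' \<in> sets borel"
      then show "(\<integral>\<^sup>+\<omega>. num (\<Psi> k \<omega> \<inter> (Q'' \<inter> a')) * (num (\<Psi> i \<omega> \<inter> (Q \<inter> A)) * num (\<Psi> j \<omega> \<inter> (Q' \<inter> A'))) \<partial>M)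
        = emeasure (intensity (lam k)) (Q'' \<inter> a') * (emeasure (intensity (lam i)) (Q \<inter> A) * emeasure (intensity (lam j)) (Q' \<inter> A'))"
        using Q dj by (intro mean_three window_Int) (auto simp: typed_disjoint_def)
    qed measurable
    have "(\<lambda>\<omega>. num (\<Psi> k \<omega> \<inter> (Q'' \<inter> a')) * num (a \<inter> (\<Psi> i \<omega> \<inter> Q) \<times> (\<Psi> j \<omega> \<inter> Q'))) \<in> borel_measurable M"
      using m pw by (intro borel_measurable_times_ennreal) auto
    then show "(\<lambda>\<omega>. num (B \<inter> ((\<Psi> i \<omega> \<inter> Q) \<times> (\<Psi> j \<omega> \<inter> Q')) \<times> (\<Psi> k \<omega> \<inter> Q''))) \<in> borel_measurable M"
      by (subst measurable_cong[OF eq])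
    show "(\<integral>\<^sup>+\<omega>. 1 * num (B \<inter> ((\<Psi> i \<omega> \<inter> Q) \<times> (\<Psi> j \<omega> \<inter> Q')) \<times> (\<Psi> k \<omega> \<inter> Q'')) \<partial>M) = 1 * emeasure N B"
    proof -
      have "(\<integral>\<^sup>+\<omega>. 1 * num (B \<inter> ((\<Psi> i \<omega> \<inter> Q) \<times> (\<Psi> j \<omega> \<inter> Q')) \<times> (\<Psi> k \<omega> \<inter> Q'')) \<partial>M)
        = (\<integral>\<^sup>+\<omega>. num (\<Psi> k \<omega> \<inter> (Q'' \<inter> a')) * num (a \<inter> (\<Psi> i \<omega> \<inter> Q) \<times> (\<Psi> j \<omega> \<inter> Q')) \<partial>M)"
        by (intro nn_integral_cong) (simp only: eq mult_1)
      then show ?thesis using pw by (simp only: mult_1) (simp add: B rect)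
    qed
  qed
  with N[OF A] show ?thesis by simp
qed

end

section \<open>Integer grids separating distinct stations\<close>

definition cell :: "nat \<Rightarrow> station \<Rightarrow> int \<times> int \<times> int" where
  "cell m s = (\<lfloor>real (Suc m) * fst (fst s)\<rfloor>, \<lfloor>real (Suc m) * snd (fst s)\<rfloor>, \<lfloor>real (Suc m) * snd s\<rfloor>)"

lemma cell_borel [measurable]: "{s. cell m s = c} \<in> sets borel"
proof -
  obtain a b d where "c = (a, b, d)" by (metis prod.collapse)
  then show ?thesis unfolding cell_def by simp
qed

lemma floor_eq_bounds:
  assumes "\<lfloor>real (Suc m) * x\<rfloor> = a"
  shows "x \<in> {real_of_int a / real (Suc m)..(real_of_int a + 1) / real (Suc m)}"
proof -
  have "real_of_int a \<le> real (Suc m) * x" "real (Suc m) * x \<le> real_of_int a + 1"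
    using assms by linarith+
  then show ?thesis by (simp add: field_simps del: of_nat_Suc)
qed

lemma cell_bounded: "bounded {s. cell m s = c}"
proof -
  obtain a b d where c: "c = (a, b, d)" by (metis prod.collapse)
  let ?I = "\<lambda>a::int. {real_of_int a / real (Suc m)..(real_of_int a + 1) / real (Suc m)}"
  have "{s. cell m s = c} \<subseteq> (?I a \<times> ?I b) \<times> ?I d"
    using floor_eq_bounds[of m] by (auto simp: c cell_def mem_Times_iff simp del: of_nat_Suc)
  then show ?thesis by (rule bounded_subset[rotated]) (intro bounded_Times bounded_closed_interval)
qed

lemma eventually_floor_neq:
  assumes "x \<noteq> (y::real)"
  shows "\<forall>\<^sub>F m in sequentially. \<lfloor>real (Suc m) * x\<rfloor> \<noteq> \<lfloor>real (Suc m) * y\<rfloor>"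
proof -
  obtain k :: nat where k: "1 / \<bar>x - y\<bar> < real k" using reals_Archimedean2 by blast
  show ?thesis
  proof (rule eventually_sequentiallyI[of k])
    fix m assume "k \<le> m"
    then have "1 / \<bar>x - y\<bar> < real (Suc m)" using k by simp
    then have "1 < real (Suc m) * \<bar>x - y\<bar>" using assms by (simp add: divide_less_eq)
    then have "1 < \<bar>real (Suc m) * x - real (Suc m) * y\<bar>"
      by (simp add: abs_mult[symmetric] right_diff_distrib[symmetric] abs_mult)
    then show "\<lfloor>real (Suc m) * x\<rfloor> \<noteq> \<lfloor>real (Suc m) * y\<rfloor>"
      by linarith
  qed
qed

text \<open>Separation holds for all fine enough grids, so a common grid can be chosen for the three
  pairs formed by a triple.\<close>

lemma eventually_cell_neq:
  assumes "a \<noteq> b"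
  shows "\<forall>\<^sub>F m in sequentially. cell m a \<noteq> cell m b"
proof -
  have "fst (fst a) \<noteq> fst (fst b) \<or> snd (fst a) \<noteq> snd (fst b) \<or> snd a \<noteq> snd b"
    using assms by (auto simp: prod_eq_iff)
  then show ?thesis
    by (auto simp del: of_nat_Suc simp: cell_def dest!: eventually_floor_neq elim!: eventually_mono)
qed

section \<open>Mean number of pairs with an empty region\<close>

abbreviation grid :: "nat \<Rightarrow> real \<Rightarrow> real" where
  "grid m x \<equiv> real_of_int \<lfloor>real (Suc m) * x\<rfloor> / real (Suc m)"

lemma grid_error: "\<bar>grid m x - x\<bar> \<le> 1 / real (Suc m)"
proof -
  have "\<bar>real_of_int \<lfloor>real (Suc m) * x\<rfloor> - real (Suc m) * x\<bar> \<le> 1" by linarith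
  then have "\<bar>real_of_int \<lfloor>real (Suc m) * x\<rfloor> - real (Suc m) * x\<bar> / real (Suc m) \<le> 1 / real (Suc m)"
    by (intro divide_right_mono) auto
  moreover have "(real_of_int \<lfloor>real (Suc m) * x\<rfloor> - real (Suc m) * x) / real (Suc m)
      = grid m x - x"
    by (simp add: diff_divide_distrib del: of_nat_Suc)
  ultimately show ?thesis by (metis abs_divide abs_of_nat)
qed

lemma grid_tendsto: "(\<lambda>m. grid m x) \<longlonglongrightarrow> x"
proof (rule LIM_zero_cancel, rule Lim_null_comparison)
  show "\<forall>\<^sub>F m in sequentially. norm (grid m x - x) \<le> 1 / real (Suc m)"
    using grid_error by (simp del: of_nat_Suc)
  show "(\<lambda>m. 1 / real (Suc m)) \<longlonglongrightarrow> 0" by (rule lim_1_over_n[THEN LIMSEQ_Suc])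
qed

lemma eventually_less_if_tendsto:
  fixes f g :: "'a \<Rightarrow> real"
  assumes "(f \<longlongrightarrow> a) F" "(g \<longlongrightarrow> b) F" "a < b"
  shows "\<forall>\<^sub>F x in F. f x < g x"
  using order_tendstoD(1)[OF tendsto_diff[OF assms(2,1)], of 0] assms(3) by simp

text \<open>A condition that does not mention the counted element becomes a factor 0 or 1; this is
  how a fixed void event is separated from the count of pairs.\<close>

lemma num_conj: "num {p \<in> B. c} = of_bool c * num B"
  by (cases c) simp_all

locale stations = typed_poisson M n lam \<Psi> for M :: "'w measure" and n lam \<Psi> +
  fixes v :: "nat \<Rightarrow> real"
  assumes v_pos: "\<And>i. i \<in> {1..n} \<Longrightarrow> 0 < v i"
begin

definition lam_total :: real where "lam_total = (\<Sum>l=1..n. lam l)"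

text \<open>There are no stations with directions outside [0,2pi); cutting these directions off
  makes the set bounded.\<close>

definition region :: "real \<Rightarrow> real \<Rightarrow> nat \<Rightarrow> station set" where
  "region t r l = {s. dist_at (v l) s t < r} \<inter> UNIV \<times> {0..<2*pi}"

text \<open>A station closer than r at time t started within distance r plus the length of the path
  travelled.\<close>

lemma region_window: "l \<in> {1..n} \<Longrightarrow> window l (region t r l)"
proof -
  assume l: "l \<in> {1..n}"
  have "norm (fst s) \<le> r + \<bar>v l * t\<bar>" if "s \<in> region t r l" for s
  proof -
    have "norm (fst s) \<le> norm (fst s + (v l * t) *\<^sub>R (cos (snd s), sin (snd s))) + norm ((v l * t) *\<^sub>R (cos (snd s), sin (snd s)))"
      by (metis add_diff_cancel_right' norm_triangle_ineq4)
    moreover have "norm ((v l * t) *\<^sub>R (cos (snd s), sin (snd s))) = \<bar>v l * t\<bar>"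
      by (simp only: norm_scaleR) (simp add: norm_prod_def)
    ultimately show ?thesis using that by (simp add: region_def dist_at_eq_norm)
  qed
  then have "region t r l \<subseteq> cball 0 (r + \<bar>v l * t\<bar>) \<times> {0..2*pi}"
    by (auto simp: region_def)
  then have "bounded (region t r l)"
    by (rule bounded_subset[rotated]) (intro bounded_Times bounded_cball bounded_closed_interval)
  moreover have "region t r l \<in> sets borel"
    unfolding region_def by (intro sets.Int) measurable
  ultimately show ?thesis using l by (simp add: window_def)
qed

lemma measure_region:
  assumes "l \<in> {1..n}"
  shows "measure (intensity (lam l)) (region t r l) = lam l * pi * (max 0 r)\<^sup>2"
proof -
  have [measurable]: "{s. dist_at (v l) s t < r} \<in> sets borel" by measurable
  have "emeasure (intensity (lam l)) (region t r l) = emeasure (intensity (lam l)) {s. dist_at (v l) s t < r}"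
    by (simp add: region_def emeasure_intensity Int_assoc)
  then show ?thesis
    using lam_pos[OF assms] by (simp add: measure_def emeasure_intensity_ball)
qed

lemma void_region:
  assumes "\<omega> \<in> space M"
  shows "void (region t r) \<omega> \<longleftrightarrow> (\<forall>l\<in>{1..n}. \<forall>s\<in>\<Psi> l \<omega>. r \<le> dist_at (v l) s t)"
  using marks[OF _ assms] by (fastforce simp: void_def region_def not_less)

text \<open>The void region of a pair depends on the pair only through the meeting time and distance.
  Rounding these to a grid and shrinking the regions slightly leaves countably many void events, each
  independent of the pairs it is combined with, because the two stations lie outside the
  shrunken region. Refining the grid recovers the formula by dominated convergence.\<close>

lemma pair_formula_local:
  assumes Q: "window i Q" "window j Q'" "typed_disjoint i Q j Q'"
    and A[measurable]: "A \<in> sets (borel \<Otimes>\<^sub>M borel)" and AQ: "A \<subseteq> Q \<times> Q'"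
    and \<tau>[measurable]: "\<tau> \<in> borel_measurable (borel \<Otimes>\<^sub>M borel)"
    and \<rho>[measurable]: "\<rho> \<in> borel_measurable (borel \<Otimes>\<^sub>M borel)"
    and far: "\<And>p. p \<in> A \<Longrightarrow> \<rho> p \<le> dist_at (v i) (fst p) (\<tau> p)" "\<And>p. p \<in> A \<Longrightarrow> \<rho> p \<le> dist_at (v j) (snd p) (\<tau> p)"
    and nonneg: "\<And>p. p \<in> A \<Longrightarrow> 0 \<le> \<rho> p"
  shows "(\<lambda>\<omega>. num {p \<in> A \<inter> \<Psi> i \<omega> \<times> \<Psi> j \<omega>. void (region (\<tau> p) (\<rho> p)) \<omega>}) \<in> borel_measurable M
    \<and> (\<integral>\<^sup>+\<omega>. num {p \<in> A \<inter> \<Psi> i \<omega> \<times> \<Psi> j \<omega>. void (region (\<tau> p) (\<rho> p)) \<omega>} \<partial>M)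
     = (\<integral>\<^sup>+p. indicator A p * ennreal (exp (- lam_total * pi * (\<rho> p)\<^sup>2)) \<partial>(intensity (lam i) \<Otimes>\<^sub>M intensity (lam j)))"
proof -
  let ?\<nu> = "intensity (lam i) \<Otimes>\<^sub>M intensity (lam j)"
  interpret J: sigma_finite_measure "intensity (lam j)" by (rule sigma_finite_intensity)
  have sets\<nu>[measurable_cong]: "sets ?\<nu> = sets (borel \<Otimes>\<^sub>M borel)" by (simp cong: sets_pair_measure_cong)
  have ij: "i \<in> {1..n}" "j \<in> {1..n}" using Q by (auto simp: window_def)
  define F where "F \<omega> = (\<Psi> i \<omega> \<inter> Q) \<times> (\<Psi> j \<omega> \<inter> Q')" for \<omega>
  have finF: "finite (F \<omega>)" if "\<omega> \<in> space M" for \<omega>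
    using that Q unfolding F_def by (intro finite_cartesian_product locally_finite) (auto simp: window_def)
  have AF: "A \<inter> \<Psi> i \<omega> \<times> \<Psi> j \<omega> = A \<inter> F \<omega>" for \<omega> using AQ by (auto simp: F_def)
  \<comment> \<open>The radius is reduced by v_l / (m + 1), which is the farthest a type-l station
    can move within the rounding error of the time. Rounding the distance down only shrinks the
    region further, so \<open>K\<close> lies inside the true region.\<close>
  define K where "K m c l = region (real_of_int (fst c) / real (Suc m)) (real_of_int (snd c) / real (Suc m) - v l / real (Suc m)) l"
    for m :: nat and c :: "int \<times> int" and l
  define ct where "ct m p = (\<lfloor>real (Suc m) * \<tau> p\<rfloor>, \<lfloor>real (Suc m) * \<rho> p\<rfloor>)" for m p
  have winK: "window l (K m c l)" if "l \<in> {1..n}" for m c l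
    unfolding K_def by (rule region_window[OF that])
  have K_sub: "s \<in> K m (ct m p) l \<Longrightarrow> dist_at (v l) s (\<tau> p) < \<rho> p" if "l \<in> {1..n}" for s m p l
  proof -
    assume "s \<in> K m (ct m p) l"
    then have "dist_at (v l) s (grid m (\<tau> p)) < grid m (\<rho> p) - v l / real (Suc m)"
      by (simp add: K_def ct_def region_def)
    moreover have "dist_at (v l) s (\<tau> p) \<le> dist_at (v l) s (grid m (\<tau> p))
        + \<bar>v l\<bar> * \<bar>\<tau> p - grid m (\<tau> p)\<bar>" by (rule dist_at_lipschitz)
    moreover have "\<bar>v l\<bar> * \<bar>\<tau> p - grid m (\<tau> p)\<bar> \<le> v l * (1 / real (Suc m))"
      using v_pos[OF that] grid_error[of m "\<tau> p"] by (intro mult_mono) (auto simp: abs_minus_commute simp del: of_nat_Suc)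
    moreover have "grid m (\<rho> p) \<le> \<rho> p"
      using of_int_floor_le[of "real (Suc m) * \<rho> p"] by (simp add: divide_le_eq mult.commute del: of_nat_Suc)
    ultimately show ?thesis by simp
  qed
  have K_lim: "\<forall>\<^sub>F m in sequentially. s \<in> K m (ct m p) l"
    if "dist_at (v l) s (\<tau> p) < \<rho> p" "s \<in> UNIV \<times> {0..<2*pi}" for s p l
  proof -
    have "(\<lambda>m. dist_at (v l) s (grid m (\<tau> p))) \<longlonglongrightarrow> dist_at (v l) s (\<tau> p)"
      unfolding dist_at_def by (intro tendsto_intros grid_tendsto)
    moreover have "(\<lambda>m. grid m (\<rho> p) - v l * (1 / real (Suc m))) \<longlonglongrightarrow> \<rho> p - v l * 0"
      by (intro tendsto_intros grid_tendsto lim_1_over_n[THEN LIMSEQ_Suc])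
    ultimately have "\<forall>\<^sub>F m in sequentially. dist_at (v l) s (grid m (\<tau> p))
       < grid m (\<rho> p) - v l * (1 / real (Suc m))"
      by (rule eventually_less_if_tendsto) (use that(1) in simp)
    then show ?thesis
      by eventually_elim (use that(2) in \<open>simp add: K_def ct_def region_def\<close>)
  qed
  define X where "X m \<omega> = num {p \<in> A \<inter> F \<omega>. void (K m (ct m p)) \<omega>}" for m \<omega>
  define Y where "Y \<omega> = num {p \<in> A \<inter> F \<omega>. void (region (\<tau> p) (\<rho> p)) \<omega>}" for \<omega>
  define w where "w m c = (\<Prod>l\<in>{1..n}. ennreal (exp (- measure (intensity (lam l)) (K m c l))))" for m c
  \<comment> \<open>On one piece the rounded meeting data are constant, so a single fixed void event
    serves all its pairs; the pieces are numbered through an encoding of pairs of integers.\<close>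
  define A' where "A' m k = {p \<in> A. to_nat (ct m p) = k}" for m k
  have A'_sets[measurable]: "A' m k \<in> sets (borel \<Otimes>\<^sub>M borel)" for m k
  proof -
    have "A' m k = {p \<in> space (borel \<Otimes>\<^sub>M borel). p \<in> A \<and> \<lfloor>real (Suc m) * \<tau> p\<rfloor> = fst (from_nat k :: int \<times> int) \<and> \<lfloor>real (Suc m) * \<rho> p\<rfloor> = snd (from_nat k :: int \<times> int) \<and> to_nat (from_nat k :: int \<times> int) = k}"
      by (auto simp: A'_def ct_def space_pair_measure prod_eq_iff simp del: of_nat_Suc) 
    also have "\<dots> \<in> sets (borel \<Otimes>\<^sub>M borel)" by measurable
    finally show ?thesis .
  qed
  have disjA': "disjoint_family (A' m)" for m by (auto simp: disjoint_family_on_def A'_def)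
  have UA': "(\<Union>k. A' m k) = A" for m by (auto simp: A'_def)
  have piece: "(\<lambda>\<omega>. num (A' m k \<inter> F \<omega>)) \<in> borel_measurable M \<and>
    (\<integral>\<^sup>+\<omega>. of_bool (void (K m (from_nat k)) \<omega>) * num (A' m k \<inter> F \<omega>) \<partial>M) = w m (from_nat k) * emeasure ?\<nu> (A' m k)" for m k
  proof -
    let ?K = "K m (from_nat k)"
    \<comment> \<open>The windows are cut down to be disjoint from the fixed void region. No pair of
      the piece is lost: its stations are at distance at least \<rho>, those of \<open>K\<close> at
      distance less than \<rho>.\<close>
    let ?Q = "Q \<inter> (- ?K i)" and ?Q' = "Q' \<inter> (- ?K j)"
    have "?K i \<in> sets borel" "?K j \<in> sets borel"
      using winK[OF ij(1), of m "from_nat k"] winK[OF ij(2), of m "from_nat k"] by (simp_all add: window_def)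
    then have wQ: "window i ?Q" "window j ?Q'"
      by (simp_all only: window_Int[OF Q(1)] window_Int[OF Q(2)] borel_comp)
    have dQ: "typed_disjoint i ?Q j ?Q'" using Q(3) by (auto simp: typed_disjoint_def)
    have *: "(\<lambda>\<omega>. num (A' m k \<inter> (\<Psi> i \<omega> \<inter> ?Q) \<times> (\<Psi> j \<omega> \<inter> ?Q'))) \<in> borel_measurable M
    \<and> (\<integral>\<^sup>+\<omega>. of_bool (void ?K \<omega>) * num (A' m k \<inter> (\<Psi> i \<omega> \<inter> ?Q) \<times> (\<Psi> j \<omega> \<inter> ?Q')) \<partial>M)
      = w m (from_nat k) * emeasure ?\<nu> (A' m k \<inter> ?Q \<times> ?Q')"
      unfolding w_def by (rule pair_mean_void[OF wQ dQ winK _ _ A'_sets]) auto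
    have A'Q: "A' m k \<subseteq> ?Q \<times> ?Q'"
    proof
      fix p assume p: "p \<in> A' m k"
      then have pA: "p \<in> A" and k: "from_nat k = ct m p" by (auto simp: A'_def)
      have "fst p \<notin> K m (ct m p) i" "snd p \<notin> K m (ct m p) j"
        using far[OF pA] K_sub[OF ij(1), of "fst p" m p] K_sub[OF ij(2), of "snd p" m p] by linarith+
      then show "p \<in> ?Q \<times> ?Q'" using pA AQ k by (auto simp: mem_Times_iff)
    qed
    then have "A' m k \<inter> (\<Psi> i \<omega> \<inter> ?Q) \<times> (\<Psi> j \<omega> \<inter> ?Q') = A' m k \<inter> F \<omega>" for \<omega>
      unfolding F_def by blast
    moreover have "A' m k \<inter> ?Q \<times> ?Q' = A' m k" using A'Q by auto
    ultimately show ?thesis using * by (simp only:)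
  qed
  have voidK[measurable]: "(\<lambda>\<omega>. of_bool (void (K m c) \<omega>) :: ennreal) \<in> borel_measurable M" for m c
    using winK by (intro void_measurable) (auto simp: window_def)
  have Xsum: "X m \<omega> = (\<Sum>k. of_bool (void (K m (from_nat k)) \<omega>) * num (A' m k \<inter> F \<omega>))" for m \<omega>
  proof -
    let ?S = "\<lambda>k. {p \<in> A' m k \<inter> F \<omega>. void (K m (from_nat k)) \<omega>}"
    have "{p \<in> A \<inter> F \<omega>. void (K m (ct m p)) \<omega>} = (\<Union>k. ?S k)"
      by (auto simp: A'_def)
    moreover have "disjoint_family ?S" using disjA'[of m] by (auto simp: disjoint_family_on_def)
    ultimately have "X m \<omega> = (\<Sum>k. num (?S k))"
      unfolding X_def by (simp add: suminf_emeasure)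
    also have "(\<lambda>k. num (?S k)) = (\<lambda>k. of_bool (void (K m (from_nat k)) \<omega>) * num (A' m k \<inter> F \<omega>))"
      by (simp only: num_conj)
    finally show ?thesis .
  qed
  have Xmeas[measurable]: "X m \<in> borel_measurable M" for m
    unfolding Xsum[abs_def] using piece by (intro borel_measurable_suminf_order borel_measurable_times_ennreal) auto
  have w_eq: "(\<integral>\<^sup>+p. indicator A p * w m (ct m p) \<partial>?\<nu>) = (\<Sum>k. w m (from_nat k) * emeasure ?\<nu> (A' m k))" for m
  proof -
    have "indicator A p * w m (ct m p) = (\<Sum>k. w m (from_nat k) * indicator (A' m k) p)" for p
    proof -
      have "(\<Sum>k. w m (from_nat k) * indicator (A' m k) p) = (\<Sum>k\<in>{to_nat (ct m p)}. w m (from_nat k) * indicator (A' m k) p)"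
        by (intro suminf_finite) (auto simp: A'_def)
      then show ?thesis by (simp add: A'_def indicator_def mult.commute)
    qed
    then have "(\<integral>\<^sup>+p. indicator A p * w m (ct m p) \<partial>?\<nu>) = (\<integral>\<^sup>+p. (\<Sum>k. w m (from_nat k) * indicator (A' m k) p) \<partial>?\<nu>)"
      by simp
    also have "\<dots> = (\<Sum>k. w m (from_nat k) * emeasure ?\<nu> (A' m k))"
      by (subst nn_integral_suminf) (auto simp: nn_integral_cmult)
    finally show ?thesis .
  qed
  have XI: "(\<integral>\<^sup>+\<omega>. X m \<omega> \<partial>M) = (\<integral>\<^sup>+p. indicator A p * w m (ct m p) \<partial>?\<nu>)" for m
  proof -
    have "(\<integral>\<^sup>+\<omega>. X m \<omega> \<partial>M) = (\<Sum>k. \<integral>\<^sup>+\<omega>. of_bool (void (K m (from_nat k)) \<omega>) * num (A' m k \<inter> F \<omega>) \<partial>M)"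
      unfolding Xsum using piece by (intro nn_integral_suminf borel_measurable_times_ennreal) auto
    then show ?thesis using piece by (simp add: w_eq)
  qed
  have Xlim: "(\<lambda>m. X m \<omega>) \<longlonglongrightarrow> Y \<omega>" if om: "\<omega> \<in> space M" for \<omega>
  proof (rule tendsto_eventually)
    \<comment> \<open>Only finitely many pairs have to be compared, so one threshold for m suffices.
      A void true region leaves all shrunken ones void; a station in the open true region eventually
      lies in the shrunken ones.\<close>
    have "\<forall>\<^sub>F m in sequentially. \<forall>p\<in>F \<omega>. void (K m (ct m p)) \<omega> \<longleftrightarrow> void (region (\<tau> p) (\<rho> p)) \<omega>"
    proof (rule eventually_ball_finite[OF finF[OF om]], rule ballI)
      fix p assume "p \<in> F \<omega>"
      show "\<forall>\<^sub>F m in sequentially. void (K m (ct m p)) \<omega> \<longleftrightarrow> void (region (\<tau> p) (\<rho> p)) \<omega>"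
      proof (cases "void (region (\<tau> p) (\<rho> p)) \<omega>")
        case True
        have "void (K m (ct m p)) \<omega>" for m
          unfolding void_def
        proof (intro ballI equals0I)
          fix l s assume l: "l \<in> {1..n}" and s: "s \<in> \<Psi> l \<omega> \<inter> K m (ct m p) l"
          then have "dist_at (v l) s (\<tau> p) < \<rho> p" by (intro K_sub[OF l]) blast
          moreover have "\<rho> p \<le> dist_at (v l) s (\<tau> p)" using True l s unfolding void_region[OF om] by blast
          ultimately show False by linarith
        qed
        with True show ?thesis by simp
      next
        case False
        then obtain l s where l: "l \<in> {1..n}" "s \<in> \<Psi> l \<omega>" "dist_at (v l) s (\<tau> p) < \<rho> p"
          unfolding void_region[OF om] by (auto simp: not_le)
        then have "\<forall>\<^sub>F m in sequentially. s \<in> K m (ct m p) l" using marks[OF l(1) om] by (intro K_lim) auto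
        then show ?thesis
        proof eventually_elim
          case (elim m)
          then have "\<not> void (K m (ct m p)) \<omega>" using l by (auto simp: void_def)
          with False show ?case by simp
        qed
      qed
    qed
    then show "\<forall>\<^sub>F m in sequentially. X m \<omega> = Y \<omega>"
    proof eventually_elim
      case (elim m)
      then have "{p \<in> A \<inter> F \<omega>. void (K m (ct m p)) \<omega>} = {p \<in> A \<inter> F \<omega>. void (region (\<tau> p) (\<rho> p)) \<omega>}" by auto
      then show ?case by (simp add: X_def Y_def)
    qed
  qed
  have Ymeas[measurable]: "Y \<in> borel_measurable M"
    by (rule borel_measurable_LIMSEQ_order[OF Xlim Xmeas])
  \<comment> \<open>With empty void regions the formula gives the mean number of all pairs in the
    two windows, which serves as integrable bound.\<close>
  have bound: "(\<lambda>\<omega>. num (UNIV \<inter> F \<omega>)) \<in> borel_measurable M \<and> (\<integral>\<^sup>+\<omega>. num (UNIV \<inter> F \<omega>) \<partial>M) = emeasure ?\<nu> (UNIV \<inter> Q \<times> Q')"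
  proof -
    have "window l {}" if "l \<in> {1..n}" for l using that by (simp add: window_def)
    with pair_mean_void[OF Q, of "\<lambda>_. {}" UNIV] sets.top[of "borel \<Otimes>\<^sub>M borel :: (station \<times> station) measure"]
    show ?thesis by (simp add: void_def F_def space_pair_measure)
  qed
  have QQ: "emeasure ?\<nu> (Q \<times> Q') < \<infinity>"
    using Q emeasure_intensity_finite[of Q "lam i"] emeasure_intensity_finite[of Q' "lam j"]
    by (subst J.emeasure_pair_measure_Times) (auto simp: window_def ennreal_mult_less_top)
  have "(\<lambda>m. \<integral>\<^sup>+\<omega>. X m \<omega> \<partial>M) \<longlonglongrightarrow> (\<integral>\<^sup>+\<omega>. Y \<omega> \<partial>M)"
  proof (rule nn_integral_dominated_convergence[where w="\<lambda>\<omega>. num (UNIV \<inter> F \<omega>)"])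
    show "AE \<omega> in M. X m \<omega> \<le> num (UNIV \<inter> F \<omega>)" for m
      unfolding X_def by (intro AE_I2 emeasure_mono) auto
    show "AE \<omega> in M. (\<lambda>m. X m \<omega>) \<longlonglongrightarrow> Y \<omega>" using Xlim by (intro AE_I2)
    show "(\<lambda>\<omega>. num (UNIV \<inter> F \<omega>)) \<in> borel_measurable M" using bound by blast
    show "(\<integral>\<^sup>+\<omega>. num (UNIV \<inter> F \<omega>) \<partial>M) < \<infinity>"
      unfolding bound[THEN conjunct2] using QQ by (simp only: Int_UNIV_left)
  qed (fact Xmeas Ymeas)+
  moreover have "(\<lambda>m. \<integral>\<^sup>+p. indicator A p * w m (ct m p) \<partial>?\<nu>) \<longlonglongrightarrow> (\<integral>\<^sup>+p. indicator A p * ennreal (exp (- lam_total * pi * (\<rho> p)\<^sup>2)) \<partial>?\<nu>)"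
  proof -
    \<comment> \<open>A shrunken radius can be negative and then contributes an empty disc, whence
      the truncation at 0; it disappears in the limit because \<rho> is nonnegative on A.\<close>
    define r where "r m p l = grid m (\<rho> p) - v l * (1 / real (Suc m))" for m p l
    have w: "w m (ct m p) = ennreal (exp (- (\<Sum>l=1..n. lam l * pi * (max 0 (r m p l))\<^sup>2)))" for m p
    proof -
      have "w m (ct m p) = (\<Prod>l\<in>{1..n}. ennreal (exp (- (lam l * pi * (max 0 (r m p l))\<^sup>2))))"
        unfolding w_def by (intro prod.cong refl) (simp add: K_def measure_region r_def ct_def del: of_nat_Suc)
      also have "\<dots> = ennreal (exp (\<Sum>l\<in>{1..n}. - (lam l * pi * (max 0 (r m p l))\<^sup>2)))"
        by (subst prod_ennreal) (auto simp: exp_sum)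
      finally show ?thesis by (simp add: sum_negf)
    qed
    have r_lim: "(\<lambda>m. r m p l) \<longlonglongrightarrow> \<rho> p" for p l
    proof -
      have "(\<lambda>m. r m p l) \<longlonglongrightarrow> \<rho> p - v l * 0"
        unfolding r_def by (intro tendsto_intros grid_tendsto lim_1_over_n[THEN LIMSEQ_Suc])
      then show ?thesis by simp
    qed
    have [measurable]: "(\<lambda>p. r m p l) \<in> borel_measurable (borel \<Otimes>\<^sub>M borel)" for m l
      unfolding r_def by measurable
    have lim: "(\<lambda>m. indicator A p * w m (ct m p)) \<longlonglongrightarrow> indicator A p * ennreal (exp (- lam_total * pi * (\<rho> p)\<^sup>2))" for p
    proof (cases "p \<in> A")
      case True
      have "(\<lambda>m. exp (- (\<Sum>l=1..n. lam l * pi * (max 0 (r m p l))\<^sup>2))) \<longlonglongrightarrow> exp (- (\<Sum>l=1..n. lam l * pi * (max 0 (\<rho> p))\<^sup>2))"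
        by (intro tendsto_intros r_lim)
      also have "(\<Sum>l=1..n. lam l * pi * (max 0 (\<rho> p))\<^sup>2) = lam_total * pi * (\<rho> p)\<^sup>2"
        using nonneg[OF True] by (simp add: lam_total_def sum_distrib_right max_def)
      finally show ?thesis using True by (simp add: w tendsto_ennrealI)
    qed simp
    show ?thesis
    proof (rule nn_integral_dominated_convergence[where w="indicator A"])
      show "(\<lambda>p. indicator A p * w m (ct m p)) \<in> borel_measurable ?\<nu>" for m
        unfolding w by measurable
      have "0 \<le> (\<Sum>l=1..n. lam l * pi * (max 0 (r m p l))\<^sup>2)" for m p
        using lam_pos by (intro sum_nonneg mult_nonneg_nonneg) (auto simp: less_imp_le)
      then show "AE p in ?\<nu>. indicator A p * w m (ct m p) \<le> indicator A p" for m
        unfolding w by (intro AE_I2) (simp add: indicator_def)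
      have "emeasure ?\<nu> A \<le> emeasure ?\<nu> (Q \<times> Q')"
        using AQ Q by (intro emeasure_mono) (auto intro!: pair_measureI simp: window_def)
      then show "(\<integral>\<^sup>+p. indicator A p \<partial>?\<nu>) < \<infinity>" using QQ by simp
      show "AE p in ?\<nu>. (\<lambda>m. indicator A p * w m (ct m p)) \<longlonglongrightarrow> indicator A p * ennreal (exp (- lam_total * pi * (\<rho> p)\<^sup>2))"
        using lim by (intro AE_I2)
    qed measurable
  qed
  ultimately have "(\<integral>\<^sup>+\<omega>. Y \<omega> \<partial>M) = (\<integral>\<^sup>+p. indicator A p * ennreal (exp (- lam_total * pi * (\<rho> p)\<^sup>2)) \<partial>?\<nu>)"
    unfolding XI by (rule LIMSEQ_unique)
  then show ?thesis using Ymeas unfolding Y_def AF by simp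
qed

text \<open>Off the diagonal, pairs are separated by the cells of a sufficiently fine grid, so countably
  many products of disjoint windows suffice.\<close>

lemma pair_formula:
  assumes ij: "i \<in> {1..n}" "j \<in> {1..n}"
    and A[measurable]: "A \<in> sets (borel \<Otimes>\<^sub>M borel)" and off: "\<And>p. p \<in> A \<Longrightarrow> i = j \<Longrightarrow> fst p \<noteq> snd p"
    and \<tau>[measurable]: "\<tau> \<in> borel_measurable (borel \<Otimes>\<^sub>M borel)"
    and \<rho>[measurable]: "\<rho> \<in> borel_measurable (borel \<Otimes>\<^sub>M borel)"
    and far: "\<And>p. p \<in> A \<Longrightarrow> \<rho> p \<le> dist_at (v i) (fst p) (\<tau> p)" "\<And>p. p \<in> A \<Longrightarrow> \<rho> p \<le> dist_at (v j) (snd p) (\<tau> p)"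
    and nonneg: "\<And>p. p \<in> A \<Longrightarrow> 0 \<le> \<rho> p"
  shows "(\<lambda>\<omega>. num {p \<in> A \<inter> \<Psi> i \<omega> \<times> \<Psi> j \<omega>. void (region (\<tau> p) (\<rho> p)) \<omega>}) \<in> borel_measurable M
    \<and> (\<integral>\<^sup>+\<omega>. num {p \<in> A \<inter> \<Psi> i \<omega> \<times> \<Psi> j \<omega>. void (region (\<tau> p) (\<rho> p)) \<omega>} \<partial>M)
     = (\<integral>\<^sup>+p. indicator A p * ennreal (exp (- lam_total * pi * (\<rho> p)\<^sup>2)) \<partial>(intensity (lam i) \<Otimes>\<^sub>M intensity (lam j)))"
proof -
  let ?N = "\<lambda>B \<omega>. num {p \<in> B \<inter> \<Psi> i \<omega> \<times> \<Psi> j \<omega>. void (region (\<tau> p) (\<rho> p)) \<omega>}"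
  let ?e = "\<lambda>p. ennreal (exp (- lam_total * pi * (\<rho> p)\<^sup>2))"
  let ?\<nu> = "intensity (lam i) \<Otimes>\<^sub>M intensity (lam j)"
  have sets\<nu>[measurable_cong]: "sets ?\<nu> = sets (borel \<Otimes>\<^sub>M borel)" by (simp cong: sets_pair_measure_cong)
  define ix :: "nat \<Rightarrow> nat \<times> (int \<times> int \<times> int) \<times> (int \<times> int \<times> int)" where "ix = from_nat"
  \<comment> \<open>For equal types an index with two equal cells is useless and receives empty
    windows, so that every index yields disjoint windows.\<close>
  define ok where "ok k \<longleftrightarrow> (i = j \<longrightarrow> fst (snd (ix k)) \<noteq> snd (snd (ix k)))" for k
  define C where "C k = (if ok k then {s. cell (fst (ix k)) s = fst (snd (ix k))} else {})" for k
  define C' where "C' k = (if ok k then {s. cell (fst (ix k)) s = snd (snd (ix k))} else {})" for k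
  have win: "window i (C k)" "window j (C' k)" "typed_disjoint i (C k) j (C' k)" for k
    using ij cell_bounded by (auto simp: window_def C_def C'_def typed_disjoint_def ok_def)
  let ?W = "\<lambda>k. C k \<times> C' k"
  \<comment> \<open>Cells of different grids overlap, so the rectangles are made disjoint before
    summing; each piece still lies in its own rectangle.\<close>
  let ?D = "\<lambda>k. A \<inter> disjointed ?W k"
  have W: "?W k \<in> sets (borel \<Otimes>\<^sub>M borel)" for k
    using win by (intro pair_measureI) (auto simp: window_def)
  have D[measurable]: "?D k \<in> sets (borel \<Otimes>\<^sub>M borel)" for k
    using sets.range_disjointed_sets[of ?W] W by (intro sets.Int A) blast
  have cover: "A \<subseteq> (\<Union>k. ?W k)"
  proof
    fix p assume p: "p \<in> A"
    have "\<exists>m. i = j \<longrightarrow> cell m (fst p) \<noteq> cell m (snd p)"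
      using eventually_cell_neq[of "fst p" "snd p"] off[OF p]
      by (auto dest!: eventually_happens)
    then obtain m where m: "i = j \<longrightarrow> cell m (fst p) \<noteq> cell m (snd p)" ..
    define k where "k = to_nat (m, cell m (fst p), cell m (snd p))"
    have "ix k = (m, cell m (fst p), cell m (snd p))" by (simp add: ix_def k_def)
    then have "p \<in> ?W k" using m by (auto simp: C_def C'_def ok_def mem_Times_iff)
    then show "p \<in> (\<Union>k. ?W k)" by blast
  qed
  then have UD: "(\<Union>k. ?D k) = A" by (auto simp: UN_disjointed_eq simp flip: Int_UN_distrib)
  have disj: "disjoint_family ?D" using disjoint_family_disjointed[of ?W] by (auto simp: disjoint_family_on_def)
  have D_sub: "?D k \<subseteq> ?W k" for k using disjointed_subset[of ?W k] by auto
  have loc: "(\<lambda>\<omega>. ?N (?D k) \<omega>) \<in> borel_measurable M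
    \<and> (\<integral>\<^sup>+\<omega>. ?N (?D k) \<omega> \<partial>M)
     = (\<integral>\<^sup>+p. indicator (?D k) p * ?e p \<partial>?\<nu>)" for k
    using far nonneg by (intro pair_formula_local[OF win D D_sub \<tau> \<rho>]) auto
  have sum: "?N A \<omega>
      = (\<Sum>k. ?N (?D k) \<omega>)" for \<omega>
  proof -
    have "disjoint_family (\<lambda>k. {p \<in> ?D k \<inter> \<Psi> i \<omega> \<times> \<Psi> j \<omega>. void (region (\<tau> p) (\<rho> p)) \<omega>})"
      using disj by (auto simp: disjoint_family_on_def)
    moreover have "{p \<in> A \<inter> \<Psi> i \<omega> \<times> \<Psi> j \<omega>. void (region (\<tau> p) (\<rho> p)) \<omega>}
      = (\<Union>k. {p \<in> ?D k \<inter> \<Psi> i \<omega> \<times> \<Psi> j \<omega>. void (region (\<tau> p) (\<rho> p)) \<omega>})" using UD by blast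
    ultimately show ?thesis by (simp add: suminf_emeasure)
  qed
  have ind: "(\<Sum>k. indicator (?D k) p) = (indicator A p :: ennreal)" for p
    using suminf_indicator[OF disj, of p] UD by simp
  have "(\<integral>\<^sup>+\<omega>. ?N A \<omega> \<partial>M)
     = (\<Sum>k. \<integral>\<^sup>+p. indicator (?D k) p * ?e p \<partial>?\<nu>)"
    unfolding sum using loc by (subst nn_integral_suminf) auto
  also have "\<dots> = (\<integral>\<^sup>+p. (\<Sum>k. indicator (?D k) p * ?e p) \<partial>?\<nu>)"
    by (rule nn_integral_suminf[symmetric]) measurable
  also have "\<dots> = (\<integral>\<^sup>+p. indicator A p * ?e p \<partial>?\<nu>)"
    by (simp add: ind)
  finally have "(\<integral>\<^sup>+\<omega>. ?N A \<omega> \<partial>M)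
     = (\<integral>\<^sup>+p. indicator A p * ?e p \<partial>?\<nu>)" .
  moreover have "(\<lambda>\<omega>. ?N A \<omega>) \<in> borel_measurable M"
    unfolding sum by (rule borel_measurable_suminf_order) (use loc in blast)
  ultimately show ?thesis by blast
qed

text \<open>At distance 0 the void regions are empty and impose nothing, so the pair formula yields
  the plain mean number of pairs in A, which is zero here.\<close>

lemma AE_no_pair:
  assumes ij: "i \<in> {1..n}" "j \<in> {1..n}"
    and A[measurable]: "A \<in> sets (borel \<Otimes>\<^sub>M borel)" and off: "\<And>p. p \<in> A \<Longrightarrow> i = j \<Longrightarrow> fst p \<noteq> snd p"
    and null: "emeasure (intensity (lam i) \<Otimes>\<^sub>M intensity (lam j)) A = 0"
  shows "AE \<omega> in M. A \<inter> \<Psi> i \<omega> \<times> \<Psi> j \<omega> = {}"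
proof -
  let ?\<nu> = "intensity (lam i) \<Otimes>\<^sub>M intensity (lam j)"
  have sets\<nu>[measurable_cong]: "sets ?\<nu> = sets (borel \<Otimes>\<^sub>M borel)" by (simp cong: sets_pair_measure_cong)
  have *: "(\<lambda>\<omega>. num {p \<in> A \<inter> \<Psi> i \<omega> \<times> \<Psi> j \<omega>. void (region 0 0) \<omega>}) \<in> borel_measurable M
    \<and> (\<integral>\<^sup>+\<omega>. num {p \<in> A \<inter> \<Psi> i \<omega> \<times> \<Psi> j \<omega>. void (region 0 0) \<omega>} \<partial>M)
     = (\<integral>\<^sup>+p. indicator A p * ennreal (exp (- lam_total * pi * 0\<^sup>2)) \<partial>?\<nu>)"
    using off by (intro pair_formula[OF ij A, where \<tau>="\<lambda>_. 0" and \<rho>="\<lambda>_. 0"]) (auto simp: dist_at_nonneg)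
  also have "(\<integral>\<^sup>+p. indicator A p * ennreal (exp (- lam_total * pi * 0\<^sup>2)) \<partial>?\<nu>) = 0"
    using null by simp
  finally have "AE \<omega> in M. num {p \<in> A \<inter> \<Psi> i \<omega> \<times> \<Psi> j \<omega>. void (region 0 0) \<omega>} = 0"
    by (elim conjE) (rule nn_integral_0_iff_AE[THEN iffD1])
  then show ?thesis
  proof (rule AE_mp, intro AE_I2 impI)
    fix \<omega> assume "\<omega> \<in> space M" "num {p \<in> A \<inter> \<Psi> i \<omega> \<times> \<Psi> j \<omega>. void (region 0 0) \<omega>} = 0"
    moreover have "void (region 0 0) \<omega>" using dist_at_nonneg by (auto simp: void_def region_def not_less[symmetric])
    ultimately have "{p \<in> A \<inter> \<Psi> i \<omega> \<times> \<Psi> j \<omega>. True} = {}"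
      by (simp only: emeasure_count_space_eq_0) blast
    then show "A \<inter> \<Psi> i \<omega> \<times> \<Psi> j \<omega> = {}" by blast
  qed
qed

text \<open>In each triple of separated cells the mean number of triples in A is zero; countably
  many such cells over all grids catch every triple of A.\<close>

lemma AE_no_triple:
  assumes ijk: "i \<in> {1..n}" "j \<in> {1..n}" "k \<in> {1..n}"
    and A[measurable]: "A \<in> sets ((borel \<Otimes>\<^sub>M borel) \<Otimes>\<^sub>M borel)"
    and off: "\<And>a b c. ((a, b), c) \<in> A \<Longrightarrow> (i = j \<longrightarrow> a \<noteq> b) \<and> (i = k \<longrightarrow> a \<noteq> c) \<and> (j = k \<longrightarrow> b \<noteq> c)"
    and null: "emeasure ((intensity (lam i) \<Otimes>\<^sub>M intensity (lam j)) \<Otimes>\<^sub>M intensity (lam k)) A = 0"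
  shows "AE \<omega> in M. A \<inter> (\<Psi> i \<omega> \<times> \<Psi> j \<omega>) \<times> \<Psi> k \<omega> = {}"
proof -
  let ?\<nu> = "(intensity (lam i) \<Otimes>\<^sub>M intensity (lam j)) \<Otimes>\<^sub>M intensity (lam k)"
  have sets\<nu>: "sets ?\<nu> = sets ((borel \<Otimes>\<^sub>M borel) \<Otimes>\<^sub>M borel)" by (simp cong: sets_pair_measure_cong)
  define S where "S m c = {s. cell m s = c}" for m c
  define ok where "ok ca cb cc \<longleftrightarrow> (i = j \<longrightarrow> ca \<noteq> cb) \<and> (i = k \<longrightarrow> ca \<noteq> cc) \<and> (j = k \<longrightarrow> cb \<noteq> cc)"
    for ca cb cc :: "int \<times> int \<times> int"
  have win: "l \<in> {1..n} \<Longrightarrow> window l (S m c)" for l m c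
    by (simp add: window_def S_def cell_bounded)
  have "AE \<omega> in M. ok ca cb cc \<longrightarrow> A \<inter> ((\<Psi> i \<omega> \<inter> S m ca) \<times> (\<Psi> j \<omega> \<inter> S m cb)) \<times> (\<Psi> k \<omega> \<inter> S m cc) = {}" for m ca cb cc
  proof (cases "ok ca cb cc")
    case True
    let ?F = "\<lambda>\<omega>. A \<inter> ((\<Psi> i \<omega> \<inter> S m ca) \<times> (\<Psi> j \<omega> \<inter> S m cb)) \<times> (\<Psi> k \<omega> \<inter> S m cc)"
    have *: "(\<lambda>\<omega>. num (?F \<omega>)) \<in> borel_measurable M \<and>
      (\<integral>\<^sup>+\<omega>. num (?F \<omega>) \<partial>M) = emeasure ?\<nu> (A \<inter> (S m ca \<times> S m cb) \<times> S m cc)"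
      using True by (intro triple_mean win ijk A) (auto simp: typed_disjoint_def ok_def S_def)
    have "emeasure ?\<nu> (A \<inter> (S m ca \<times> S m cb) \<times> S m cc) \<le> emeasure ?\<nu> A"
      using A by (intro emeasure_mono) (auto simp: sets\<nu>)
    with null * have "(\<integral>\<^sup>+\<omega>. num (?F \<omega>) \<partial>M) = 0" by simp
    then have "AE \<omega> in M. num (?F \<omega>) = 0" by (rule nn_integral_0_iff_AE[THEN iffD1, rotated]) (use * in blast)
    then show ?thesis by eventually_elim (simp add: emeasure_count_space_eq_0)
  qed simp
  then have "AE \<omega> in M. \<forall>m ca cb cc. ok ca cb cc \<longrightarrow> A \<inter> ((\<Psi> i \<omega> \<inter> S m ca) \<times> (\<Psi> j \<omega> \<inter> S m cb)) \<times> (\<Psi> k \<omega> \<inter> S m cc) = {}"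
    by (simp add: AE_all_countable)
  then show ?thesis
  proof eventually_elim
    case (elim \<omega>)
    show ?case
    proof (rule ccontr)
      assume "A \<inter> (\<Psi> i \<omega> \<times> \<Psi> j \<omega>) \<times> \<Psi> k \<omega> \<noteq> {}"
      then obtain a b c where abc: "((a, b), c) \<in> A" "a \<in> \<Psi> i \<omega>" "b \<in> \<Psi> j \<omega>" "c \<in> \<Psi> k \<omega>" by auto
      have "\<forall>\<^sub>F m in sequentially. (i = j \<longrightarrow> cell m a \<noteq> cell m b) \<and> (i = k \<longrightarrow> cell m a \<noteq> cell m c) \<and> (j = k \<longrightarrow> cell m b \<noteq> cell m c)"
        using off[OF abc(1)] eventually_cell_neq[of a b] eventually_cell_neq[of a c] eventually_cell_neq[of b c]
        by (intro eventually_conj) (auto simp: eventually_mono)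
      then obtain m where "ok (cell m a) (cell m b) (cell m c)"
        by (auto simp: ok_def dest!: eventually_happens)
      with elim have "A \<inter> ((\<Psi> i \<omega> \<inter> S m (cell m a)) \<times> (\<Psi> j \<omega> \<inter> S m (cell m b))) \<times> (\<Psi> k \<omega> \<inter> S m (cell m c)) = {}" by blast
      then show False using abc by (auto simp: S_def)
    qed
  qed
qed

end

section \<open>Distinct meeting times and head coordinates\<close>

lemma nn_integral_head_pair:
  fixes g :: "(real \<times> real) \<times> (real \<times> real) \<Rightarrow> ennreal"
  assumes g[measurable]: "g \<in> borel_measurable ((borel \<Otimes>\<^sub>M borel) \<Otimes>\<^sub>M (borel \<Otimes>\<^sub>M borel))"
    and "v > 0" "v' > 0" "l \<ge> 0" "l' \<ge> 0"
  shows "(\<integral>\<^sup>+ p. g ((head_time v (fst p), height (fst p)), (head_time v' (snd p), height (snd p)))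
      \<partial>(intensity l \<Otimes>\<^sub>M intensity l'))
    = ennreal (4 * l * l' * v * v') * (\<integral>\<^sup>+ T. \<integral>\<^sup>+ h. indicator {0..} h *
        (\<integral>\<^sup>+ T'. \<integral>\<^sup>+ h'. indicator {0..} h' * g ((T, h), (T', h')) \<partial>lborel \<partial>lborel) \<partial>lborel \<partial>lborel)"
proof -
  interpret J: sigma_finite_measure "intensity l'" by (rule sigma_finite_intensity)
  let ?G = "\<lambda>x. \<integral>\<^sup>+ T'. \<integral>\<^sup>+ h'. indicator {0..} h' * g (x, (T', h')) \<partial>lborel \<partial>lborel"
  have G[measurable]: "?G \<in> borel_measurable (borel \<Otimes>\<^sub>M borel)" by measurable
  have gx: "(\<lambda>y. g (x, y)) \<in> borel_measurable borel" for x
  proof -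
    have "(\<lambda>y. g (x, y)) \<in> borel_measurable (borel \<Otimes>\<^sub>M borel)"
      by (rule measurable_compose[OF measurable_Pair1' g]) (simp add: space_pair_measure)
    then show ?thesis by (simp only: borel_prod)
  qed
  have inner: "(\<integral>\<^sup>+ b. g (x, (head_time v' b, height b)) \<partial>intensity l') = ennreal (2 * l' * v') * ?G x" for x
    using assms by (intro nn_integral_head gx) auto
  have "(\<integral>\<^sup>+ p. g ((head_time v (fst p), height (fst p)), (head_time v' (snd p), height (snd p)))
      \<partial>(intensity l \<Otimes>\<^sub>M intensity l'))
    = (\<integral>\<^sup>+ a. (\<integral>\<^sup>+ b. g ((head_time v a, height a), (head_time v' b, height b)) \<partial>intensity l') \<partial>intensity l)"
    by (subst J.nn_integral_fst[symmetric]) auto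
  also have "\<dots> = (\<integral>\<^sup>+ a. (\<lambda>x. ennreal (2 * l' * v') * ?G x) (head_time v a, height a) \<partial>intensity l)"
    by (simp add: inner)
  also have "\<dots> = ennreal (2 * l * v) * (\<integral>\<^sup>+ T. \<integral>\<^sup>+ h. indicator {0..} h * (ennreal (2 * l' * v') * ?G (T, h)) \<partial>lborel \<partial>lborel)"
    using assms G by (intro nn_integral_head) (auto simp: borel_prod)
  also have "(\<integral>\<^sup>+ T. \<integral>\<^sup>+ h. indicator {0..} h * (ennreal (2 * l' * v') * ?G (T, h)) \<partial>lborel \<partial>lborel)
      = (\<integral>\<^sup>+ T. ennreal (2 * l' * v') * (\<integral>\<^sup>+ h. indicator {0..} h * ?G (T, h) \<partial>lborel) \<partial>lborel)"
    by (subst nn_integral_cmult[symmetric]) (auto simp: mult_ac)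
  also have "\<dots> = ennreal (2 * l' * v') * (\<integral>\<^sup>+ T. \<integral>\<^sup>+ h. indicator {0..} h * ?G (T, h) \<partial>lborel \<partial>lborel)"
    by (rule nn_integral_cmult) measurable
  also have "ennreal (2 * l * v) * (ennreal (2 * l' * v') * (\<integral>\<^sup>+ T. \<integral>\<^sup>+ h. indicator {0..} h * ?G (T, h) \<partial>lborel \<partial>lborel))
    = ennreal (4 * l * l' * v * v') * (\<integral>\<^sup>+ T. \<integral>\<^sup>+ h. indicator {0..} h * ?G (T, h) \<partial>lborel \<partial>lborel)"
  proof -
    have "ennreal (2 * l * v) * ennreal (2 * l' * v') = ennreal (4 * l * l' * v * v')"
      using assms by (subst ennreal_mult[symmetric]) (auto intro!: arg_cong[where f=ennreal])
    then show ?thesis by (simp only: mult.assoc[symmetric])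
  qed
  finally show ?thesis .
qed

text \<open>Once the difference d of the head times is fixed, the demand that the meeting fall into
  [0,1] confines T' to an interval of length one, so T' integrates out with factor 1. The rest is an
  exchange of the order of integration that brings the two times innermost.\<close>

lemma nn_integral_meeting_window:
  fixes sh E :: "real \<Rightarrow> real \<Rightarrow> real \<Rightarrow> real" and P :: "real \<Rightarrow> real \<Rightarrow> real \<Rightarrow> bool"
  assumes [measurable]: "(\<lambda>(d, h, h'). sh d h h') \<in> borel_measurable (borel \<Otimes>\<^sub>M borel \<Otimes>\<^sub>M borel)"
    "(\<lambda>(d, h, h'). E d h h') \<in> borel_measurable (borel \<Otimes>\<^sub>M borel \<Otimes>\<^sub>M borel)"
    "Measurable.pred (borel \<Otimes>\<^sub>M borel \<Otimes>\<^sub>M borel) (\<lambda>(d, h, h'). P d h h')"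
  shows "(\<integral>\<^sup>+ T. \<integral>\<^sup>+ h. indicator {0..} h * (\<integral>\<^sup>+ T'. \<integral>\<^sup>+ h'. indicator {0..} h' *
      (if T < T' \<and> P (T' - T) h h' \<and> T' + sh (T' - T) h h' \<in> {0..1} then ennreal (E (T' - T) h h') else 0)
      \<partial>lborel \<partial>lborel) \<partial>lborel \<partial>lborel)
    = (\<integral>\<^sup>+ h'. indicator {0..} h' * (\<integral>\<^sup>+ h. indicator {0..} h * (\<integral>\<^sup>+ d. (if 0 < d \<and> P d h h' then ennreal (E d h h') else 0)
      \<partial>lborel) \<partial>lborel) \<partial>lborel)"
proof -
  let ?g = "\<lambda>d h h'. if 0 < d \<and> P d h h' then ennreal (E d h h') else 0"
  have [measurable]: "(\<lambda>x. sh (f x) (g x) (k x)) \<in> borel_measurable N"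
      "(\<lambda>x. E (f x) (g x) (k x)) \<in> borel_measurable N" "Measurable.pred N (\<lambda>x. P (f x) (g x) (k x))"
    if [measurable]: "f \<in> borel_measurable N" "g \<in> borel_measurable N" "k \<in> borel_measurable N" for f g k and N :: "'n measure"
    using measurable_compose[OF _ assms(1), of "\<lambda>x. (f x, g x, k x)" N] measurable_compose[OF _ assms(2), of "\<lambda>x. (f x, g x, k x)" N]
      measurable_compose[OF _ assms(3), of "\<lambda>x. (f x, g x, k x)" N] by simp_all
  define F :: "real \<Rightarrow> real \<Rightarrow> real \<Rightarrow> real \<Rightarrow> ennreal" where
    "F T h T' h' = (if T < T' \<and> P (T' - T) h h' \<and> T' + sh (T' - T) h h' \<in> {0..1} then ennreal (E (T' - T) h h') else 0)" for T h T' h'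
  have F[measurable]: "(\<lambda>x. F (f x) (g x) (k x) (e x)) \<in> borel_measurable N"
    if [measurable]: "f \<in> borel_measurable N" "g \<in> borel_measurable N" "k \<in> borel_measurable N" "e \<in> borel_measurable N"
    for f g k e and N :: "'n measure"
    unfolding F_def atLeastAtMost_iff by measurable
  let ?i = "indicator {0..} :: real \<Rightarrow> ennreal"
  have window: "(\<integral>\<^sup>+ T'. \<integral>\<^sup>+ T. F T h T' h' \<partial>lborel \<partial>lborel) = (\<integral>\<^sup>+ d. ?g d h h' \<partial>lborel)" for h h'
  proof -
    have "(\<integral>\<^sup>+ T'. \<integral>\<^sup>+ T. F T h T' h' \<partial>lborel \<partial>lborel) = (\<integral>\<^sup>+ T'. \<integral>\<^sup>+ d. F (T' - d) h T' h' \<partial>lborel \<partial>lborel)"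
    \<comment> \<open>For fixed T' the earlier head time T is replaced by the difference d = T' -
      T.\<close>
    proof (rule nn_integral_cong)
      fix T' show "(\<integral>\<^sup>+ T. F T h T' h' \<partial>lborel) = (\<integral>\<^sup>+ d. F (T' - d) h T' h' \<partial>lborel)"
        by (subst nn_integral_real_affine[where c="-1" and t=T']) auto
    qed
    also have "\<dots> = (\<integral>\<^sup>+ d. \<integral>\<^sup>+ T'. F (T' - d) h T' h' \<partial>lborel \<partial>lborel)"
      by (rule lborel_pair.Fubini') measurable
    also have "\<dots> = (\<integral>\<^sup>+ d. ?g d h h' \<partial>lborel)"
    proof (rule nn_integral_cong)
      fix d
      have "(\<integral>\<^sup>+ T'. F (T' - d) h T' h' \<partial>lborel)
        = (\<integral>\<^sup>+ T'. ?g d h h' * indicator {- sh d h h' .. 1 - sh d h h'} T' \<partial>lborel)"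
        by (intro nn_integral_cong) (auto simp: F_def indicator_def)
      also have "\<dots> = ?g d h h'"
        by (subst nn_integral_cmult) auto
      finally show "(\<integral>\<^sup>+ T'. F (T' - d) h T' h' \<partial>lborel) = ?g d h h'" .
    qed
    finally show ?thesis .
  qed
  have "(\<integral>\<^sup>+ T. \<integral>\<^sup>+ h. ?i h * (\<integral>\<^sup>+ T'. \<integral>\<^sup>+ h'. ?i h' * F T h T' h' \<partial>lborel \<partial>lborel) \<partial>lborel \<partial>lborel)
    = (\<integral>\<^sup>+ h. \<integral>\<^sup>+ T. ?i h * (\<integral>\<^sup>+ T'. \<integral>\<^sup>+ h'. ?i h' * F T h T' h' \<partial>lborel \<partial>lborel) \<partial>lborel \<partial>lborel)"
    by (rule lborel_pair.Fubini'[symmetric]) measurable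
  also have "\<dots> = (\<integral>\<^sup>+ h. ?i h * (\<integral>\<^sup>+ T. \<integral>\<^sup>+ T'. \<integral>\<^sup>+ h'. ?i h' * F T h T' h' \<partial>lborel \<partial>lborel \<partial>lborel) \<partial>lborel)"
    by (intro nn_integral_cong nn_integral_cmult) measurable
  also have "\<dots> = (\<integral>\<^sup>+ h. ?i h * (\<integral>\<^sup>+ T'. \<integral>\<^sup>+ T. \<integral>\<^sup>+ h'. ?i h' * F T h T' h' \<partial>lborel \<partial>lborel \<partial>lborel) \<partial>lborel)"
    by (intro nn_integral_cong arg_cong2[where f="(*)"] refl lborel_pair.Fubini'[symmetric]) measurable
  also have "\<dots> = (\<integral>\<^sup>+ h. ?i h * (\<integral>\<^sup>+ T'. \<integral>\<^sup>+ h'. ?i h' * (\<integral>\<^sup>+ T. F T h T' h' \<partial>lborel) \<partial>lborel \<partial>lborel) \<partial>lborel)"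
  proof -
    have "(\<integral>\<^sup>+ T. \<integral>\<^sup>+ h'. ?i h' * F T h T' h' \<partial>lborel \<partial>lborel) = (\<integral>\<^sup>+ h'. ?i h' * (\<integral>\<^sup>+ T. F T h T' h' \<partial>lborel) \<partial>lborel)" for T' h
    proof -
      have "(\<integral>\<^sup>+ T. \<integral>\<^sup>+ h'. ?i h' * F T h T' h' \<partial>lborel \<partial>lborel) = (\<integral>\<^sup>+ h'. \<integral>\<^sup>+ T. ?i h' * F T h T' h' \<partial>lborel \<partial>lborel)"
        by (rule lborel_pair.Fubini'[symmetric]) measurable
      then show ?thesis by (simp add: nn_integral_cmult)
    qed
    then show ?thesis by simp
  qed
  also have "\<dots> = (\<integral>\<^sup>+ h. ?i h * (\<integral>\<^sup>+ h'. ?i h' * (\<integral>\<^sup>+ T'. \<integral>\<^sup>+ T. F T h T' h' \<partial>lborel \<partial>lborel) \<partial>lborel) \<partial>lborel)"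
  proof -
    have "(\<integral>\<^sup>+ T'. \<integral>\<^sup>+ h'. ?i h' * (\<integral>\<^sup>+ T. F T h T' h' \<partial>lborel) \<partial>lborel \<partial>lborel) = (\<integral>\<^sup>+ h'. ?i h' * (\<integral>\<^sup>+ T'. \<integral>\<^sup>+ T. F T h T' h' \<partial>lborel \<partial>lborel) \<partial>lborel)" for h
    proof -
      have "(\<integral>\<^sup>+ T'. \<integral>\<^sup>+ h'. ?i h' * (\<integral>\<^sup>+ T. F T h T' h' \<partial>lborel) \<partial>lborel \<partial>lborel) = (\<integral>\<^sup>+ h'. \<integral>\<^sup>+ T'. ?i h' * (\<integral>\<^sup>+ T. F T h T' h' \<partial>lborel) \<partial>lborel \<partial>lborel)"
        by (rule lborel_pair.Fubini'[symmetric]) measurable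
      then show ?thesis by (simp add: nn_integral_cmult)
    qed
    then show ?thesis by simp
  qed
  also have "\<dots> = (\<integral>\<^sup>+ h. \<integral>\<^sup>+ h'. ?i h * (?i h' * (\<integral>\<^sup>+ d. ?g d h h' \<partial>lborel)) \<partial>lborel \<partial>lborel)"
    unfolding window by (intro nn_integral_cong nn_integral_cmult[symmetric]) measurable
  also have "\<dots> = (\<integral>\<^sup>+ h'. \<integral>\<^sup>+ h. ?i h * (?i h' * (\<integral>\<^sup>+ d. ?g d h h' \<partial>lborel)) \<partial>lborel \<partial>lborel)"
    by (rule lborel_pair.Fubini'[symmetric]) measurable
  also have "\<dots> = (\<integral>\<^sup>+ h'. ?i h' * (\<integral>\<^sup>+ h. ?i h * (\<integral>\<^sup>+ d. ?g d h h' \<partial>lborel) \<partial>lborel) \<partial>lborel)"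
    by (subst nn_integral_cmult[symmetric]) (auto simp: mult_ac)
  finally show ?thesis unfolding F_def .
qed

section \<open>Uniqueness of the meeting pair and the general rate of meetings\<close>

context stations
begin

text \<open>If two pairs met at the same time while both are nearest, all their stations would be at
  one common distance; a station of the second pair not in the first would then form a triple tie.
  For equal types \<open>anti\<close> fixes an orientation, so that a pair is not confused with its
  swap.\<close>

lemma distinct_meeting_times:
  assumes ij: "i \<in> {1..n}" "j \<in> {1..n}"
    and A[measurable]: "A \<in> sets (borel \<Otimes>\<^sub>M borel)"
    and \<tau>[measurable]: "\<tau> \<in> borel_measurable (borel \<Otimes>\<^sub>M borel)"
    and meet: "\<And>p. p \<in> A \<Longrightarrow> dist_at (v i) (fst p) (\<tau> p) = dist_at (v j) (snd p) (\<tau> p)"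
    and off: "\<And>p. i = j \<Longrightarrow> p \<in> A \<Longrightarrow> fst p \<noteq> snd p"
    and anti: "\<And>a b. i = j \<Longrightarrow> (a, b) \<in> A \<Longrightarrow> (b, a) \<notin> A"
  shows "AE \<omega> in M. inj_on \<tau> {p \<in> A \<inter> \<Psi> i \<omega> \<times> \<Psi> j \<omega>. void (region (\<tau> p) (dist_at (v i) (fst p) (\<tau> p))) \<omega>}"
proof -
  \<comment> \<open>The third station is of type l, differs from both stations of the pair, and is
    at the pair's common distance when they meet.\<close>
  define T where "T l = {((a, b), c). (a, b) \<in> A \<and> dist_at (v l) c (\<tau> (a, b)) = dist_at (v i) a (\<tau> (a, b))
      \<and> (i = l \<longrightarrow> a \<noteq> c) \<and> (j = l \<longrightarrow> b \<noteq> c)}" for l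
  have none: "AE \<omega> in M. T l \<inter> (\<Psi> i \<omega> \<times> \<Psi> j \<omega>) \<times> \<Psi> l \<omega> = {}" if l: "l \<in> {1..n}" for l
  proof (rule AE_no_triple[OF ij l])
    interpret L: sigma_finite_measure "intensity (lam l)" by (rule sigma_finite_intensity)
    have "T l = {x \<in> space ((borel \<Otimes>\<^sub>M borel) \<Otimes>\<^sub>M borel). fst x \<in> A
        \<and> dist_at (v l) (snd x) (\<tau> (fst x)) = dist_at (v i) (fst (fst x)) (\<tau> (fst x))
        \<and> (i = l \<longrightarrow> fst (fst x) \<noteq> snd x) \<and> (j = l \<longrightarrow> snd (fst x) \<noteq> snd x)}"
      by (auto simp: T_def space_pair_measure)
    also have "\<dots> \<in> sets ((borel \<Otimes>\<^sub>M borel) \<Otimes>\<^sub>M borel)" by measurable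
    finally show T: "T l \<in> sets ((borel \<Otimes>\<^sub>M borel) \<Otimes>\<^sub>M borel)" .
    show "(i = j \<longrightarrow> a \<noteq> b) \<and> (i = l \<longrightarrow> a \<noteq> c) \<and> (j = l \<longrightarrow> b \<noteq> c)" if "((a, b), c) \<in> T l" for a b c
      using that off[of "(a, b)"] by (auto simp: T_def)
    have "emeasure ((intensity (lam i) \<Otimes>\<^sub>M intensity (lam j)) \<Otimes>\<^sub>M intensity (lam l)) (T l)
       = (\<integral>\<^sup>+ p. emeasure (intensity (lam l)) (Pair p -` T l) \<partial>(intensity (lam i) \<Otimes>\<^sub>M intensity (lam j)))"
      using T by (intro L.emeasure_pair_measure_alt) (simp cong: sets_pair_measure_cong)
    also have "(\<lambda>p. emeasure (intensity (lam l)) (Pair p -` T l)) = (\<lambda>p. 0)"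
    proof
      fix p
      \<comment> \<open>For a given pair the time and the distance are fixed, so the third station
        is confined to a null set.\<close>
      have "emeasure (intensity (lam l)) (Pair p -` T l)
          \<le> emeasure (intensity (lam l)) {s. dist_at (v l) s (\<tau> p) = dist_at (v i) (fst p) (\<tau> p)}"
        by (intro emeasure_mono) (auto simp: T_def)
      then show "emeasure (intensity (lam l)) (Pair p -` T l) = 0" by (simp add: emeasure_intensity_circle)
    qed
    finally show "emeasure ((intensity (lam i) \<Otimes>\<^sub>M intensity (lam j)) \<Otimes>\<^sub>M intensity (lam l)) (T l) = 0" by simp
  qed
  show ?thesis
    using none[OF ij(1)] none[OF ij(2)]
  proof (rule AE_mp[OF AE_conjI], intro AE_I2 impI inj_onI)
    fix \<omega> p q
    let ?S = "{p \<in> A \<inter> \<Psi> i \<omega> \<times> \<Psi> j \<omega>. void (region (\<tau> p) (dist_at (v i) (fst p) (\<tau> p))) \<omega>}"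
    assume om: "\<omega> \<in> space M" and none: "T i \<inter> (\<Psi> i \<omega> \<times> \<Psi> j \<omega>) \<times> \<Psi> i \<omega> = {} \<and> T j \<inter> (\<Psi> i \<omega> \<times> \<Psi> j \<omega>) \<times> \<Psi> j \<omega> = {}"
      and p: "p \<in> ?S" and q: "q \<in> ?S" and eq: "\<tau> p = \<tau> q"
    obtain a b a' b' where ab: "p = (a, b)" "q = (a', b')" by (cases p, cases q) simp
    let ?t = "\<tau> p"
    have mem: "(a, b) \<in> A" "(a', b') \<in> A" "a \<in> \<Psi> i \<omega>" "b \<in> \<Psi> j \<omega>" "a' \<in> \<Psi> i \<omega>" "b' \<in> \<Psi> j \<omega>"
      using p q ab by auto
    have "\<forall>l\<in>{1..n}. \<forall>s\<in>\<Psi> l \<omega>. dist_at (v i) a ?t \<le> dist_at (v l) s ?t"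
      and "\<forall>l\<in>{1..n}. \<forall>s\<in>\<Psi> l \<omega>. dist_at (v i) a' ?t \<le> dist_at (v l) s ?t"
      using p q eq unfolding void_region[OF om] ab by simp_all
    then have a: "dist_at (v i) a' ?t = dist_at (v i) a ?t"
      using ij mem by (intro antisym) blast+
    moreover have "dist_at (v i) a' ?t = dist_at (v j) b' ?t" using meet[OF mem(2)] eq ab by simp
    ultimately have b: "dist_at (v j) b' ?t = dist_at (v i) a ?t" by simp
    have a': "i = i \<and> a' = a \<or> j = i \<and> a' = b"
    proof (rule ccontr)
      assume "\<not> ?thesis"
      then have "((a, b), a') \<in> T i" using a mem ab by (auto simp: T_def)
      then show False using none mem by blast
    qed
    have b': "i = j \<and> b' = a \<or> b' = b"
    proof (rule ccontr)
      assume "\<not> ?thesis"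
      then have "((a, b), b') \<in> T j" using b mem ab by (auto simp: T_def)
      then show False using none mem by blast
    qed
    show "p = q"
    proof (cases "i = j")
      case True
      \<comment> \<open>The second pair now consists of the same two stations, and
        \<open>anti\<close> excludes the reverse order.\<close>
      then have "a' \<noteq> b'" using off[OF True mem(2)] by simp
      then show ?thesis using a' b' anti[OF True mem(1)] mem(2) ab by auto
    next
      case False
      then show ?thesis using a' b' ab by auto
    qed
  qed
qed

text \<open>This serves handovers of every kind: \<open>sh\<close> is the meeting time relative to
  the later head and \<open>P\<close> the condition under which that meeting exists. The strict
  order of the heads also supplies the orientation needed when i = j.\<close>

lemma meeting_rate:
  fixes sh :: "real \<Rightarrow> real \<Rightarrow> real \<Rightarrow> real" and P :: "real \<Rightarrow> real \<Rightarrow> real \<Rightarrow> bool"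
  assumes ij: "i \<in> {1..n}" "j \<in> {1..n}"
    and sh[measurable]: "(\<lambda>(d, h, h'). sh d h h') \<in> borel_measurable (borel \<Otimes>\<^sub>M borel \<Otimes>\<^sub>M borel)"
    and P[measurable]: "Measurable.pred (borel \<Otimes>\<^sub>M borel \<Otimes>\<^sub>M borel) (\<lambda>(d, h, h'). P d h h')"
    and meet: "\<And>d h h'. 0 < d \<Longrightarrow> 0 \<le> h \<Longrightarrow> 0 \<le> h' \<Longrightarrow> P d h h' \<Longrightarrow>
      (v i)\<^sup>2 * (d + sh d h h')\<^sup>2 + h\<^sup>2 = (v j)\<^sup>2 * (sh d h h')\<^sup>2 + h'\<^sup>2"
  shows "(\<integral>\<^sup>+\<omega>. num {t \<in> {0..1}. \<exists>a\<in>\<Psi> i \<omega>. \<exists>b\<in>\<Psi> j \<omega>. head_time (v i) a < head_time (v j) b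
        \<and> P (head_time (v j) b - head_time (v i) a) (height a) (height b)
        \<and> t = head_time (v j) b + sh (head_time (v j) b - head_time (v i) a) (height a) (height b)
        \<and> void (region t (dist_at (v i) a t)) \<omega>} \<partial>M)
    = ennreal (4 * lam i * lam j * v i * v j) * (\<integral>\<^sup>+ h'. indicator {0..} h' * (\<integral>\<^sup>+ h. indicator {0..} h *
        (\<integral>\<^sup>+ d. (if 0 < d \<and> P d h h' then ennreal (exp (- lam_total * pi * ((v j)\<^sup>2 * (sh d h h')\<^sup>2 + h'\<^sup>2))) else 0)
      \<partial>lborel) \<partial>lborel) \<partial>lborel)"
proof -
  have comp[measurable]: "(\<lambda>x. sh (f x) (g x) (k x)) \<in> borel_measurable N"
      "Measurable.pred N (\<lambda>x. P (f x) (g x) (k x))"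
    if [measurable]: "f \<in> borel_measurable N" "g \<in> borel_measurable N" "k \<in> borel_measurable N" for f g k and N :: "'n measure"
    using measurable_compose[OF _ sh, of "\<lambda>x. (f x, g x, k x)" N]
      measurable_compose[OF _ P, of "\<lambda>x. (f x, g x, k x)" N] by simp_all
  let ?d = "\<lambda>p. head_time (v j) (snd p) - head_time (v i) (fst p)"
  define \<tau> where "\<tau> p = head_time (v j) (snd p) + sh (?d p) (height (fst p)) (height (snd p))" for p
  define A where "A = {p. head_time (v i) (fst p) < head_time (v j) (snd p)
      \<and> P (?d p) (height (fst p)) (height (snd p)) \<and> \<tau> p \<in> {0..1}}"
  define \<rho> where "\<rho> p = dist_at (v i) (fst p) (\<tau> p)" for p
  define E where "E d h h' = exp (- lam_total * pi * ((v j)\<^sup>2 * (sh d h h')\<^sup>2 + h'\<^sup>2))" for d h h'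
  let ?f = "\<lambda>((T, h), (T', h')). if T < T' \<and> P (T' - T) h h' \<and> T' + sh (T' - T) h h' \<in> {0..1}
      then ennreal (E (T' - T) h h') else 0"
  have \<tau>[measurable]: "\<tau> \<in> borel_measurable (borel \<Otimes>\<^sub>M borel)" unfolding \<tau>_def by measurable
  have \<rho>[measurable]: "\<rho> \<in> borel_measurable (borel \<Otimes>\<^sub>M borel)" unfolding \<rho>_def by measurable
  have E[measurable]: "(\<lambda>(d, h, h'). E d h h') \<in> borel_measurable (borel \<Otimes>\<^sub>M borel \<Otimes>\<^sub>M borel)"
    unfolding E_def split_beta' by measurable
  have "A = {p \<in> space (borel \<Otimes>\<^sub>M borel). head_time (v i) (fst p) < head_time (v j) (snd p)
      \<and> P (?d p) (height (fst p)) (height (snd p)) \<and> \<tau> p \<in> {0..1}}" by (simp add: A_def space_pair_measure)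
  also have "\<dots> \<in> sets (borel \<Otimes>\<^sub>M borel)" by measurable
  finally have A[measurable]: "A \<in> sets (borel \<Otimes>\<^sub>M borel)" .
  have v: "v i > 0" "v j > 0" using v_pos ij by auto
  have dj: "dist_at (v j) (snd p) (\<tau> p) = sqrt ((v j)\<^sup>2 * (sh (?d p) (height (fst p)) (height (snd p)))\<^sup>2 + (height (snd p))\<^sup>2)" for p
    using v by (simp add: dist_at_head \<tau>_def)
  have m: "dist_at (v i) (fst p) (\<tau> p) = dist_at (v j) (snd p) (\<tau> p)" if "p \<in> A" for p
  proof -
    have "dist_at (v i) (fst p) (\<tau> p) = sqrt ((v i)\<^sup>2 * (?d p + sh (?d p) (height (fst p)) (height (snd p)))\<^sup>2 + (height (fst p))\<^sup>2)"
      using v by (simp add: dist_at_head \<tau>_def algebra_simps)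
    also have "\<dots> = dist_at (v j) (snd p) (\<tau> p)"
      unfolding dj using that by (subst meet) (auto simp: A_def)
    finally show ?thesis .
  qed
  define S where "S \<omega> = {p \<in> A \<inter> \<Psi> i \<omega> \<times> \<Psi> j \<omega>. void (region (\<tau> p) (\<rho> p)) \<omega>}" for \<omega>
  have pf: "(\<lambda>\<omega>. num (S \<omega>)) \<in> borel_measurable M \<and> (\<integral>\<^sup>+\<omega>. num (S \<omega>) \<partial>M)
     = (\<integral>\<^sup>+p. indicator A p * ennreal (exp (- lam_total * pi * (\<rho> p)\<^sup>2)) \<partial>(intensity (lam i) \<Otimes>\<^sub>M intensity (lam j)))"
    unfolding S_def
  proof (rule pair_formula[OF ij A _ \<tau> \<rho>])
    show "fst p \<noteq> snd p" if "p \<in> A" "i = j" for p using that by (auto simp: A_def)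
  qed (auto simp: \<rho>_def m dist_at_nonneg)
  have "AE \<omega> in M. inj_on \<tau> (S \<omega>)"
    unfolding S_def \<rho>_def
  proof (rule distinct_meeting_times[OF ij A \<tau> m])
    show "fst p \<noteq> snd p" if "i = j" "p \<in> A" for p using that by (auto simp: A_def)
    show "(b, a) \<notin> A" if "i = j" "(a, b) \<in> A" for a b using that by (auto simp: A_def)
  qed
  \<comment> \<open>Injectivity of the meeting time turns the count of pairs into a count of times,
    for finite and infinite sets alike.\<close>
  then have "AE \<omega> in M. num (\<tau> ` S \<omega>) = num (S \<omega>)"
    by eventually_elim (simp add: emeasure_count_space finite_image_iff card_image)
  then have "(\<integral>\<^sup>+\<omega>. num (\<tau> ` S \<omega>) \<partial>M) = (\<integral>\<^sup>+\<omega>. num (S \<omega>) \<partial>M)" by (rule nn_integral_cong_AE)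
  also have "\<dots> = (\<integral>\<^sup>+p. ?f
      ((head_time (v i) (fst p), height (fst p)), (head_time (v j) (snd p), height (snd p)))
      \<partial>(intensity (lam i) \<Otimes>\<^sub>M intensity (lam j)))"
    unfolding pf[THEN conjunct2]
  proof (rule nn_integral_cong)
    fix p
    have "(\<rho> p)\<^sup>2 = (v j)\<^sup>2 * (sh (?d p) (height (fst p)) (height (snd p)))\<^sup>2 + (height (snd p))\<^sup>2" if "p \<in> A"
      using m[OF that] unfolding dj by (simp add: \<rho>_def)
    then show "indicator A p * ennreal (exp (- lam_total * pi * (\<rho> p)\<^sup>2))
      = ?f
      ((head_time (v i) (fst p), height (fst p)), (head_time (v j) (snd p), height (snd p)))"
      by (auto simp: indicator_def A_def \<tau>_def E_def)
  qed
  also have "\<dots> = ennreal (4 * lam i * lam j * v i * v j) * (\<integral>\<^sup>+ T. \<integral>\<^sup>+ h. indicator {0..} h *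
        (\<integral>\<^sup>+ T'. \<integral>\<^sup>+ h'. indicator {0..} h' * (if T < T' \<and> P (T' - T) h h' \<and> T' + sh (T' - T) h h' \<in> {0..1} then ennreal (E (T' - T) h h') else 0) \<partial>lborel \<partial>lborel) \<partial>lborel \<partial>lborel)"
  proof (subst nn_integral_head_pair)
    have [measurable]: "(\<lambda>x. E (f x) (g x) (k x)) \<in> borel_measurable N"
      if [measurable]: "f \<in> borel_measurable N" "g \<in> borel_measurable N" "k \<in> borel_measurable N" for f g k and N :: "'n measure"
      using measurable_compose[OF _ E, of "\<lambda>x. (f x, g x, k x)" N] by simp
    show "?f
      \<in> borel_measurable ((borel \<Otimes>\<^sub>M borel) \<Otimes>\<^sub>M (borel \<Otimes>\<^sub>M borel))"
      unfolding split_beta' atLeastAtMost_iff by measurable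
  qed (use v lam_pos ij in \<open>auto simp: less_imp_le\<close>)
  also have "\<dots> = ennreal (4 * lam i * lam j * v i * v j) * (\<integral>\<^sup>+ h'. indicator {0..} h' * (\<integral>\<^sup>+ h. indicator {0..} h *
        (\<integral>\<^sup>+ d. (if 0 < d \<and> P d h h' then ennreal (E d h h') else 0) \<partial>lborel) \<partial>lborel) \<partial>lborel)"
    by (subst nn_integral_meeting_window[OF sh E P]) simp
  also have "(\<lambda>\<omega>. num (\<tau> ` S \<omega>)) = (\<lambda>\<omega>. num {t \<in> {0..1}. \<exists>a\<in>\<Psi> i \<omega>. \<exists>b\<in>\<Psi> j \<omega>. head_time (v i) a < head_time (v j) b
        \<and> P (head_time (v j) b - head_time (v i) a) (height a) (height b)
        \<and> t = head_time (v j) b + sh (head_time (v j) b - head_time (v i) a) (height a) (height b)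
        \<and> void (region t (dist_at (v i) a t)) \<omega>})"
    by (intro ext arg_cong[where f=num]) (auto simp: S_def A_def \<tau>_def \<rho>_def image_iff Bex_def; blast)
  finally show ?thesis unfolding E_def .
qed

text \<open>A handover between stations of one type comes as an unordered pair; this allows it to be
  ordered strictly by head times. Given one station, the head time of the other would have to hit a
  single value, which has intensity zero.\<close>

lemma AE_distinct_head_times:
  assumes i: "i \<in> {1..n}"
  shows "AE \<omega> in M. \<forall>a\<in>\<Psi> i \<omega>. \<forall>b\<in>\<Psi> i \<omega>. a \<noteq> b \<longrightarrow> head_time (v i) a \<noteq> head_time (v i) b"
proof -
  interpret I: sigma_finite_measure "intensity (lam i)" by (rule sigma_finite_intensity)
  define A where "A = {p :: station \<times> station. fst p \<noteq> snd p \<and> head_time (v i) (fst p) = head_time (v i) (snd p)}"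
  have "A = {p \<in> space (borel \<Otimes>\<^sub>M borel). fst p \<noteq> snd p \<and> head_time (v i) (fst p) = head_time (v i) (snd p)}"
    by (simp add: A_def space_pair_measure)
  also have "\<dots> \<in> sets (borel \<Otimes>\<^sub>M borel)" by measurable
  finally have A: "A \<in> sets (borel \<Otimes>\<^sub>M borel)" .
  have "emeasure (intensity (lam i) \<Otimes>\<^sub>M intensity (lam i)) A
       = (\<integral>\<^sup>+ a. emeasure (intensity (lam i)) (Pair a -` A) \<partial>intensity (lam i))"
    using A by (intro I.emeasure_pair_measure_alt) (simp cong: sets_pair_measure_cong)
  also have "(\<lambda>a. emeasure (intensity (lam i)) (Pair a -` A)) = (\<lambda>p. 0)"
  proof
    fix a
    have [measurable]: "{b. head_time (v i) b = head_time (v i) a} \<in> sets borel" by measurable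
    define f :: "real \<times> real \<Rightarrow> ennreal" where "f x = indicator {head_time (v i) a} (fst x)" for x
    have f: "f \<in> borel_measurable borel"
      unfolding f_def[abs_def] borel_prod[symmetric] by measurable
    have "emeasure (intensity (lam i)) (Pair a -` A) \<le> emeasure (intensity (lam i)) {b. head_time (v i) b = head_time (v i) a}"
      by (intro emeasure_mono) (auto simp: A_def)
    also have "\<dots> = (\<integral>\<^sup>+ b. f (head_time (v i) b, height b) \<partial>intensity (lam i))"
    proof -
      have "(\<lambda>b. f (head_time (v i) b, height b)) = indicator {b. head_time (v i) b = head_time (v i) a}"
        by (auto simp: f_def indicator_def fun_eq_iff)
      then show ?thesis by simp
    qed
    also have "\<dots> = ennreal (2 * lam i * v i) * (\<integral>\<^sup>+ T. \<integral>\<^sup>+ h. indicator {0..} h * f (T, h) \<partial>lborel \<partial>lborel)"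
      using v_pos[OF i] lam_pos[OF i] f by (intro nn_integral_head) auto
    also have "(\<integral>\<^sup>+ T. \<integral>\<^sup>+ h. indicator {0..} h * f (T, h) \<partial>lborel \<partial>lborel) = (\<integral>\<^sup>+ (T::real). 0 \<partial>lborel)"
      using AE_lborel_singleton[of "head_time (v i) a"]
      by (intro nn_integral_cong_AE) (auto simp: f_def elim!: eventually_mono)
    finally show "emeasure (intensity (lam i)) (Pair a -` A) = 0" by simp
  qed
  finally have "AE \<omega> in M. A \<inter> \<Psi> i \<omega> \<times> \<Psi> i \<omega> = {}"
    by (intro AE_no_pair[OF i i A]) (auto simp: A_def)
  then show ?thesis
  proof eventually_elim
    case (elim \<omega>)
    show ?case
    proof (intro ballI impI notI)
      fix a b assume "a \<in> \<Psi> i \<omega>" "b \<in> \<Psi> i \<omega>" "a \<noteq> b" "head_time (v i) a = head_time (v i) b"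
      then have "(a, b) \<in> A \<inter> \<Psi> i \<omega> \<times> \<Psi> i \<omega>" by (simp add: A_def)
      with elim show False by blast
    qed
  qed
qed

end

section \<open>Integrals and roots\<close>

text \<open>Cauchy--Schloemilch substitution: $u = a t - b / t$ maps the positive half-line onto the
  real line, and $a^2 t^2 + b^2 / t^2 = u^2 + 2 a b$; the odd part of the Jacobian integrates to zero.\<close>

lemma nn_integral_Cauchy_Schloemilch:
  fixes a b :: real
  assumes a: "a > 0" and b: "b > 0"
  shows "(\<integral>\<^sup>+ t. (if 0 < t then ennreal (exp (- (a\<^sup>2 * t\<^sup>2 + b\<^sup>2 / t\<^sup>2))) else 0) \<partial>lborel)
    = ennreal (sqrt pi / (2 * a) * exp (- 2 * a * b))"
proof -
  \<comment> \<open>The inverse of u = a t - b / t is the positive root t of a t^2 - u t - b = 0;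
    \<open>R\<close> is the square root of the discriminant and \<open>g\<close> that root.\<close>
  define R where "R u = sqrt (u\<^sup>2 + 4 * a * b)" for u
  define g where "g u = (u + R u) / (2 * a)" for u
  define g' where "g' u = (1 + u / R u) / (2 * a)" for u
  define f where "f t = exp (- (a\<^sup>2 * t\<^sup>2 + b\<^sup>2 / t\<^sup>2))" for t
  have ab: "a * b > 0" using a b by simp
  have R2: "(R u)\<^sup>2 = u\<^sup>2 + 4 * a * b" for u using ab by (simp add: R_def add_nonneg_nonneg)
  have Rgt: "\<bar>u\<bar> < R u" for u
  proof -
    have "sqrt (u\<^sup>2) < R u" unfolding R_def using ab by (intro real_sqrt_less_mono) auto
    then show ?thesis by simp
  qed
  have Rpos: "R u > 0" for u using Rgt[of u] by linarith
  have gpos: "g u > 0" for u using Rgt[of u] a by (simp add: g_def)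
  have fg: "f (g u) = exp (- 2 * a * b) * exp (- u\<^sup>2)" for u
  proof -
    \<comment> \<open>Since a g and b / g are half the sum and half the difference of R and u, their
      squares add up to (R^2 + u^2) / 2.\<close>
    have ag: "a * g u = (R u + u) / 2" using a by (simp add: g_def)
    have bg: "b / g u = (R u - u) / 2"
    proof -
      have "b = g u * ((R u - u) / 2)"
      proof -
        have "(u + R u) * (R u - u) = 4 * a * b" using R2[of u] by (simp add: algebra_simps power2_eq_square)
        then show ?thesis using a by (simp add: g_def field_simps)
      qed
      then show ?thesis using gpos[of u] by (simp add: field_simps)
    qed
    have "a\<^sup>2 * (g u)\<^sup>2 + b\<^sup>2 / (g u)\<^sup>2 = (a * g u)\<^sup>2 + (b / g u)\<^sup>2"
      by (simp add: power_mult_distrib power_divide)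
    also have "\<dots> = ((R u)\<^sup>2 + u\<^sup>2) / 2"
      unfolding ag bg by (simp add: power2_eq_square field_simps)
    also have "\<dots> = u\<^sup>2 + 2 * a * b" unfolding R2 by simp
    finally show ?thesis by (simp add: f_def exp_add[symmetric])
  qed
  have Rcont: "isCont R u" for u unfolding R_def by (intro continuous_intros)
  have Rderiv: "DERIV R u :> u / R u" for u
  proof -
    have "0 < u\<^sup>2 + 4 * a * b" using ab by (simp add: add_nonneg_pos)
    then show ?thesis unfolding R_def by (auto intro!: derivative_eq_intros simp: field_simps)
  qed
  have gd: "DERIV g u :> g' u" for u
    unfolding g_def g'_def using a Rpos[of u] by (auto intro!: derivative_eq_intros Rderiv simp: field_simps)
  have g'0: "0 \<le> g' u" for u
  proof -
    have "- 1 \<le> u / R u" using Rgt[of u] Rpos[of u] by (simp add: le_divide_eq)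
    then show ?thesis using a by (simp add: g'_def)
  qed
  have gauss: "has_bochner_integral lborel (\<lambda>x::real. exp (- x\<^sup>2)) (sqrt pi)"
    using has_bochner_integral_even_function[OF gaussian_moment_0] by simp
  \<comment> \<open>Oddness gives the value 0 only together with integrability, which follows from
    |u / R| <= 1 and the Gaussian bound.\<close>
  have odd: "has_bochner_integral lborel (\<lambda>u. exp (- u\<^sup>2) * (u / R u)) 0"
  proof -
    have int: "integrable lborel (\<lambda>u. indicator {0..} u *\<^sub>R (exp (- u\<^sup>2) * (u / R u)))"
    proof (rule Bochner_Integration.integrable_bound)
      show "integrable lborel (\<lambda>u::real. exp (- u\<^sup>2))" using gauss by (rule integrable.intros)
      have "continuous_on UNIV R" using Rcont by (simp add: continuous_at_imp_continuous_on)
      then have [measurable]: "R \<in> borel_measurable borel" by (rule borel_measurable_continuous_onI)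
      show "(\<lambda>u. indicator {0..} u *\<^sub>R (exp (- u\<^sup>2) * (u / R u))) \<in> borel_measurable lborel" by measurable
      show "AE u in lborel. norm (indicator {0..} u *\<^sub>R (exp (- u\<^sup>2) * (u / R u))) \<le> norm (exp (- u\<^sup>2))"
      proof (rule AE_I2)
        fix u :: real
        have "\<bar>u / R u\<bar> \<le> 1" using Rgt[of u] Rpos[of u] by (simp add: abs_divide divide_le_eq)
        then have "exp (- u\<^sup>2) * \<bar>u / R u\<bar> \<le> exp (- u\<^sup>2) * 1" by (intro mult_left_mono) auto
        then show "norm (indicator {0..} u *\<^sub>R (exp (- u\<^sup>2) * (u / R u))) \<le> norm (exp (- u\<^sup>2))"
          by (auto simp: indicator_def abs_mult)
      qed
    qed
    show ?thesis
      by (rule has_bochner_integral_odd_function[OF has_bochner_integral_integrable[OF int]]) (simp add: R_def)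
  qed
  have total: "has_bochner_integral lborel (\<lambda>u. f (g u) * g' u) (sqrt pi / (2 * a) * exp (- 2 * a * b))"
  proof -
    have "has_bochner_integral lborel (\<lambda>u. (exp (- 2 * a * b) / (2 * a)) * (exp (- u\<^sup>2) + exp (- u\<^sup>2) * (u / R u)))
        ((exp (- 2 * a * b) / (2 * a)) * (sqrt pi + 0))"
      by (intro has_bochner_integral_mult_right has_bochner_integral_add gauss odd)
    moreover have "(\<lambda>u. (exp (- 2 * a * b) / (2 * a)) * (exp (- u\<^sup>2) + exp (- u\<^sup>2) * (u / R u))) = (\<lambda>u. f (g u) * g' u)"
      by (rule ext) (simp add: fg g'_def distrib_left distrib_right add_divide_distrib mult_ac)
    ultimately show ?thesis by (simp add: mult_ac)
  qed
  have lim_bot: "(g \<longlongrightarrow> 0) at_bot"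
  proof (rule tendsto_sandwich[of "\<lambda>_. 0" _ _ "\<lambda>u. b / (- u)"])
    show "\<forall>\<^sub>F u in at_bot. 0 \<le> g u" using gpos by (intro always_eventually) (auto simp: less_imp_le)
    show "\<forall>\<^sub>F u in at_bot. g u \<le> b / - u"
      using eventually_gt_at_bot[of "0::real"]
    proof eventually_elim
      case (elim u)
      \<comment> \<open>Near minus infinity numerator cancellation hides the decay; multiplying by
        the conjugate R - u gives g (R - u) = 2 b, and R - u >= - 2 u.\<close>
      have "2 * a * g u = u + R u" using a by (simp add: g_def)
      then have "2 * a * (g u * (R u - u)) = (u + R u) * (R u - u)" by (metis mult.assoc)
      also have "\<dots> = 2 * a * (2 * b)" using R2[of u] by (simp add: algebra_simps power2_eq_square)
      finally have "g u * (R u - u) = 2 * b" using a by simp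
      moreover have "g u * (- 2 * u) \<le> g u * (R u - u)"
        using Rgt[of u] gpos[of u] by (intro mult_left_mono) auto
      ultimately show ?case using elim by (simp add: field_simps)
    qed
    show "((\<lambda>u. b / - u) \<longlongrightarrow> 0) at_bot"
      by (intro tendsto_divide_0[OF tendsto_const] filterlim_at_top_imp_at_infinity filterlim_uminus_at_top_at_bot)
  qed simp
  have lim_top: "filterlim g at_top at_top"
  proof (rule filterlim_at_top_mono)
    show "filterlim (\<lambda>u. 1 / a * u) at_top at_top"
      using a by (intro filterlim_tendsto_pos_mult_at_top[OF tendsto_const]) (auto simp: filterlim_ident)
    show "\<forall>\<^sub>F u in at_top. 1 / a * u \<le> g u"
    proof (intro always_eventually allI)
      fix u show "1 / a * u \<le> g u" using Rgt[of u] a by (simp add: g_def field_simps)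
    qed
  qed
  have sub: "set_integrable lborel (einterval 0 \<infinity>) f"
     "(LBINT x=0..\<infinity>. f x) = (LBINT x=-\<infinity>..\<infinity>. (f (g x) * g' x))"
  proof -
    note S = interval_integral_substitution_nonneg[of "-\<infinity>" "\<infinity>" g g' f 0 "\<infinity>"]
    have cf: "isCont f (g u)" for u
      unfolding f_def using gpos[of u] by (intro continuous_intros) auto
    have cg: "isCont g' u" for u
      unfolding g'_def using Rpos[of u] a by (intro continuous_intros Rcont) auto
    have A: "((ereal \<circ> g \<circ> real_of_ereal) \<longlongrightarrow> 0) (at_right (-\<infinity>))"
      using lim_bot by (simp add: ereal_tendsto_simps zero_ereal_def)
    have B: "((ereal \<circ> g \<circ> real_of_ereal) \<longlongrightarrow> \<infinity>) (at_left \<infinity>)"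
      using lim_top by (simp add: ereal_tendsto_simps)
    have I: "set_integrable lborel (einterval (-\<infinity>) \<infinity>) (\<lambda>x. f (g x) * g' x)"
      using total by (simp add: set_integrable_def einterval_def has_bochner_integral_iff)
    show "set_integrable lborel (einterval 0 \<infinity>) f" "(LBINT x=0..\<infinity>. f x) = (LBINT x=-\<infinity>..\<infinity>. (f (g x) * g' x))"
      using S gd cf cg g'0 A B I by (auto simp: f_def)
  qed
  have "(\<integral>\<^sup>+ t. (if 0 < t then ennreal (exp (- (a\<^sup>2 * t\<^sup>2 + b\<^sup>2 / t\<^sup>2))) else 0) \<partial>lborel)
      = (\<integral>\<^sup>+ t. ennreal (indicator (einterval 0 \<infinity>) t *\<^sub>R f t) \<partial>lborel)"
    by (intro nn_integral_cong) (auto simp: einterval_def indicator_def f_def zero_ereal_def)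
  also have "\<dots> = ennreal (\<integral> t. indicator (einterval 0 \<infinity>) t *\<^sub>R f t \<partial>lborel)"
    using sub(1) unfolding set_integrable_def by (intro nn_integral_eq_integral) (auto simp: f_def)
  also have "(\<integral> t. indicator (einterval 0 \<infinity>) t *\<^sub>R f t \<partial>lborel) = (LBINT x=0..\<infinity>. f x)"
    by (simp add: interval_lebesgue_integral_def set_lebesgue_integral_def)
  also have "\<dots> = (\<integral> u. f (g u) * g' u \<partial>lborel)"
    unfolding sub(2) by (simp add: interval_lebesgue_integral_def set_lebesgue_integral_def einterval_def)
  also have "\<dots> = sqrt pi / (2 * a) * exp (- 2 * a * b)" using total by (simp add: has_bochner_integral_iff)
  finally show ?thesis .
qed

text \<open>The quadrant is split according to which height is larger. Where the larger one equals
  m, the other ranges over an interval of length m, so each half contributes the integral of m exp(-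
  c m^2), that is 1 / (2 c).\<close>

lemma nn_integral_exp_max_square:
  fixes c :: real
  assumes "c > 0"
  shows "(\<integral>\<^sup>+ h'. indicator {0..} h' * (\<integral>\<^sup>+ h. indicator {0..} h * ennreal (exp (- c * (max h h')\<^sup>2)) \<partial>lborel) \<partial>lborel)
    = ennreal (1 / c)"
proof -
  let ?e = "\<lambda>m::real. ennreal (exp (- c * m\<^sup>2))"
  have half: "(\<integral>\<^sup>+ m. indicator {0..} m * (ennreal m * ?e m) \<partial>lborel) = ennreal (1 / (2 * c))"
  proof -
    have "(\<integral>\<^sup>+ m. ennreal (m * exp (- c * m\<^sup>2)) * indicator {0..} m \<partial>lborel) = ennreal (0 - (- exp (- c * 0\<^sup>2) / (2 * c)))"
    proof (rule nn_integral_FTC_atLeast[where F="\<lambda>m. - exp (- c * m\<^sup>2) / (2 * c)"])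
      show "((\<lambda>m. - exp (- c * m\<^sup>2) / (2 * c)) has_real_derivative m * exp (- c * m\<^sup>2)) (at m)" for m
        using assms by (auto intro!: derivative_eq_intros)
      have sq: "filterlim (\<lambda>m::real. c * m\<^sup>2) at_top at_top"
        using assms by (intro filterlim_tendsto_pos_mult_at_top[OF tendsto_const] filterlim_pow_at_top filterlim_ident) auto
      have "((\<lambda>m::real. exp (- (c * m\<^sup>2))) \<longlongrightarrow> 0) at_top"
        by (intro filterlim_compose[OF exp_at_bot] filterlim_compose[OF filterlim_uminus_at_bot_at_top] sq)
      then have "((\<lambda>m::real. - exp (- (c * m\<^sup>2)) / (2 * c)) \<longlongrightarrow> - 0 / (2 * c)) at_top"
        using assms by (intro tendsto_intros) auto
      then show "((\<lambda>m::real. - exp (- c * m\<^sup>2) / (2 * c)) \<longlongrightarrow> 0) at_top" by simp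
    qed auto
    moreover have "(\<integral>\<^sup>+ m. indicator {0..} m * (ennreal m * ?e m) \<partial>lborel) = (\<integral>\<^sup>+ m. ennreal (m * exp (- c * m\<^sup>2)) * indicator {0..} m \<partial>lborel)"
      by (intro nn_integral_cong) (auto simp: indicator_def ennreal_mult)
    ultimately show ?thesis by simp
  qed
  have slab: "(\<integral>\<^sup>+ h. indicator {0..} m * (?e m * indicator I h) \<partial>lborel) = indicator {0..} m * (ennreal m * ?e m)"
    if "I = {0..m} \<or> I = {0..<m}" for I and m :: real
  proof -
    have [measurable]: "I \<in> sets borel" using that by auto
    have "(\<integral>\<^sup>+ h. indicator {0..} m * (?e m * indicator I h) \<partial>lborel) = indicator {0..} m * (?e m * emeasure lborel I)"
      by (simp add: nn_integral_cmult)
    then show ?thesis using that by (cases "0 \<le> m") (auto simp: mult.commute)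
  qed
  \<comment> \<open>One range is closed and the other half-open, so the diagonal is counted exactly
    once and the split holds pointwise.\<close>
  have "(\<integral>\<^sup>+ h'. indicator {0..} h' * (\<integral>\<^sup>+ h. indicator {0..} h * ennreal (exp (- c * (max h h')\<^sup>2)) \<partial>lborel) \<partial>lborel)
    = (\<integral>\<^sup>+ h'. (\<integral>\<^sup>+ h. indicator {0..} h' * (?e h' * indicator {0..h'} h) + indicator {0..} h * (?e h * indicator {0..<h} h') \<partial>lborel) \<partial>lborel)"
    by (subst nn_integral_cmult[symmetric]) (auto intro!: nn_integral_cong simp: indicator_def max_def not_le)
  also have "\<dots> = (\<integral>\<^sup>+ h'. (\<integral>\<^sup>+ h. indicator {0..} h' * (?e h' * indicator {0..h'} h) \<partial>lborel) + (\<integral>\<^sup>+ h. indicator {0..} h * (?e h * indicator {0..<h} h') \<partial>lborel) \<partial>lborel)"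
    by (intro nn_integral_cong nn_integral_add) (simp_all add: indicator_def)
  also have "\<dots> = (\<integral>\<^sup>+ h'. (\<integral>\<^sup>+ h. indicator {0..} h' * (?e h' * indicator {0..h'} h) \<partial>lborel) \<partial>lborel) + (\<integral>\<^sup>+ h'. (\<integral>\<^sup>+ h. indicator {0..} h * (?e h * indicator {0..<h} h') \<partial>lborel) \<partial>lborel)"
    by (intro nn_integral_add) (simp_all add: indicator_def, measurable)
  also have "(\<integral>\<^sup>+ h'. (\<integral>\<^sup>+ h. indicator {0..} h' * (?e h' * indicator {0..h'} h) \<partial>lborel) \<partial>lborel) = (\<integral>\<^sup>+ m. indicator {0..} m * (ennreal m * ?e m) \<partial>lborel)"
    by (intro nn_integral_cong slab) simp
  also have "(\<integral>\<^sup>+ h'. (\<integral>\<^sup>+ h. indicator {0..} h * (?e h * indicator {0..<h} h') \<partial>lborel) \<partial>lborel)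
      = (\<integral>\<^sup>+ h. (\<integral>\<^sup>+ h'. indicator {0..} h * (?e h * indicator {0..<h} h') \<partial>lborel) \<partial>lborel)"
    by (rule lborel_pair.Fubini') (simp add: indicator_def, measurable)
  also have "\<dots> = (\<integral>\<^sup>+ m. indicator {0..} m * (ennreal m * ?e m) \<partial>lborel)"
    by (intro nn_integral_cong slab) simp
  finally show ?thesis
    unfolding half using assms by (simp add: ennreal_plus[symmetric] del: ennreal_plus)
qed

text \<open>Applied to the discriminant, this makes tangent birds negligible in the integral over
  the difference of head times.\<close>

lemma AE_square_neq: "AE d in lborel. q * d\<^sup>2 \<noteq> (r::real)" if "q \<noteq> 0" for q r :: real
proof -
  have "{d. q * d\<^sup>2 = r} \<subseteq> {sqrt (r / q), - sqrt (r / q)}"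
  proof
    fix d assume "d \<in> {d. q * d\<^sup>2 = r}"
    then have "d\<^sup>2 = r / q" using that by (simp add: field_simps)
    then have "\<bar>d\<bar> = sqrt (r / q)" by (metis real_sqrt_abs)
    then show "d \<in> {sqrt (r / q), - sqrt (r / q)}" by auto
  qed
  then have "finite {d. q * d\<^sup>2 = r}" by (rule finite_subset) simp
  then have "{d. q * d\<^sup>2 = r} \<in> null_sets lborel" by (intro countable_imp_null_set_lborel countable_finite)
  then show ?thesis by (auto dest: AE_not_in)
qed

text \<open>Counting the roots up to and including t gives the rank of t in time order. Division by
  W reverses the order of the two roots when W is negative, which the factor \<open>sgn W\<close>
  corrects. A double root has rank 1 only, hence the strict inequality for k = 2.\<close>

lemma kth_root_of_square:
  fixes W q D T t :: real
  assumes W: "W \<noteq> 0" and k: "k \<in> {1, 2::nat}"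
  shows "((W * (t - T) - q)\<^sup>2 = D \<and> card {s. s \<le> t \<and> (W * (s - T) - q)\<^sup>2 = D} = k)
    \<longleftrightarrow> (0 \<le> D \<and> (k = 2 \<longrightarrow> 0 < D) \<and> t = T + (q + sgn W * (-1) ^ k * sqrt D) / W)"
proof (cases "0 \<le> D")
  case False
  then have "(W * (t - T) - q)\<^sup>2 \<noteq> D" by (metis zero_le_power2)
  with False show ?thesis by simp
next
  case True
  define r where "r x = T + (q + x) / W" for x
  have iff: "(W * (s - T) - q)\<^sup>2 = D \<longleftrightarrow> s = r (- sgn W * sqrt D) \<or> s = r (sgn W * sqrt D)" for s
  proof -
    have "(W * (s - T) - q)\<^sup>2 = D \<longleftrightarrow> (W * (s - T) - q)\<^sup>2 = (sgn W * sqrt D)\<^sup>2"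
      using True W by (simp add: power_mult_distrib sgn_if)
    also have "\<dots> \<longleftrightarrow> W * (s - T) - q = sgn W * sqrt D \<or> W * (s - T) - q = - (sgn W * sqrt D)"
      by (rule power2_eq_iff)
    also have "\<dots> \<longleftrightarrow> s = r (- sgn W * sqrt D) \<or> s = r (sgn W * sqrt D)"
      using W unfolding r_def by (auto simp: field_simps)
    finally show ?thesis .
  qed
  \<comment> \<open>The sign of W combines with the division into a division by its absolute value,
    so the root with the plus sign is never the earlier one.\<close>
  have gap: "r (sgn W * sqrt D) = r (- sgn W * sqrt D) + 2 * sqrt D / \<bar>W\<bar>"
  proof -
    have "sgn W / W = 1 / \<bar>W\<bar>" using W by (simp add: sgn_if)
    then have "sgn W * sqrt D / W = sqrt D / \<bar>W\<bar>" by (metis mult.commute times_divide_eq_right mult.right_neutral)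
    then show ?thesis by (simp add: r_def add_divide_distrib diff_divide_distrib)
  qed
  let ?u = "r (- sgn W * sqrt D)" and ?w = "r (sgn W * sqrt D)"
  have S: "{s. s \<le> t \<and> (W * (s - T) - q)\<^sup>2 = D} = {s. s \<le> t \<and> (s = ?u \<or> s = ?w)}" by (simp only: iff)
  have uw: "?u \<le> ?w" "0 < D \<Longrightarrow> ?u < ?w" "D = 0 \<Longrightarrow> ?u = ?w" using True W gap by auto
  have rk: "T + (q + sgn W * (-1) ^ k * sqrt D) / W = (if k = 1 then ?u else ?w)"
    using k by (auto simp: r_def)
  show ?thesis unfolding S rk iff
  proof (cases "D = 0")
    case True
    then have "{s. s \<le> t \<and> (s = ?u \<or> s = ?w)} = (if ?u \<le> t then {?u} else {})" using uw by auto
    then show "((t = ?u \<or> t = ?w) \<and> card {s. s \<le> t \<and> (s = ?u \<or> s = ?w)} = k)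
      = (0 \<le> D \<and> (k = 2 \<longrightarrow> 0 < D) \<and> t = (if k = 1 then ?u else ?w))"
      using k uw True by auto
  next
    case False
    with \<open>0 \<le> D\<close> have D: "0 < D" by simp
    with uw have lt: "?u < ?w" by simp
    then have *: "{s. s \<le> ?u \<and> (s = ?u \<or> s = ?w)} = {?u}" "{s. s \<le> ?w \<and> (s = ?u \<or> s = ?w)} = {?u, ?w}" by auto
    then show "((t = ?u \<or> t = ?w) \<and> card {s. s \<le> t \<and> (s = ?u \<or> s = ?w)} = k)
      = (0 \<le> D \<and> (k = 2 \<longrightarrow> 0 < D) \<and> t = (if k = 1 then ?u else ?w))"
      using k lt D by (auto simp del: mult_minus_left)
  qed
qed

section \<open>Handover rates\<close>

text \<open>The station itself belongs to the set of distances, so the set is nonempty and the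
  infimum, if equal to its distance, is a minimum.\<close>

lemma is_nearest_iff:
  assumes "i \<in> {1..n}" "a \<in> \<Phi> i \<omega>"
  shows "is_nearest n v \<Phi> \<omega> i a t \<longleftrightarrow> (\<forall>l\<in>{1..n}. \<forall>s\<in>\<Phi> l \<omega>. dist_at (v i) a t \<le> dist_at (v l) s t)"
proof -
  let ?S = "{dist_at (v i) s t | i s. i \<in> {1..n} \<and> s \<in> \<Phi> i \<omega>}"
  have mem: "dist_at (v i) a t \<in> ?S" using assms by blast
  have bdd: "bdd_below ?S" by (rule bdd_belowI[of _ 0]) (auto simp: dist_at_nonneg)
  show ?thesis
  proof
    assume "is_nearest n v \<Phi> \<omega> i a t"
    then have eq: "dist_at (v i) a t = Inf ?S" by (simp add: is_nearest_def nearest_dist_def)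
    show "\<forall>l\<in>{1..n}. \<forall>s\<in>\<Phi> l \<omega>. dist_at (v i) a t \<le> dist_at (v l) s t"
      unfolding eq by (intro ballI cInf_lower[OF _ bdd]) blast
  next
    assume min: "\<forall>l\<in>{1..n}. \<forall>s\<in>\<Phi> l \<omega>. dist_at (v i) a t \<le> dist_at (v l) s t"
    have "Inf ?S = dist_at (v i) a t"
      by (rule cInf_eq_minimum[OF mem]) (use min in blast)
    then show "is_nearest n v \<Phi> \<omega> i a t" by (simp add: is_nearest_def nearest_dist_def)
  qed
qed

text \<open>The time, relative to the head of the second station, at which the birds of two stations with
  different speeds meet for the k-th time; the sign makes k the time order for either order of the
  speeds.\<close>

definition cross_shift :: "real \<Rightarrow> real \<Rightarrow> nat \<Rightarrow> real \<Rightarrow> real \<Rightarrow> real \<Rightarrow> real" where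
  "cross_shift vi vj k d h h' =
    (vi\<^sup>2 * d + sgn (vj\<^sup>2 - vi\<^sup>2) * (-1) ^ k * sqrt (Delta vi vj d h' h)) / (vj\<^sup>2 - vi\<^sup>2)"

text \<open>Multiplying the quadratic equation in s by its leading coefficient vj^2 - vi^2 completes
  the square; \<open>Delta\<close> is a quarter of the discriminant.\<close>

lemma birds_meet_iff:
  fixes vi vj d s h h' :: real
  assumes "vi\<^sup>2 \<noteq> vj\<^sup>2"
  shows "vi\<^sup>2 * (d + s)\<^sup>2 + h\<^sup>2 = vj\<^sup>2 * s\<^sup>2 + h'\<^sup>2 \<longleftrightarrow> ((vj\<^sup>2 - vi\<^sup>2) * s - vi\<^sup>2 * d)\<^sup>2 = Delta vi vj d h' h"
proof -
  have "((vj\<^sup>2 - vi\<^sup>2) * s - vi\<^sup>2 * d)\<^sup>2 - Delta vi vj d h' h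
      = (vj\<^sup>2 - vi\<^sup>2) * ((vj\<^sup>2 * s\<^sup>2 + h'\<^sup>2) - (vi\<^sup>2 * (d + s)\<^sup>2 + h\<^sup>2))"
    unfolding Delta_def by (simp add: power2_eq_square algebra_simps)
  then show ?thesis using assms by (metis eq_iff_diff_eq_0 mult_eq_0_iff)
qed

lemma cross_shift_meets:
  assumes "vi\<^sup>2 \<noteq> vj\<^sup>2" "0 \<le> Delta vi vj d h' h"
  shows "vi\<^sup>2 * (d + cross_shift vi vj k d h h')\<^sup>2 + h\<^sup>2 = vj\<^sup>2 * (cross_shift vi vj k d h h')\<^sup>2 + h'\<^sup>2"
proof -
  have "(vj\<^sup>2 - vi\<^sup>2) * cross_shift vi vj k d h h' - vi\<^sup>2 * d = sgn (vj\<^sup>2 - vi\<^sup>2) * (-1) ^ k * sqrt (Delta vi vj d h' h)"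
    using assms(1) by (simp add: cross_shift_def)
  moreover have "(sgn (vj\<^sup>2 - vi\<^sup>2) * (-1) ^ k * sqrt (Delta vi vj d h' h))\<^sup>2 = Delta vi vj d h' h"
    using assms by (simp add: power_mult_distrib sgn_if flip: power_mult)
  ultimately show ?thesis using birds_meet_iff[OF assms(1)] by simp
qed

lemma Delta_commute: "Delta vj vi d h h' = Delta vi vj d h' h"
  by (simp add: Delta_def algebra_simps)

text \<open>A meeting at s after the later head is at d + s after the earlier one. Under time
  reversal the earlier head becomes the later one, the sign changes, and the k-th of two meetings
  becomes the (3 - k)-th.\<close>

lemma cross_shift_commute:
  assumes "vi\<^sup>2 \<noteq> vj\<^sup>2" "k \<in> {1, 2::nat}"
  shows "cross_shift vj vi (3 - k) d h' h = - (d + cross_shift vi vj k d h h')"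
proof -
  define W where "W = vj\<^sup>2 - vi\<^sup>2"
  have W: "W \<noteq> 0" "vi\<^sup>2 - vj\<^sup>2 = - W" using assms(1) by (auto simp: W_def)
  define y where "y = sgn W * (-1) ^ k * sqrt (Delta vi vj d h' h)"
  have sign: "(-1::real) ^ (3 - k) = - ((-1) ^ k)" using assms(2) by auto
  have "cross_shift vj vi (3 - k) d h' h = (vj\<^sup>2 * d + y) / (- W)"
    unfolding cross_shift_def W(2) sign Delta_commute[of vj vi] y_def by (simp add: sgn_minus)
  also have "vj\<^sup>2 * d + y = W * d + (vi\<^sup>2 * d + y)" by (simp add: W_def algebra_simps)
  also have "(W * d + (vi\<^sup>2 * d + y)) / (- W) = - (d + (vi\<^sup>2 * d + y) / W)" using W(1) by (simp add: field_simps)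
  finally show ?thesis unfolding cross_shift_def y_def W_def .
qed

lemma cross_shift_measurable:
  "(\<lambda>(d, h, h'). cross_shift vi vj k d h h') \<in> borel_measurable (borel \<Otimes>\<^sub>M borel \<Otimes>\<^sub>M borel)"
  unfolding cross_shift_def Delta_def split_beta' by measurable

context stations
begin

lemma both_nearest_iff:
  assumes ij: "i \<in> {1..n}" "j \<in> {1..n}" and om: "\<omega> \<in> space M" and ab: "a \<in> \<Psi> i \<omega>" "b \<in> \<Psi> j \<omega>"
  shows "is_nearest n v \<Psi> \<omega> i a t \<and> is_nearest n v \<Psi> \<omega> j b t
    \<longleftrightarrow> dist_at (v i) a t = dist_at (v j) b t \<and> void (region t (dist_at (v i) a t)) \<omega>"
  unfolding is_nearest_iff[of i n a \<Psi> \<omega>, OF ij(1) ab(1)] is_nearest_iff[of j n b \<Psi> \<omega>, OF ij(2) ab(2)] void_region[OF om]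
  using ij ab by (metis order_antisym)

lemma speed_square_neq:
  assumes "i \<in> {1..n}" "j \<in> {1..n}" "v i \<noteq> v j"
  shows "(v i)\<^sup>2 \<noteq> (v j)\<^sup>2"
  using v_pos[OF assms(1)] v_pos[OF assms(2)] assms(3) by (simp add: power2_eq_iff)

text \<open>The rank expressed by \<open>card\<close> is replaced by the explicit k-th root, the
  form in which the general rate applies.\<close>

lemma handovers_cross_eq:
  assumes ij: "i \<in> {1..n}" "j \<in> {1..n}" and vij: "v i \<noteq> v j" and k: "k \<in> {1, 2::nat}" and om: "\<omega> \<in> space M"
  shows "handovers_cross n v \<Psi> k i j \<omega> = {t \<in> {0..1}. \<exists>a\<in>\<Psi> i \<omega>. \<exists>b\<in>\<Psi> j \<omega>. head_time (v i) a < head_time (v j) b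
        \<and> (0 \<le> Delta (v i) (v j) (head_time (v j) b - head_time (v i) a) (height b) (height a)
           \<and> (k = 2 \<longrightarrow> 0 < Delta (v i) (v j) (head_time (v j) b - head_time (v i) a) (height b) (height a)))
        \<and> t = head_time (v j) b + cross_shift (v i) (v j) k (head_time (v j) b - head_time (v i) a) (height a) (height b)
        \<and> void (region t (dist_at (v i) a t)) \<omega>}"
proof -
  note v2 = speed_square_neq[OF ij vij]
  have v: "v i \<noteq> 0" "v j \<noteq> 0" using v_pos ij by force+
  have "(is_nearest n v \<Psi> \<omega> i a t \<and> is_nearest n v \<Psi> \<omega> j b t \<and>
      card {s. s \<le> t \<and> dist_at (v i) a s = dist_at (v j) b s} = k)
    \<longleftrightarrow> (0 \<le> Delta (v i) (v j) (head_time (v j) b - head_time (v i) a) (height b) (height a)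
           \<and> (k = 2 \<longrightarrow> 0 < Delta (v i) (v j) (head_time (v j) b - head_time (v i) a) (height b) (height a)))
        \<and> t = head_time (v j) b + cross_shift (v i) (v j) k (head_time (v j) b - head_time (v i) a) (height a) (height b)
        \<and> void (region t (dist_at (v i) a t)) \<omega>"
    if ab: "a \<in> \<Psi> i \<omega>" "b \<in> \<Psi> j \<omega>" for a b t
  proof -
    let ?d = "head_time (v j) b - head_time (v i) a"
    let ?W = "(v j)\<^sup>2 - (v i)\<^sup>2"
    have meet: "dist_at (v i) a s = dist_at (v j) b s
        \<longleftrightarrow> (?W * (s - head_time (v j) b) - (v i)\<^sup>2 * ?d)\<^sup>2 = Delta (v i) (v j) ?d (height b) (height a)" for s
    proof -
      have "dist_at (v i) a s = dist_at (v j) b s \<longleftrightarrow>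
          (v i)\<^sup>2 * (?d + (s - head_time (v j) b))\<^sup>2 + (height a)\<^sup>2 = (v j)\<^sup>2 * (s - head_time (v j) b)\<^sup>2 + (height b)\<^sup>2"
        using v by (simp add: dist_at_head)
      then show ?thesis unfolding birds_meet_iff[OF v2] .
    qed
    have "?W \<noteq> 0" using v2 by simp
    from kth_root_of_square[OF this k] show ?thesis
      unfolding cross_shift_def meet conj_assoc[symmetric] both_nearest_iff[OF ij om ab] by blast
  qed
  then show ?thesis unfolding handovers_cross_def by blast
qed

lemma cross_rate:
  assumes ij: "i \<in> {1..n}" "j \<in> {1..n}" and vij: "v i \<noteq> v j" and k: "k \<in> {1, 2::nat}"
  shows "Lambda_cross M n v \<Psi> k i j = ennreal (4 * lam i * lam j * v i * v j) *
    (\<integral>\<^sup>+ h'. indicator {0..} h' * (\<integral>\<^sup>+ h. indicator {0..} h *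
      (\<integral>\<^sup>+ d. (if 0 < d \<and> 0 < Delta (v i) (v j) d h' h
          then ennreal (exp (- lam_total * pi * ((v j)\<^sup>2 * (cross_shift (v i) (v j) k d h h')\<^sup>2 + h'\<^sup>2))) else 0)
      \<partial>lborel) \<partial>lborel) \<partial>lborel)"
proof -
  note v2 = speed_square_neq[OF ij vij]
  let ?P = "\<lambda>d h h'. 0 \<le> Delta (v i) (v j) d h' h \<and> (k = 2 \<longrightarrow> 0 < Delta (v i) (v j) d h' h)"
  have P: "Measurable.pred (borel \<Otimes>\<^sub>M borel \<Otimes>\<^sub>M borel) (\<lambda>(d, h, h'). ?P d h h')"
    unfolding Delta_def split_beta' by measurable
  have ae: "(\<integral>\<^sup>+ d. (if 0 < d \<and> ?P d h h' then E d else 0) \<partial>lborel) = (\<integral>\<^sup>+ d. (if 0 < d \<and> 0 < Delta (v i) (v j) d h' h then E d else 0) \<partial>lborel)"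
    for h h' and E :: "real \<Rightarrow> ennreal"
  proof (rule nn_integral_cong_AE)
    have "AE d in lborel. (v j)\<^sup>2 * (v i)\<^sup>2 * d\<^sup>2 \<noteq> (h'\<^sup>2 - h\<^sup>2) * ((v j)\<^sup>2 - (v i)\<^sup>2)"
      using v_pos[OF ij(1)] v_pos[OF ij(2)] by (intro AE_square_neq) simp
    then show "AE d in lborel. (if 0 < d \<and> ?P d h h' then E d else 0) = (if 0 < d \<and> 0 < Delta (v i) (v j) d h' h then E d else 0)"
      by eventually_elim (auto simp: Delta_def)
  qed
  have "Lambda_cross M n v \<Psi> k i j = (\<integral>\<^sup>+\<omega>. num {t \<in> {0..1}. \<exists>a\<in>\<Psi> i \<omega>. \<exists>b\<in>\<Psi> j \<omega>. head_time (v i) a < head_time (v j) b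
        \<and> ?P (head_time (v j) b - head_time (v i) a) (height a) (height b)
        \<and> t = head_time (v j) b + cross_shift (v i) (v j) k (head_time (v j) b - head_time (v i) a) (height a) (height b)
        \<and> void (region t (dist_at (v i) a t)) \<omega>} \<partial>M)"
    unfolding Lambda_cross_def by (intro nn_integral_cong arg_cong[where f=num] handovers_cross_eq[OF ij vij k])
  also have "\<dots> = ennreal (4 * lam i * lam j * v i * v j) * (\<integral>\<^sup>+ h'. indicator {0..} h' * (\<integral>\<^sup>+ h. indicator {0..} h *
        (\<integral>\<^sup>+ d. (if 0 < d \<and> ?P d h h' then ennreal (exp (- lam_total * pi * ((v j)\<^sup>2 * (cross_shift (v i) (v j) k d h h')\<^sup>2 + h'\<^sup>2))) else 0)
      \<partial>lborel) \<partial>lborel) \<partial>lborel)"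
    by (rule meeting_rate[OF ij cross_shift_measurable P]) (rule cross_shift_meets[OF v2], blast)
  finally show ?thesis unfolding ae .
qed

text \<open>The exponent is the squared common distance at the meeting, which may be read off from
  either bird. Reading it off from the other bird gives the integrand with exchanged roles, up to
  the order of the two height integrals.\<close>

lemma cross_rate_commute:
  assumes ij: "i \<in> {1..n}" "j \<in> {1..n}" and vij: "v i \<noteq> v j" and k: "k \<in> {1, 2::nat}"
  shows "Lambda_cross M n v \<Psi> k i j = Lambda_cross M n v \<Psi> (3 - k) j i"
proof -
  let ?e = "\<lambda>d h h'. ennreal (exp (- lam_total * pi * ((v j)\<^sup>2 * (cross_shift (v i) (v j) k d h h')\<^sup>2 + h'\<^sup>2)))"
  let ?e' = "\<lambda>d h h'. ennreal (exp (- lam_total * pi * ((v i)\<^sup>2 * (cross_shift (v j) (v i) (3 - k) d h' h)\<^sup>2 + h\<^sup>2)))"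
  note v2 = speed_square_neq[OF ij vij]
  have k': "3 - k \<in> {1, 2}" using k by auto
  let ?i = "indicator {0..} :: real \<Rightarrow> ennreal"
  define F where "F h h' = (\<integral>\<^sup>+ d. (if 0 < d \<and> 0 < Delta (v i) (v j) d h' h
          then ?e d h h' else 0) \<partial>lborel)" for h h'
  have [measurable]: "(\<lambda>(h, h'). F h h') \<in> borel_measurable (borel \<Otimes>\<^sub>M borel)"
    unfolding F_def cross_shift_def Delta_def split_beta' by measurable
  have F_eq: "(\<integral>\<^sup>+ d. (if 0 < d \<and> 0 < Delta (v j) (v i) d h h'
          then ?e' d h h' else 0) \<partial>lborel) = F h h'" for h h'
    unfolding F_def
  proof (intro nn_integral_cong)
    fix d
    have "(v i)\<^sup>2 * (cross_shift (v j) (v i) (3 - k) d h' h)\<^sup>2 + h\<^sup>2 = (v j)\<^sup>2 * (cross_shift (v i) (v j) k d h h')\<^sup>2 + h'\<^sup>2"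
      if "0 < Delta (v i) (v j) d h' h"
      using cross_shift_meets[OF v2, of d h' h k] that
      unfolding cross_shift_commute[OF v2 k] power2_minus by simp
    then show "(if 0 < d \<and> 0 < Delta (v j) (v i) d h h'
          then ?e' d h h' else 0)
      = (if 0 < d \<and> 0 < Delta (v i) (v j) d h' h
          then ?e d h h' else 0)"
      unfolding Delta_commute[of "v j" "v i"] by auto
  qed
  have "(\<integral>\<^sup>+ h'. ?i h' * (\<integral>\<^sup>+ h. ?i h * F h h' \<partial>lborel) \<partial>lborel) = (\<integral>\<^sup>+ h'. \<integral>\<^sup>+ h. ?i h' * (?i h * F h h') \<partial>lborel \<partial>lborel)"
    by (intro nn_integral_cong nn_integral_cmult[symmetric]) measurable
  also have "\<dots> = (\<integral>\<^sup>+ h. \<integral>\<^sup>+ h'. ?i h' * (?i h * F h h') \<partial>lborel \<partial>lborel)"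
    by (rule lborel_pair.Fubini') measurable
  also have "\<dots> = (\<integral>\<^sup>+ h. ?i h * (\<integral>\<^sup>+ h'. ?i h' * F h h' \<partial>lborel) \<partial>lborel)"
    by (intro nn_integral_cong, subst nn_integral_cmult[symmetric]) (auto simp: mult.left_commute)
  finally have "(\<integral>\<^sup>+ h'. ?i h' * (\<integral>\<^sup>+ h. ?i h * F h h' \<partial>lborel) \<partial>lborel) = (\<integral>\<^sup>+ h. ?i h * (\<integral>\<^sup>+ h'. ?i h' * F h h' \<partial>lborel) \<partial>lborel)" .
  then show ?thesis
    unfolding cross_rate[OF ij vij k] cross_rate[OF ij(2,1) vij[symmetric] k'] F_eq F_def[symmetric]
    by (simp add: mult_ac)
qed

text \<open>Since type i is the slower one, vj^2 - vi^2 is positive and the sign factor in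
  \<open>cross_shift\<close> is 1. It remains to describe where \<open>Delta\<close> is positive,
  separately for the two orders of the heights.\<close>

lemma cross_rate_integral:
  assumes ij: "i \<in> {1..n}" "j \<in> {1..n}" and vij: "v i < v j" and k: "k \<in> {1, 2::nat}"
  shows "Lambda_cross M n v \<Psi> k i j =
      ennreal (4 * lam i * lam j * v i * v j) *
      (\<integral>\<^sup>+ hj. indicator {0..} hj *
         ((\<integral>\<^sup>+ hi. indicator {0..hj} hi *
             (\<integral>\<^sup>+ t. indicator {t_star (v i) (v j) hj hi..} t *
                ennreal (exp (- lam_total * pi * hhat_sq k (v i) (v j) t hj hi)) \<partial>lborel) \<partial>lborel)
        + (\<integral>\<^sup>+ hi. indicator {hj..} hi *
             (\<integral>\<^sup>+ t. indicator {0..} t *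
                ennreal (exp (- lam_total * pi * hhat_sq k (v i) (v j) t hj hi)) \<partial>lborel) \<partial>lborel))
       \<partial>lborel)"
proof -
  have v: "0 < v i" "0 < v j" using v_pos ij by auto
  have vneq: "v i \<noteq> v j" using vij by simp
  have W: "0 < (v j)\<^sup>2 - (v i)\<^sup>2" using v vij by (simp add: power_strict_mono)
  let ?E = "\<lambda>t hi hj. ennreal (exp (- lam_total * pi * hhat_sq k (v i) (v j) t hj hi))"
  have E: "(v j)\<^sup>2 * (cross_shift (v i) (v j) k t hi hj)\<^sup>2 + hj\<^sup>2 = hhat_sq k (v i) (v j) t hj hi" for t hi hj
    using W by (simp add: cross_shift_def hhat_sq_def)
  let ?F = "\<lambda>hi hj. \<integral>\<^sup>+ t. (if 0 < t \<and> 0 < Delta (v i) (v j) t hj hi then ?E t hi hj else 0) \<partial>lborel"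
  have below: "?F hi hj = (\<integral>\<^sup>+ t. indicator {t_star (v i) (v j) hj hi..} t * ?E t hi hj \<partial>lborel)"
    if "0 \<le> hi" "hi \<le> hj" for hi hj
  proof (rule nn_integral_cong_AE)
    let ?s = "t_star (v i) (v j) hj hi"
    have X: "0 \<le> hj\<^sup>2 - hi\<^sup>2" using that by (simp add: power_mono)
    have s0: "0 \<le> ?s" using v vij X unfolding t_star_def by (intro mult_nonneg_nonneg) auto
    \<comment> \<open>\<open>t_star\<close> is the nonnegative zero of \<open>Delta\<close> as a
      function of t.\<close>
    have s2: "(v j)\<^sup>2 * (v i)\<^sup>2 * ?s\<^sup>2 = (hj\<^sup>2 - hi\<^sup>2) * ((v j)\<^sup>2 - (v i)\<^sup>2)"
    proof -
      have "?s\<^sup>2 = (hj\<^sup>2 - hi\<^sup>2) * ((v j)\<^sup>2 - (v i)\<^sup>2) / ((v j)\<^sup>2 * (v i)\<^sup>2)"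
        using X W by (simp add: t_star_def power_mult_distrib power_divide)
      then show ?thesis using v by simp
    qed
    have pos: "0 < (v j)\<^sup>2 * (v i)\<^sup>2" using v by simp
    have "Delta (v i) (v j) t hj hi = (v j)\<^sup>2 * (v i)\<^sup>2 * (t\<^sup>2 - ?s\<^sup>2)" for t
      unfolding Delta_def s2[symmetric] by (simp add: algebra_simps)
    then have D: "0 < Delta (v i) (v j) t hj hi \<longleftrightarrow> ?s\<^sup>2 < t\<^sup>2" for t
      by (metis diff_gt_0_iff_gt mult_pos_pos pos zero_less_mult_pos)
    show "AE t in lborel. (if 0 < t \<and> 0 < Delta (v i) (v j) t hj hi then ?E t hi hj else 0) = indicator {?s..} t * ?E t hi hj"
      using AE_lborel_singleton[of ?s]
    proof eventually_elim
      case (elim t)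
      have "0 < t \<and> ?s\<^sup>2 < t\<^sup>2 \<longleftrightarrow> ?s \<le> t"
      proof
        assume "0 < t \<and> ?s\<^sup>2 < t\<^sup>2"
        then show "?s \<le> t" using power2_less_imp_less[of ?s t] by simp
      next
        assume "?s \<le> t"
        then have "?s < t" using elim by simp
        then show "0 < t \<and> ?s\<^sup>2 < t\<^sup>2" using s0 power_strict_mono[of ?s t 2] by simp
      qed
      then show ?case unfolding D by (auto simp: indicator_def)
    qed
  qed
  have above: "?F hi hj = (\<integral>\<^sup>+ t. indicator {0..} t * ?E t hi hj \<partial>lborel)"
    if "0 \<le> hj" "hj \<le> hi" for hi hj
  proof (rule nn_integral_cong_AE)
    \<comment> \<open>With the faster bird's head not above the slower one's, the constant part of
      \<open>Delta\<close> is nonnegative, so two crossings exist for every t > 0.\<close>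
    have X: "(hj\<^sup>2 - hi\<^sup>2) * ((v j)\<^sup>2 - (v i)\<^sup>2) \<le> 0" using that W by (simp add: mult_le_0_iff power_mono)
    have D: "0 < Delta (v i) (v j) t hj hi" if "0 < t" for t
    proof -
      have "0 < (v j)\<^sup>2 * (v i)\<^sup>2 * t\<^sup>2" using v that by simp
      then show ?thesis unfolding Delta_def using X by linarith
    qed
    show "AE t in lborel. (if 0 < t \<and> 0 < Delta (v i) (v j) t hj hi then ?E t hi hj else 0) = indicator {0..} t * ?E t hi hj"
      using AE_lborel_singleton[of "0::real"] by eventually_elim (auto simp: indicator_def D)
  qed
  have [measurable]: "(\<lambda>hi. ?F hi hj) \<in> borel_measurable borel" for hj
    unfolding hhat_sq_def Delta_def by measurable
  have split: "(\<integral>\<^sup>+ hi. indicator {0..} hi * ?F hi hj \<partial>lborel)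
     = (\<integral>\<^sup>+ hi. indicator {0..hj} hi * (\<integral>\<^sup>+ t. indicator {t_star (v i) (v j) hj hi..} t * ?E t hi hj \<partial>lborel) \<partial>lborel)
       + (\<integral>\<^sup>+ hi. indicator {hj..} hi * (\<integral>\<^sup>+ t. indicator {0..} t * ?E t hi hj \<partial>lborel) \<partial>lborel)"
    if hj: "0 \<le> hj" for hj
  proof -
    \<comment> \<open>The value hi = hj belongs to both closed ranges and is negligible.\<close>
    have "(\<integral>\<^sup>+ hi. indicator {0..} hi * ?F hi hj \<partial>lborel)
      = (\<integral>\<^sup>+ hi. indicator {0..hj} hi * ?F hi hj + indicator {hj..} hi * ?F hi hj \<partial>lborel)"
      using AE_lborel_singleton[of hj] hj
      by (intro nn_integral_cong_AE) (auto simp: indicator_def elim!: eventually_mono)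
    also have "\<dots> = (\<integral>\<^sup>+ hi. indicator {0..hj} hi * ?F hi hj \<partial>lborel) + (\<integral>\<^sup>+ hi. indicator {hj..} hi * ?F hi hj \<partial>lborel)"
      by (intro nn_integral_add) measurable
    also have "(\<integral>\<^sup>+ hi. indicator {0..hj} hi * ?F hi hj \<partial>lborel)
      = (\<integral>\<^sup>+ hi. indicator {0..hj} hi * (\<integral>\<^sup>+ t. indicator {t_star (v i) (v j) hj hi..} t * ?E t hi hj \<partial>lborel) \<partial>lborel)"
      by (intro nn_integral_cong) (simp add: indicator_def below)
    also have "(\<integral>\<^sup>+ hi. indicator {hj..} hi * ?F hi hj \<partial>lborel)
      = (\<integral>\<^sup>+ hi. indicator {hj..} hi * (\<integral>\<^sup>+ t. indicator {0..} t * ?E t hi hj \<partial>lborel) \<partial>lborel)"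
      using hj by (intro nn_integral_cong) (simp add: indicator_def above)
    finally show ?thesis .
  qed
  have "indicator {0..} hj * (\<integral>\<^sup>+ hi. indicator {0..} hi * ?F hi hj \<partial>lborel)
     = indicator {0..} hj * ((\<integral>\<^sup>+ hi. indicator {0..hj} hi * (\<integral>\<^sup>+ t. indicator {t_star (v i) (v j) hj hi..} t * ?E t hi hj \<partial>lborel) \<partial>lborel)
       + (\<integral>\<^sup>+ hi. indicator {hj..} hi * (\<integral>\<^sup>+ t. indicator {0..} t * ?E t hi hj \<partial>lborel) \<partial>lborel))" for hj :: real
  proof (cases "0 \<le> hj")
    case True
    show ?thesis unfolding split[OF True] ..
  next
    case False
    then have "indicator {0..} hj = (0::ennreal)" by simp
    then show ?thesis by (simp only: mult_zero_left)
  qed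
  then show ?thesis unfolding cross_rate[OF ij vneq k] E by (simp only:)
qed

lemma lam_total_pos: "i \<in> {1..n} \<Longrightarrow> 0 < lam_total"
  unfolding lam_total_def using lam_pos by (intro sum_pos) auto

text \<open>For equal speeds the quadratic terms cancel and the meeting equation is linear, so two
  birds with different head times cross exactly once. Ordering the pair by head times counts each
  crossing once.\<close>

lemma same_rate:
  assumes i: "i \<in> {1..n}"
  shows "Lambda_same M n v \<Psi> i = ennreal (4 * v i * sqrt lam_total / pi * (lam i / lam_total)\<^sup>2)"
proof -
  have v: "0 < v i" and l: "0 < lam i" and L: "0 < lam_total" using v_pos lam_pos lam_total_pos i by auto
  define sh where "sh d h h' = (h'\<^sup>2 - h\<^sup>2 - (v i)\<^sup>2 * d\<^sup>2) / (2 * (v i)\<^sup>2 * d)" for d h h' :: real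
  define c where "c = lam_total * pi"
  have c: "0 < c" using L by (simp add: c_def)
  have shm: "(\<lambda>(d, h, h'). sh d h h') \<in> borel_measurable (borel \<Otimes>\<^sub>M borel \<Otimes>\<^sub>M borel)"
    unfolding sh_def split_beta' by measurable
  have meet_iff: "(v i)\<^sup>2 * (d + s)\<^sup>2 + h\<^sup>2 = (v i)\<^sup>2 * s\<^sup>2 + h'\<^sup>2 \<longleftrightarrow> s = sh d h h'" if "d \<noteq> 0" for d s h h' :: real
  proof -
    have "(v i)\<^sup>2 * (d + s)\<^sup>2 + h\<^sup>2 = (v i)\<^sup>2 * s\<^sup>2 + h'\<^sup>2 \<longleftrightarrow> s * (2 * (v i)\<^sup>2 * d) = h'\<^sup>2 - h\<^sup>2 - (v i)\<^sup>2 * d\<^sup>2"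
      by (auto simp: power2_eq_square algebra_simps)
    also have "\<dots> \<longleftrightarrow> s = sh d h h'" unfolding sh_def using that v by (subst eq_divide_eq) auto
    finally show ?thesis .
  qed
  let ?H = "\<lambda>\<omega>. {t \<in> {0..1}. \<exists>a\<in>\<Psi> i \<omega>. \<exists>b\<in>\<Psi> i \<omega>. head_time (v i) a < head_time (v i) b \<and> True
        \<and> t = head_time (v i) b + sh (head_time (v i) b - head_time (v i) a) (height a) (height b)
        \<and> void (region t (dist_at (v i) a t)) \<omega>}"
  have H: "AE \<omega> in M. handovers_same n v \<Psi> i \<omega> = ?H \<omega>"
    using AE_distinct_head_times[OF i]
  proof (rule AE_mp, intro AE_I2 impI)
    fix \<omega> assume om: "\<omega> \<in> space M"
      and ht: "\<forall>a\<in>\<Psi> i \<omega>. \<forall>b\<in>\<Psi> i \<omega>. a \<noteq> b \<longrightarrow> head_time (v i) a \<noteq> head_time (v i) b"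
    have near: "is_nearest n v \<Psi> \<omega> i a t \<and> is_nearest n v \<Psi> \<omega> i b t
      \<longleftrightarrow> t = head_time (v i) b + sh (head_time (v i) b - head_time (v i) a) (height a) (height b)
        \<and> void (region t (dist_at (v i) a t)) \<omega>"
      if ab: "a \<in> \<Psi> i \<omega>" "b \<in> \<Psi> i \<omega>" "head_time (v i) a < head_time (v i) b" for a b t
    proof -
      let ?d = "head_time (v i) b - head_time (v i) a"
      have "dist_at (v i) a t = dist_at (v i) b t \<longleftrightarrow>
        (v i)\<^sup>2 * (?d + (t - head_time (v i) b))\<^sup>2 + (height a)\<^sup>2 = (v i)\<^sup>2 * (t - head_time (v i) b)\<^sup>2 + (height b)\<^sup>2"
        using v by (simp add: dist_at_head)
      also have "\<dots> \<longleftrightarrow> t - head_time (v i) b = sh ?d (height a) (height b)"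
        using ab(3) by (intro meet_iff) simp
      finally show ?thesis
        unfolding both_nearest_iff[OF i i om ab(1,2)] by (auto simp: algebra_simps)
    qed
    show "handovers_same n v \<Psi> i \<omega> = ?H \<omega>"
    proof (intro equalityI subsetI)
      fix t assume "t \<in> handovers_same n v \<Psi> i \<omega>"
      then obtain a b where t: "t \<in> {0..1}" and ab: "a \<in> \<Psi> i \<omega>" "b \<in> \<Psi> i \<omega>" "a \<noteq> b"
        and nn: "is_nearest n v \<Psi> \<omega> i a t" "is_nearest n v \<Psi> \<omega> i b t"
        unfolding handovers_same_def by blast
      have "head_time (v i) a < head_time (v i) b \<or> head_time (v i) b < head_time (v i) a"
        using ht ab by (metis neq_iff)
      then show "t \<in> ?H \<omega>"
        using near[OF ab(1,2), of t] near[OF ab(2,1), of t] nn t ab by blast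
    next
      fix t assume "t \<in> ?H \<omega>"
      then obtain a b where t: "t \<in> {0..1}" and ab: "a \<in> \<Psi> i \<omega>" "b \<in> \<Psi> i \<omega>" "head_time (v i) a < head_time (v i) b"
        and "t = head_time (v i) b + sh (head_time (v i) b - head_time (v i) a) (height a) (height b)"
          "void (region t (dist_at (v i) a t)) \<omega>" by blast
      with near[OF ab, of t] have "is_nearest n v \<Psi> \<omega> i a t \<and> is_nearest n v \<Psi> \<omega> i b t" by blast
      moreover have "a \<noteq> b" using ab(3) by blast
      ultimately show "t \<in> handovers_same n v \<Psi> i \<omega>" unfolding handovers_same_def using t ab by blast
    qed
  qed
  let ?G = "\<lambda>h h'. \<integral>\<^sup>+ d. (if 0 < d \<and> True
      then ennreal (exp (- lam_total * pi * ((v i)\<^sup>2 * (sh d h h')\<^sup>2 + h'\<^sup>2))) else 0) \<partial>lborel"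
  let ?C = "ennreal (sqrt pi / (sqrt c * v i))" and ?E = "\<lambda>h h'. ennreal (exp (- c * (max h h')\<^sup>2))"
  have gap: "?G h h'
      = ?C * ?E h h'"
    if h: "0 \<le> h" "0 \<le> h'" "h \<noteq> h'" for h h' :: real
  proof -
    \<comment> \<open>With c = L pi, the constants are read off from the squared meeting distance:
      a^2 d^2 and b^2 / d^2 are c times its terms in d^2 and 1 / d^2.\<close>
    define a where "a = sqrt c * v i / 2"
    define b where "b = sqrt c * \<bar>h'\<^sup>2 - h\<^sup>2\<bar> / (2 * v i)"
    have a: "a > 0" using c v by (simp add: a_def)
    \<comment> \<open>The case of equal heights would make b vanish and is left out; it is a null
      set in the later integration.\<close>
    have "h'\<^sup>2 \<noteq> h\<^sup>2" using h by (simp add: power2_eq_iff_nonneg)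
    then have b: "b > 0" using c v by (simp add: b_def)
    have exponent: "- lam_total * pi * ((v i)\<^sup>2 * (sh d h h')\<^sup>2 + h'\<^sup>2) = - (a\<^sup>2 * d\<^sup>2 + b\<^sup>2 / d\<^sup>2) + - c * ((h\<^sup>2 + h'\<^sup>2) / 2)" if "0 < d" for d
    proof -
      define X where "X = h'\<^sup>2 - h\<^sup>2"
      define y where "y = (v i)\<^sup>2 * d\<^sup>2"
      have y: "y > 0" using v that by (simp add: y_def)
      have a2: "a\<^sup>2 * d\<^sup>2 = c * y / 4" using c by (simp add: a_def y_def power_mult_distrib power_divide)
      have b2: "b\<^sup>2 / d\<^sup>2 = c * X\<^sup>2 / (4 * y)" using c by (simp add: b_def X_def y_def power_mult_distrib power_divide)
      have s2: "(v i)\<^sup>2 * (sh d h h')\<^sup>2 = (X - y)\<^sup>2 / (4 * y)"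
      proof -
        have "(sh d h h')\<^sup>2 = (X - y)\<^sup>2 / (4 * (v i)\<^sup>2 * y)"
          by (simp add: sh_def X_def y_def power_mult_distrib power_divide power2_eq_square mult_ac)
        then show ?thesis using v by simp
      qed
      have "(X - y)\<^sup>2 / (4 * y) + h'\<^sup>2 = y / 4 + X\<^sup>2 / (4 * y) + (h\<^sup>2 + h'\<^sup>2) / 2"
      proof -
        have "(X - y)\<^sup>2 / (4 * y) = X\<^sup>2 / (4 * y) - X / 2 + y / 4"
          using y by (simp add: power2_eq_square field_simps)
        then show ?thesis by (simp add: X_def field_simps)
      qed
      then show ?thesis unfolding a2 b2 s2 c_def[symmetric] 
        by (simp add: c_def algebra_simps)
    qed
    have "?G h h'
      = (\<integral>\<^sup>+ d. ennreal (exp (- c * ((h\<^sup>2 + h'\<^sup>2) / 2))) * (if 0 < d then ennreal (exp (- (a\<^sup>2 * d\<^sup>2 + b\<^sup>2 / d\<^sup>2))) else 0) \<partial>lborel)"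
    proof (rule nn_integral_cong)
      fix d :: real
      have "ennreal (exp (x + y)) = ennreal (exp y) * ennreal (exp x)" for x y :: real
        by (subst ennreal_mult[symmetric]) (auto simp: exp_add mult.commute)
      then show "(if 0 < d \<and> True then ennreal (exp (- lam_total * pi * ((v i)\<^sup>2 * (sh d h h')\<^sup>2 + h'\<^sup>2))) else 0)
        = ennreal (exp (- c * ((h\<^sup>2 + h'\<^sup>2) / 2))) * (if 0 < d then ennreal (exp (- (a\<^sup>2 * d\<^sup>2 + b\<^sup>2 / d\<^sup>2))) else 0)"
        using exponent[of d] by (cases "0 < d") (simp_all only: if_True if_False mult_zero_right simp_thms)
    qed
    also have "\<dots> = ennreal (exp (- c * ((h\<^sup>2 + h'\<^sup>2) / 2))) * ennreal (sqrt pi / (2 * a) * exp (- 2 * a * b))"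
      unfolding nn_integral_Cauchy_Schloemilch[OF a b, symmetric] by (intro nn_integral_cmult) measurable
    also have "\<dots> = ennreal (exp (- c * ((h\<^sup>2 + h'\<^sup>2) / 2)) * (sqrt pi / (2 * a) * exp (- 2 * a * b)))"
      using a by (intro ennreal_mult[symmetric]) auto
    also have "exp (- c * ((h\<^sup>2 + h'\<^sup>2) / 2)) * (sqrt pi / (2 * a) * exp (- 2 * a * b))
       = sqrt pi / (sqrt c * v i) * exp (- c * (max h h')\<^sup>2)"
    proof -
      \<comment> \<open>The term 2 a b turns the mean of the two squares into the larger one, as (x
        + y) / 2 + |x - y| / 2 is the maximum.\<close>
      have "2 * a * b = c * \<bar>h'\<^sup>2 - h\<^sup>2\<bar> / 2"
        using v c by (simp add: a_def b_def field_simps)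
      moreover have "(h\<^sup>2 + h'\<^sup>2) / 2 + \<bar>h'\<^sup>2 - h\<^sup>2\<bar> / 2 = (max h h')\<^sup>2"
      proof (cases "h \<le> h'")
        case True
        then have "h\<^sup>2 \<le> h'\<^sup>2" using h by (simp add: power_mono)
        with True show ?thesis by (simp add: max_def field_simps)
      next
        case False
        then have "h'\<^sup>2 \<le> h\<^sup>2" using h by (simp add: power_mono)
        with False show ?thesis by (simp add: max_def field_simps)
      qed
      ultimately have "- c * ((h\<^sup>2 + h'\<^sup>2) / 2) + - 2 * a * b = - c * (max h h')\<^sup>2"
        by (metis (no_types, opaque_lifting) add_diff_eq distrib_left minus_add_distrib mult_minus_left times_divide_eq_right)
      then have "exp (- c * ((h\<^sup>2 + h'\<^sup>2) / 2)) * exp (- 2 * a * b) = exp (- c * (max h h')\<^sup>2)"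
        by (simp only: exp_add[symmetric])
      then show ?thesis by (simp add: a_def mult_ac)
    qed
    also have "ennreal \<dots> = ?C * ?E h h'"
      using c v by (intro ennreal_mult) auto
    finally show ?thesis .
  qed
  have "Lambda_same M n v \<Psi> i = (\<integral>\<^sup>+\<omega>. num (?H \<omega>) \<partial>M)"
    unfolding Lambda_same_def using H by (intro nn_integral_cong_AE) (auto elim!: eventually_mono)
  also have "\<dots> = ennreal (4 * lam i * lam i * v i * v i) * (\<integral>\<^sup>+ h'. indicator {0..} h' * (\<integral>\<^sup>+ h. indicator {0..} h *
        ?G h h' \<partial>lborel) \<partial>lborel)"
    by (rule meeting_rate[OF i i shm]) (auto simp: meet_iff)
  also have "(\<integral>\<^sup>+ h'. indicator {0..} h' * (\<integral>\<^sup>+ h. indicator {0..} h *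
        ?G h h' \<partial>lborel) \<partial>lborel)
    = (\<integral>\<^sup>+ h'. ?C * (indicator {0..} h' * (\<integral>\<^sup>+ h. indicator {0..} h * ?E h h' \<partial>lborel)) \<partial>lborel)"
  proof (rule nn_integral_cong)
    fix h' :: real
    have "(\<integral>\<^sup>+ h. indicator {0..} h *
        ?G h h' \<partial>lborel)
      = (\<integral>\<^sup>+ h. ?C * (indicator {0..} h * ?E h h') \<partial>lborel)" if "0 \<le> h'"
    proof (rule nn_integral_cong_AE)
      show "AE h in lborel. indicator {0..} h *
        ?G h h'
        = ?C * (indicator {0..} h * ?E h h')"
        using AE_lborel_singleton[of h']
      proof eventually_elim
        case (elim h)
        show ?case
        proof (cases "0 \<le> h")
          case True
          show ?thesis unfolding gap[OF True that elim] using True by simp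
        qed simp
      qed
    qed
    also have "\<dots> = ?C * (\<integral>\<^sup>+ h. indicator {0..} h * ?E h h' \<partial>lborel)"
      by (intro nn_integral_cmult) measurable
    finally have *: "0 \<le> h' \<Longrightarrow> (\<integral>\<^sup>+ h. indicator {0..} h *
        ?G h h' \<partial>lborel)
      = ?C * (\<integral>\<^sup>+ h. indicator {0..} h * ?E h h' \<partial>lborel)" .
    show "indicator {0..} h' * (\<integral>\<^sup>+ h. indicator {0..} h *
        ?G h h' \<partial>lborel)
      = ?C * (indicator {0..} h' * (\<integral>\<^sup>+ h. indicator {0..} h * ?E h h' \<partial>lborel))"
    proof (cases "0 \<le> h'")
      case True
      show ?thesis unfolding *[OF True] using True by simp
    qed simp
  qed
  also have "\<dots> = ?C * ennreal (1 / c)"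
    unfolding nn_integral_exp_max_square[OF c, symmetric] by (intro nn_integral_cmult) measurable
  also have "ennreal (4 * lam i * lam i * v i * v i) * (?C * ennreal (1 / c))
    = ennreal (4 * lam i * lam i * v i * v i * (sqrt pi / (sqrt c * v i) * (1 / c)))"
    using v l c by (simp add: ennreal_mult[symmetric])
  also have "4 * lam i * lam i * v i * v i * (sqrt pi / (sqrt c * v i) * (1 / c)) = 4 * v i * sqrt lam_total / pi * (lam i / lam_total)\<^sup>2"
  proof -
    have st: "sqrt lam_total * sqrt lam_total = lam_total" "sqrt lam_total > 0" using L by auto
    have "sqrt pi / (sqrt c * v i) = 1 / (sqrt lam_total * v i)" by (simp add: c_def real_sqrt_mult)
    then have "4 * lam i * lam i * v i * v i * (sqrt pi / (sqrt c * v i) * (1 / c)) = 4 * (lam i)\<^sup>2 * v i / (sqrt lam_total * lam_total * pi)"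
      using v by (simp add: c_def power2_eq_square)
    also have "\<dots> = 4 * v i * sqrt lam_total / pi * (lam i / lam_total)\<^sup>2"
    proof -
      \<comment> \<open>With the total intensity written as s * s no square root is left, and the
        identity is one between rational functions of s.\<close>
      have "4 * x\<^sup>2 * w / (s * (s * s) * pi) = 4 * w * s / pi * (x / (s * s))\<^sup>2" if "0 < s" for x w s :: real
        using that by (simp add: power2_eq_square field_simps)
      from this[OF st(2), unfolded st(1)] show ?thesis .
    qed
    finally show ?thesis .
  qed
  finally show ?thesis .
qed

end

theorem theorem7p29:
  fixes M :: "'w measure" and n :: nat and lam v :: "nat \<Rightarrow> real"
    and \<Phi> :: "nat \<Rightarrow> 'w \<Rightarrow> station set"
  assumes "n \<ge> 1"
    and "\<forall>i\<in>{1..n}. lam i > 0"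
    and "\<forall>i\<in>{1..n}. v i > 0"
    and "\<forall>i j. 1 \<le> i \<longrightarrow> i < j \<longrightarrow> j \<le> n \<longrightarrow> v j < v i"
    and "indep_marked_PPPs M n lam \<Phi>"
  defines "L \<equiv> (\<Sum>i=1..n. lam i)"
  shows "(\<forall>i\<in>{1..n}. Lambda_same M n v \<Phi> i
            = ennreal (4 * v i * sqrt L / pi * (lam i / L)\<^sup>2))
     \<and> (\<forall>i\<in>{1..n}. \<forall>j\<in>{1..n}. i \<noteq> j \<longrightarrow>
            Lambda_cross M n v \<Phi> 1 i j = Lambda_cross M n v \<Phi> 2 j i \<and>
            Lambda_cross M n v \<Phi> 2 i j = Lambda_cross M n v \<Phi> 1 j i)
     \<and> (\<forall>i\<in>{1..n}. \<forall>j\<in>{1..n}. \<forall>k\<in>{1::nat, 2}. j < i \<longrightarrow>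
            Lambda_cross M n v \<Phi> k i j =
              ennreal (4 * lam i * lam j * v i * v j) *
              (\<integral>\<^sup>+ hj. indicator {0..} hj *
                 ((\<integral>\<^sup>+ hi. indicator {0..hj} hi *
                     (\<integral>\<^sup>+ t. indicator {t_star (v i) (v j) hj hi..} t *
                        ennreal (exp (- L * pi * hhat_sq k (v i) (v j) t hj hi)) \<partial>lborel) \<partial>lborel)
                + (\<integral>\<^sup>+ hi. indicator {hj..} hi *
                     (\<integral>\<^sup>+ t. indicator {0..} t *
                        ennreal (exp (- L * pi * hhat_sq k (v i) (v j) t hj hi)) \<partial>lborel) \<partial>lborel))
               \<partial>lborel))"
proof -
  from indep_marked_PPPs_imp_typed_poisson[OF assms(5) assms(2)]
  obtain \<Psi> where \<Psi>: "typed_poisson M n lam \<Psi>" and eq: "AE \<omega> in M. \<forall>i\<in>{1..n}. \<Psi> i \<omega> = \<Phi> i \<omega>" .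
  interpret typed_poisson M n lam \<Psi> by (rule \<Psi>)
  interpret stations M n lam \<Psi> v by unfold_locales (use assms(3) in auto)
  have L: "lam_total = L" by (simp add: lam_total_def L_def)
  have near: "is_nearest n v \<Psi> \<omega> i a t \<longleftrightarrow> is_nearest n v \<Phi> \<omega> i a t"
    if "\<forall>i\<in>{1..n}. \<Psi> i \<omega> = \<Phi> i \<omega>" for \<omega> i a t
  proof -
    have "{dist_at (v i) s t | i s. i \<in> {1..n} \<and> s \<in> \<Psi> i \<omega>} = {dist_at (v i) s t | i s. i \<in> {1..n} \<and> s \<in> \<Phi> i \<omega>}"
      using that by blast
    then show ?thesis by (simp only: is_nearest_def nearest_dist_def)
  qed
  \<comment> \<open>The intensities are compared through handover sets that agree almost surely, so
    measurability of their counts is not at issue.\<close>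
  have same: "Lambda_same M n v \<Phi> i = Lambda_same M n v \<Psi> i" if "i \<in> {1..n}" for i
    unfolding Lambda_same_def
  proof (rule nn_integral_cong_AE, use eq in eventually_elim)
    case (elim \<omega>)
    then show ?case using that by (simp only: handovers_same_def near)
  qed
  have cross: "Lambda_cross M n v \<Phi> k i j = Lambda_cross M n v \<Psi> k i j" if "i \<in> {1..n}" "j \<in> {1..n}" for k i j
    unfolding Lambda_cross_def
  proof (rule nn_integral_cong_AE, use eq in eventually_elim)
    case (elim \<omega>)
    then show ?case using that by (simp only: handovers_cross_def near)
  qed
  \<comment> \<open>Speeds decrease with the index, so j < i makes type i the slower one.\<close>
  have less: "v i < v j" if "i \<in> {1..n}" "j \<in> {1..n}" "j < i" for i j
    using assms(4) that by auto
  have neq: "v i \<noteq> v j" if "i \<in> {1..n}" "j \<in> {1..n}" "i \<noteq> j" for i j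
    using less[of i j] less[of j i] that by (metis neq_iff order_less_irrefl)
  show ?thesis
  proof (intro conjI ballI impI, goal_cases)
    case (1 i)
    then show ?case unfolding same[OF 1] L[symmetric] by (rule same_rate)
  next
    case (2 i j)
    then show ?case using cross_rate_commute[OF 2(1,2) neq[OF 2], of 1] cross by simp
  next
    case (3 i j)
    then show ?case using cross_rate_commute[OF 3(1,2) neq[OF 3], of 2] cross by simp
  next
    case (4 i j k)
    show ?case
      unfolding cross[OF 4(1,2)] L[symmetric] by (rule cross_rate_integral[OF 4(1,2) less[OF 4(1,2,4)] 4(3)])
  qed
qed

end
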